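(* Let $\mathbb K$ be a field and $\triangle$ a simplicial complex on a finite vertex set, with simplicial binoid $M_\triangle$ and Stanley-Reisner ring $\mathbb K[\triangle]=\mathbb K[M_\triangle]$. In the combinatorial topology of $\operatorname{Spec}^\bullet\mathbb K[M_\triangle]$ the sheaf of units splits as \[ \mathcal O^*_{\mathbb K[\triangle]}=\mathbb K^*\oplus i_*\mathcal O^*_{M_\triangle}, \] where $\mathbb K^*$ is the constant sheaf.
   Context: A simplicial complex on $V=[n]$ is a collection $\triangle$ of subsets (faces) of $V$ closed under taking subsets, with all singletons assumed to be faces. A (commutative) binoid is a commutative monoid $(M,+,0)$ with an absorbing element $\infty$. The simplicial binoid $M_\triangle$ is the binoid with generators $x_1,\dots,x_n$ and relations $x_{i_1}+\dots+x_{i_k}=\infty$ for every $\{i_1,\dots,i_k\}\subseteq[n]$ that is not a face. A prime ideal of a binoid $M$ is a subset $\mathfrak p\ni\infty$ with $\mathfrak p+M\subseteq\mathfrak p$ and $M\smallsetminus\mathfrak p$ a submonoid; $\operatorname{Spec}M$ is the set of primes with basis of open sets $D(f)=\{\mathfrak p\mid f\notin\mathfrak p\}$; $\mathcal O_M$ is the sheaf of binoids with $\mathcal O_M(D(f))=M_f$ and $\mathcal O_M^*$ its sheaf of units. $M_+$ is the ideal of non-units. The binoid algebra $\mathbb K[M]$ has $\mathbb K$-basis $\{T^a\mid a\in M,\ a\neq\infty\}$ and multiplication $T^aT^b=T^{a+b}$, $T^\infty=0$; $\mathbb K[M_\triangle]$ is the Stanley-Reisner ring $\mathbb K[X_1,\dots,X_n]/I_\triangle$,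 with $I_\triangle$ generated by the monomials $\prod_{i\in F}X_i$ for non-faces $F$. For an ideal $I$ of $M$, $\mathbb K[I]$ is the ideal spanned by $T^a$, $a\in I$; such ideals are called combinatorial. $\operatorname{Spec}^\bullet\mathbb K[M]=\operatorname{Spec}\mathbb K[M]\smallsetminus\{\mathbb K[M_+]\}$. The map $i:\operatorname{Spec}M\to\operatorname{Spec}\mathbb K[M]$, $\mathfrak p\mapsto\mathbb K[\mathfrak p]$, is continuous, and restricts to the punctured spectra. The combinatorial topology has as open sets the $D(\mathfrak A)$ with $\mathfrak A$ a combinatorial ideal. The statement is about the restrictions of the Zariski sheaves $\mathcal O^*_{\mathbb K[\triangle]}$, $\mathbb K^*$ and $i_*\mathcal O^*_{M_\triangle}$ to the combinatorial open subsets of $\operatorname{Spec}^\bullet\mathbb K[M_\triangle]$, as sheaves of abelian groups. *)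

theory Defs
  imports "HOL-Algebra.Ideal" "HOL-Analysis.Function_Topology" "HOL-Library.Multiset"
    "HOL-Library.Poly_Mapping"
begin

section \<open>Simplicial complexes and binoids\<close>

definition abstract_simplicial_complex :: "'v set \<Rightarrow> 'v set set \<Rightarrow> bool" where
  "abstract_simplicial_complex V \<Delta> \<longleftrightarrow>
     finite V \<and> \<Delta> \<subseteq> Pow V \<and> (\<forall>F\<in>\<Delta>. \<forall>G. G \<subseteq> F \<longrightarrow> G \<in> \<Delta>) \<and> (\<forall>v\<in>V. {v} \<in> \<Delta>)"

text \<open>
  Binoids are written multiplicatively, so that the library of commutative monoids applies: the
  operation $+$ of the binoid is the record field \<^const>\<open>monoid.mult\<close>, its neutral element $0$ is
  \<^const>\<open>one\<close>.
\<close>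

record 'a binoid = "'a monoid" +
  infty :: 'a

locale binoid = comm_monoid M for M :: "'a binoid" (structure) +
  assumes infty_closed [simp, intro]: "infty M \<in> carrier M"
    and infty_absorb [simp]: "x \<in> carrier M \<Longrightarrow> x \<otimes> infty M = infty M"

text \<open>
  The free commutative binoid on \<open>V\<close>: finite multisets of elements of \<open>V\<close>, and \<^term>\<open>None\<close> as
  absorbing element. The multiset \<open>{#i\<^sub>1, \<dots>, i\<^sub>k#}\<close> is $x_{i_1} + \dots + x_{i_k}$.
\<close>

definition free_binoid :: "'v set \<Rightarrow> 'v multiset option binoid" where
  "free_binoid V =
    \<lparr>carrier = insert None (Some ` {m. set_mset m \<subseteq> V}),
     monoid.mult = (\<lambda>x y. case (x, y) of (Some m, Some k) \<Rightarrow> Some (m + k) | _ \<Rightarrow> None),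
     one = Some {#},
     infty = None\<rparr>"

text \<open>The congruence on \<open>M\<close> generated by a set \<open>E\<close> of relations.\<close>

inductive_set generated_congruence :: "('a, 'b) monoid_scheme \<Rightarrow> ('a \<times> 'a) set \<Rightarrow> ('a \<times> 'a) set"
  for M (structure) and E where
    base: "(x, y) \<in> E \<Longrightarrow> x \<in> carrier M \<Longrightarrow> y \<in> carrier M \<Longrightarrow> (x, y) \<in> generated_congruence M E"
  | refl: "x \<in> carrier M \<Longrightarrow> (x, x) \<in> generated_congruence M E"
  | sym: "(x, y) \<in> generated_congruence M E \<Longrightarrow> (y, x) \<in> generated_congruence M E"
  | trans: "(x, y) \<in> generated_congruence M E \<Longrightarrow> (y, z) \<in> generated_congruence M E
      \<Longrightarrow> (x, z) \<in> generated_congruence M E"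
  | cong: "(x, y) \<in> generated_congruence M E \<Longrightarrow> z \<in> carrier M
      \<Longrightarrow> (x \<otimes> z, y \<otimes> z) \<in> generated_congruence M E"

definition quotient_binoid :: "'a binoid \<Rightarrow> ('a \<times> 'a) set \<Rightarrow> 'a set binoid" where
  "quotient_binoid M r =
    \<lparr>carrier = carrier M // r,
     monoid.mult = (\<lambda>X Y. \<Union>x\<in>X. \<Union>y\<in>Y. r `` {x \<otimes>\<^bsub>M\<^esub> y}),
     one = r `` {\<one>\<^bsub>M\<^esub>},
     infty = r `` {infty M}\<rparr>"

definition simplicial_binoid :: "'v set \<Rightarrow> 'v set set \<Rightarrow> 'v multiset option set binoid" where
  "simplicial_binoid V \<Delta> = quotient_binoid (free_binoid V)
     (generated_congruence (free_binoid V) {(Some (mset_set F), None) | F. F \<subseteq> V \<and> F \<notin> \<Delta>})"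

lemma binoid_free_binoid: "binoid (free_binoid V)"
  by unfold_locales
    (auto simp: free_binoid_def Units_def add.assoc add.commute split: option.splits)

lemma (in binoid) generated_congruence_subset:
  assumes "(x, y) \<in> generated_congruence M E"
  shows "x \<in> carrier M \<and> y \<in> carrier M"
  using assms by induction auto

lemma (in binoid) equiv_generated_congruence: "equiv (carrier M) (generated_congruence M E)"
  by (rule equivI)
    (auto simp: refl_on_def sym_def trans_def dest: generated_congruence_subset
      intro: generated_congruence.intros(2-4))

lemma (in binoid) generated_congruence_mult:
  assumes "(x, x') \<in> generated_congruence M E" "(y, y') \<in> generated_congruence M E"
  shows "(x \<otimes> y, x' \<otimes> y') \<in> generated_congruence M E"
proof -
  note car = generated_congruence_subset[OF assms(1)] generated_congruence_subset[OF assms(2)]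
  have "(x \<otimes> y, x' \<otimes> y) \<in> generated_congruence M E"
    using assms(1) car by (intro generated_congruence.cong) auto
  moreover have "(y \<otimes> x', y' \<otimes> x') \<in> generated_congruence M E"
    using assms(2) car by (intro generated_congruence.cong) auto
  ultimately show ?thesis
    using car m_comm[of x' y] m_comm[of x' y'] by (auto intro: generated_congruence.trans)
qed

lemma (in binoid) quotient_binoid_mult_class:
  fixes E
  defines "r \<equiv> generated_congruence M E"
  assumes "x \<in> carrier M" "y \<in> carrier M"
  shows "r `` {x} \<otimes>\<^bsub>quotient_binoid M r\<^esub> r `` {y} = r `` {x \<otimes> y}"
proof -
  have "congruent2 r r (\<lambda>x y. r `` {x \<otimes> y})"
    unfolding congruent2_def r_def
    by (clarify, rule equiv_class_eq[OF equiv_generated_congruence], rule generated_congruence_mult)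
  then show ?thesis
    using UN_equiv_class2[OF equiv_generated_congruence equiv_generated_congruence] assms
    by (simp add: quotient_binoid_def)
qed

lemma (in binoid) binoid_quotient_binoid: "binoid (quotient_binoid M (generated_congruence M E))"
proof -
  define r where "r = generated_congruence M E"
  let ?Q = "quotient_binoid M r"
  have car: "carrier ?Q = (\<lambda>x. r `` {x}) ` carrier M" "\<one>\<^bsub>?Q\<^esub> = r `` {\<one>}" "infty ?Q = r `` {infty M}"
    by (auto simp: quotient_binoid_def quotient_def)
  note mult = quotient_binoid_mult_class[of _ _ E, folded r_def]
  have "comm_monoid ?Q"
    by (rule comm_monoidI) (auto simp: car mult m_assoc, (metis m_comm)+)
  moreover have "binoid_axioms ?Q"
    by (rule binoid_axioms.intro) (auto simp: car mult)
  ultimately show ?thesis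
    unfolding r_def by (rule binoid.intro)
qed

lemma binoid_simplicial_binoid: "binoid (simplicial_binoid V \<Delta>)"
  unfolding simplicial_binoid_def by (intro binoid.binoid_quotient_binoid binoid_free_binoid)

definition binoid_ideal :: "'a binoid \<Rightarrow> 'a set \<Rightarrow> bool" where
  "binoid_ideal M I \<longleftrightarrow> I \<subseteq> carrier M \<and> infty M \<in> I \<and> (\<forall>a\<in>I. \<forall>x\<in>carrier M. a \<otimes>\<^bsub>M\<^esub> x \<in> I)"

definition binoid_prime :: "'a binoid \<Rightarrow> 'a set \<Rightarrow> bool" where
  "binoid_prime M p \<longleftrightarrow> binoid_ideal M p \<and> submonoid (carrier M - p) M"

definition binoid_spec :: "'a binoid \<Rightarrow> 'a set set" where
  "binoid_spec M = {p. binoid_prime M p}"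

definition binoid_spec_topology :: "'a binoid \<Rightarrow> 'a set topology" where
  "binoid_spec_topology M =
     topology_generated_by {{p \<in> binoid_spec M. f \<notin> p} | f. f \<in> carrier M}"

text \<open>The ideal $M_+$ of non-units.\<close>

definition nonunits :: "('a, 'b) monoid_scheme \<Rightarrow> 'a set" where
  "nonunits M = carrier M - Units M"

definition punctured_binoid_spec :: "'a binoid \<Rightarrow> 'a set set" where
  "punctured_binoid_spec M = binoid_spec M - {nonunits M}"


section \<open>The binoid algebra\<close>

text \<open>
  \<open>bmonom M a c\<close> is $c T^a$, with the convention $T^\infty = 0$.
\<close>

definition bmonom :: "'a binoid \<Rightarrow> 'a \<Rightarrow> 'k \<Rightarrow> 'a \<Rightarrow>\<^sub>0 'k::field" where
  "bmonom M a c = (if a = infty M then 0 else Poly_Mapping.single a c)"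

definition binoid_algebra :: "'a binoid \<Rightarrow> ('a \<Rightarrow>\<^sub>0 'k::field) ring" where
  "binoid_algebra M =
    \<lparr>carrier = {f. Poly_Mapping.keys f \<subseteq> carrier M - {infty M}},
     monoid.mult = (\<lambda>f g. \<Sum>a\<in>Poly_Mapping.keys f. \<Sum>b\<in>Poly_Mapping.keys g.
       bmonom M (a \<otimes>\<^bsub>M\<^esub> b) (Poly_Mapping.lookup f a * Poly_Mapping.lookup g b)),
     one = bmonom M \<one>\<^bsub>M\<^esub> 1,
     zero = 0,
     add = (+)\<rparr>"

text \<open>$\mathbb K[I]$: the span of the $T^a$ with $a \in I$.\<close>

definition combinatorial_ideal :: "'a binoid \<Rightarrow> 'a set \<Rightarrow> ('a \<Rightarrow>\<^sub>0 'k::field) set" where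
  "combinatorial_ideal M I = {f. Poly_Mapping.keys f \<subseteq> I - {infty M}}"


section \<open>Spectra of rings and the combinatorial topology\<close>

definition ring_spec :: "('a, 'b) ring_scheme \<Rightarrow> 'a set set" where
  "ring_spec R = {P. primeideal P R}"

definition zariski :: "('a, 'b) ring_scheme \<Rightarrow> 'a set topology" where
  "zariski R = topology_generated_by {{P \<in> ring_spec R. f \<notin> P} | f. f \<in> carrier R}"

definition punctured_algebra_spec :: "'a binoid \<Rightarrow> ('a \<Rightarrow>\<^sub>0 'k::field) set set" where
  "punctured_algebra_spec M = ring_spec (binoid_algebra M) - {combinatorial_ideal M (nonunits M)}"

definition combinatorial_open ::
  "'a binoid \<Rightarrow> 'a set \<Rightarrow> ('a \<Rightarrow>\<^sub>0 'k::field) set set" where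
  "combinatorial_open M I =
     {P \<in> punctured_algebra_spec M. \<not> combinatorial_ideal M I \<subseteq> P}"

text \<open>
  The combinatorial topology on the punctured spectrum of $\mathbb K[M]$; see
  \<open>openin_combinatorial_topology\<close> below.
\<close>

definition combinatorial_topology :: "'a binoid \<Rightarrow> ('a \<Rightarrow>\<^sub>0 'k::field) set topology" where
  "combinatorial_topology M =
     topology (\<lambda>U. \<exists>I. binoid_ideal M I \<and> U = combinatorial_open M I)"


subsection \<open>Basic facts\<close>

lemma bmonom_zero [simp]: "bmonom M a 0 = 0"
  by (simp add: bmonom_def)

lemma bmonom_infty [simp]: "bmonom M (infty M) c = 0"
  by (simp add: bmonom_def)

lemma bmonom_add: "bmonom M a (c + d) = bmonom M a c + bmonom M a d"
  by (simp add: bmonom_def single_add)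

lemma bmonom_closed: "a \<in> carrier M \<Longrightarrow> bmonom M a c \<in> carrier (binoid_algebra M)"
  by (auto simp: bmonom_def binoid_algebra_def)

lemma zero_binoid_algebra [simp]: "\<zero>\<^bsub>binoid_algebra M\<^esub> = 0"
  and add_binoid_algebra [simp]: "f \<oplus>\<^bsub>binoid_algebra M\<^esub> g = f + g"
  and one_binoid_algebra [simp]: "\<one>\<^bsub>binoid_algebra M\<^esub> = bmonom M \<one>\<^bsub>M\<^esub> 1"
  by (simp_all add: binoid_algebra_def)

lemma carrier_binoid_algebra_add:
  assumes "f \<in> carrier (binoid_algebra M)" "g \<in> carrier (binoid_algebra M)"
  shows "f + g \<in> carrier (binoid_algebra M)"
  using assms keys_add[of f g] by (auto simp: binoid_algebra_def)

lemma binoid_algebra_mult_superset: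
  assumes "finite A" "finite B" "Poly_Mapping.keys f \<subseteq> A" "Poly_Mapping.keys g \<subseteq> B"
  shows "f \<otimes>\<^bsub>binoid_algebra M\<^esub> g = (\<Sum>a\<in>A. \<Sum>b\<in>B.
       bmonom M (a \<otimes>\<^bsub>M\<^esub> b) (Poly_Mapping.lookup f a * Poly_Mapping.lookup g b))"
proof -
  have "(\<Sum>a\<in>A. \<Sum>b\<in>B. bmonom M (a \<otimes>\<^bsub>M\<^esub> b) (Poly_Mapping.lookup f a * Poly_Mapping.lookup g b))
      = (\<Sum>a\<in>A. \<Sum>b\<in>Poly_Mapping.keys g.
           bmonom M (a \<otimes>\<^bsub>M\<^esub> b) (Poly_Mapping.lookup f a * Poly_Mapping.lookup g b))"
    using assms by (intro sum.cong sum.mono_neutral_right refl) (auto simp: in_keys_iff)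
  also have "\<dots> = (\<Sum>a\<in>Poly_Mapping.keys f. \<Sum>b\<in>Poly_Mapping.keys g.
           bmonom M (a \<otimes>\<^bsub>M\<^esub> b) (Poly_Mapping.lookup f a * Poly_Mapping.lookup g b))"
    using assms by (intro sum.mono_neutral_right) (auto simp: in_keys_iff)
  finally show ?thesis
    by (simp add: binoid_algebra_def)
qed

lemma binoid_algebra_distrib_left:
  "(f + g) \<otimes>\<^bsub>binoid_algebra M\<^esub> h = f \<otimes>\<^bsub>binoid_algebra M\<^esub> h + g \<otimes>\<^bsub>binoid_algebra M\<^esub> h"
proof -
  let ?A = "Poly_Mapping.keys f \<union> Poly_Mapping.keys g"
  have "Poly_Mapping.keys (f + g) \<subseteq> ?A" by (rule keys_add)
  then show ?thesis
    by (simp add: binoid_algebra_mult_superset[of ?A "Poly_Mapping.keys h"] lookup_add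
        distrib_right bmonom_add sum.distrib)
qed

lemma binoid_algebra_distrib_right:
  "h \<otimes>\<^bsub>binoid_algebra M\<^esub> (f + g) = h \<otimes>\<^bsub>binoid_algebra M\<^esub> f + h \<otimes>\<^bsub>binoid_algebra M\<^esub> g"
proof -
  let ?A = "Poly_Mapping.keys f \<union> Poly_Mapping.keys g"
  have "Poly_Mapping.keys (f + g) \<subseteq> ?A" by (rule keys_add)
  then show ?thesis
    by (simp add: binoid_algebra_mult_superset[of "Poly_Mapping.keys h" ?A] lookup_add
        distrib_left bmonom_add sum.distrib)
qed

lemma binoid_algebra_mult_zero [simp]:
  "0 \<otimes>\<^bsub>binoid_algebra M\<^esub> h = 0" "h \<otimes>\<^bsub>binoid_algebra M\<^esub> 0 = 0"
  by (simp_all add: binoid_algebra_def)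

lemma (in binoid) bmonom_mult:
  assumes "a \<in> carrier M" "b \<in> carrier M"
  shows "bmonom M a c \<otimes>\<^bsub>binoid_algebra M\<^esub> bmonom M b d = bmonom M (a \<otimes> b) (c * d)"
proof -
  have "infty M \<otimes> b = infty M"
    using m_comm[of b "infty M"] assms by simp
  then show ?thesis
    using assms by (auto simp: bmonom_def binoid_algebra_def)
qed

lemma binoid_algebra_induct [consumes 1, case_names zero add]:
  assumes "f \<in> carrier (binoid_algebra M)"
    and "P 0"
    and step: "\<And>a c f. \<lbrakk>a \<in> carrier M; a \<noteq> infty M; f \<in> carrier (binoid_algebra M); P f\<rbrakk>
      \<Longrightarrow> P (bmonom M a c + f)"
  shows "P f"
  using assms(1)
proof (induction f rule: update_induct)
  case const
  show ?case by (rule assms(2))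
next
  case (update f a b)
  have eq: "Poly_Mapping.update a b f = Poly_Mapping.single a b + f"
    using update(1) by (intro poly_mapping_eqI)
      (auto simp: lookup_update lookup_add lookup_single in_keys_iff when_def)
  have "Poly_Mapping.keys (Poly_Mapping.update a b f) = insert a (Poly_Mapping.keys f)"
    using update(2) by (auto simp: in_keys_iff lookup_update split: if_splits)
  then have "a \<in> carrier M" "a \<noteq> infty M" "f \<in> carrier (binoid_algebra M)"
    using update.prems by (auto simp: binoid_algebra_def)
  then show ?case
    using step[of a f b] update.IH eq by (simp add: bmonom_def)
qed

lemma (in binoid) cring_binoid_algebra: "cring (binoid_algebra M :: ('a \<Rightarrow>\<^sub>0 'k::field) ring)"
proof -
  let ?R = "binoid_algebra M :: ('a \<Rightarrow>\<^sub>0 'k) ring"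
  have zero: "0 \<in> carrier ?R" by (simp add: binoid_algebra_def)
  have closed: "f \<otimes>\<^bsub>?R\<^esub> g \<in> carrier ?R" if f: "f \<in> carrier ?R" and g: "g \<in> carrier ?R" for f g
    using f
  proof (induction f rule: binoid_algebra_induct)
    case (add a c f)
    have "bmonom M a c \<otimes>\<^bsub>?R\<^esub> g \<in> carrier ?R"
      using g add(1)
      by (induction g rule: binoid_algebra_induct)
        (auto simp: zero binoid_algebra_distrib_right bmonom_mult intro!: carrier_binoid_algebra_add bmonom_closed)
    then show ?case
      using add by (simp add: binoid_algebra_distrib_left carrier_binoid_algebra_add)
  qed (simp add: zero)
  have comm: "f \<otimes>\<^bsub>?R\<^esub> g = g \<otimes>\<^bsub>?R\<^esub> f" if f: "f \<in> carrier ?R" and g: "g \<in> carrier ?R" for f g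
    using f
  proof (induction f rule: binoid_algebra_induct)
    case (add a c f)
    have "bmonom M a c \<otimes>\<^bsub>?R\<^esub> g = g \<otimes>\<^bsub>?R\<^esub> bmonom M a c"
      using g add(1)
      by (induction g rule: binoid_algebra_induct)
        (auto simp: binoid_algebra_distrib_left binoid_algebra_distrib_right bmonom_mult m_comm mult.commute)
    then show ?case
      using add by (simp add: binoid_algebra_distrib_left binoid_algebra_distrib_right)
  qed simp
  have assoc2: "(bmonom M a c \<otimes>\<^bsub>?R\<^esub> bmonom M b d) \<otimes>\<^bsub>?R\<^esub> h = bmonom M a c \<otimes>\<^bsub>?R\<^esub> (bmonom M b d \<otimes>\<^bsub>?R\<^esub> h)"
    if "a \<in> carrier M" "b \<in> carrier M" and h: "h \<in> carrier ?R" for a b c d h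
    using h that(1,2)
    by (induction h rule: binoid_algebra_induct)
      (auto simp: binoid_algebra_distrib_right bmonom_mult m_assoc mult.assoc)
  have assoc1: "(bmonom M a c \<otimes>\<^bsub>?R\<^esub> g) \<otimes>\<^bsub>?R\<^esub> h = bmonom M a c \<otimes>\<^bsub>?R\<^esub> (g \<otimes>\<^bsub>?R\<^esub> h)"
    if "a \<in> carrier M" and g: "g \<in> carrier ?R" and h: "h \<in> carrier ?R" for a c g h
    using g that(1) h
    by (induction g rule: binoid_algebra_induct)
      (auto simp: binoid_algebra_distrib_right binoid_algebra_distrib_left assoc2)
  have assoc: "(f \<otimes>\<^bsub>?R\<^esub> g) \<otimes>\<^bsub>?R\<^esub> h = f \<otimes>\<^bsub>?R\<^esub> (g \<otimes>\<^bsub>?R\<^esub> h)"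
    if f: "f \<in> carrier ?R" and g: "g \<in> carrier ?R" and h: "h \<in> carrier ?R" for f g h
    using f g h
    by (induction f rule: binoid_algebra_induct) (auto simp: binoid_algebra_distrib_left assoc1)
  have one: "bmonom M \<one> 1 \<otimes>\<^bsub>?R\<^esub> f = f" if "f \<in> carrier ?R" for f
    using that
    by (induction f rule: binoid_algebra_induct) (auto simp: binoid_algebra_distrib_right bmonom_mult)
  have neg: "\<exists>g\<in>carrier ?R. f + g = 0" if "f \<in> carrier ?R" for f
    using that by (intro bexI[of _ "- f"]) (auto simp: binoid_algebra_def)
  show ?thesis
  proof (rule cringI)
    show "abelian_group ?R"
      by (rule abelian_groupI) (simp_all add: zero carrier_binoid_algebra_add neg add.assoc add.commute)
    show "comm_monoid ?R"
      by (rule comm_monoidI) (simp_all add: closed assoc one bmonom_closed, simp add: comm)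
  qed (simp add: binoid_algebra_distrib_left)
qed

lemma (in binoid) combinatorial_ideal_subset_iff:
  fixes P :: "('a \<Rightarrow>\<^sub>0 'k::field) set"
  assumes P: "ideal P (binoid_algebra M)" and I: "I \<subseteq> carrier M"
  shows "combinatorial_ideal M I \<subseteq> P \<longleftrightarrow> (\<forall>a\<in>I. bmonom M a 1 \<in> P)"
proof
  interpret P: ideal P "binoid_algebra M" by fact
  assume *: "\<forall>a\<in>I. bmonom M a 1 \<in> P"
  show "combinatorial_ideal M I \<subseteq> P"
  proof
    fix f :: "'a \<Rightarrow>\<^sub>0 'k"
    assume f: "f \<in> combinatorial_ideal M I"
    have mon: "bmonom M a c \<in> P" if "a \<in> I" for a c
    proof -
      have a: "a \<in> carrier M" using that I by auto
      have "bmonom M \<one> c \<otimes>\<^bsub>binoid_algebra M\<^esub> bmonom M a 1 \<in> P"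
        using * that by (intro P.I_l_closed bmonom_closed) auto
      then show ?thesis using a by (simp add: bmonom_mult)
    qed
    show "f \<in> P"
      using f
    proof (induction f rule: update_induct)
      case const
      then show ?case using P.additive_subgroup_axioms additive_subgroup.zero_closed by fastforce
    next
      case (update f a b)
      have eq: "Poly_Mapping.update a b f = Poly_Mapping.single a b + f"
        using update(1) by (intro poly_mapping_eqI)
          (auto simp: lookup_update lookup_add lookup_single in_keys_iff when_def)
      have "Poly_Mapping.keys (Poly_Mapping.update a b f) = insert a (Poly_Mapping.keys f)"
        using update(2) by (auto simp: in_keys_iff lookup_update split: if_splits)
      then have "a \<in> I" "a \<noteq> infty M" "f \<in> combinatorial_ideal M I"
        using update.prems by (auto simp: combinatorial_ideal_def)
      then show ?case
        using update.IH mon[of a b] eq additive_subgroup.a_closed[OF P.is_additive_subgroup, of "bmonom M a b" f] by (simp add: bmonom_def)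
    qed
  qed
qed (auto simp: combinatorial_ideal_def bmonom_def)

lemma (in binoid) combinatorial_open_eq:
  assumes "binoid_ideal M I"
  shows "combinatorial_open M I = {P \<in> punctured_algebra_spec M. \<exists>a\<in>I. bmonom M a 1 \<notin> P}"
proof -
  have "combinatorial_ideal M I \<subseteq> P \<longleftrightarrow> (\<forall>a\<in>I. bmonom M a 1 \<in> P)"
    if "P \<in> punctured_algebra_spec M" for P :: "('a \<Rightarrow>\<^sub>0 'b::field) set"
    using that assms
    by (intro combinatorial_ideal_subset_iff)
      (auto simp: punctured_algebra_spec_def ring_spec_def binoid_ideal_def primeideal_def)
  then show ?thesis
    by (auto simp: combinatorial_open_def)
qed

lemma (in binoid) openin_combinatorial_topology:
  fixes U :: "('a \<Rightarrow>\<^sub>0 'k::field) set set"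
  shows "openin (combinatorial_topology M) U \<longleftrightarrow>
    (\<exists>I. binoid_ideal M I \<and> U = combinatorial_open M I)"
proof -
  have "istopology (\<lambda>U :: ('a \<Rightarrow>\<^sub>0 'k) set set. \<exists>I. binoid_ideal M I \<and> U = combinatorial_open M I)"
    unfolding istopology_def
  proof safe
    fix I J
    assume I: "binoid_ideal M I" and J: "binoid_ideal M J"
    have IJ: "binoid_ideal M (I \<inter> J)"
      using I J by (auto simp: binoid_ideal_def)
    have "(\<exists>c\<in>I \<inter> J. bmonom M c 1 \<notin> P) \<longleftrightarrow> (\<exists>a\<in>I. bmonom M a 1 \<notin> P) \<and> (\<exists>b\<in>J. bmonom M b 1 \<notin> P)"
      if P: "P \<in> punctured_algebra_spec M" for P :: "('a \<Rightarrow>\<^sub>0 'k) set"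
    proof
      assume "(\<exists>a\<in>I. bmonom M a 1 \<notin> P) \<and> (\<exists>b\<in>J. bmonom M b 1 \<notin> P)"
      then obtain a b
        where ab: "a \<in> I" "b \<in> J" "bmonom M a 1 \<notin> P" "bmonom M b 1 \<notin> P"
        by blast
      then have car: "a \<in> carrier M" "b \<in> carrier M"
        using I J by (auto simp: binoid_ideal_def)
      have "primeideal P (binoid_algebra M)"
        using P by (simp add: punctured_algebra_spec_def ring_spec_def)
      then have "bmonom M (a \<otimes> b) 1 \<notin> P"
        using ab car primeideal.I_prime[of P "binoid_algebra M" "bmonom M a 1" "bmonom M b 1"]
        by (auto simp: bmonom_closed bmonom_mult)
      moreover have "a \<otimes> b \<in> I \<inter> J"
        using I J ab car m_comm[of a b] unfolding binoid_ideal_def by (metis IntI)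
      ultimately show "\<exists>c\<in>I \<inter> J. bmonom M c 1 \<notin> P" by blast
    qed blast
    then have "combinatorial_open M I \<inter> combinatorial_open M J
        = (combinatorial_open M (I \<inter> J) :: ('a \<Rightarrow>\<^sub>0 'k) set set)"
      using I J IJ by (auto simp: combinatorial_open_eq)
    with IJ show "\<exists>K. binoid_ideal M K \<and>
        combinatorial_open M I \<inter> combinatorial_open M J
        = (combinatorial_open M K :: ('a \<Rightarrow>\<^sub>0 'k) set set)"
      by blast
  next
    fix \<U> :: "('a \<Rightarrow>\<^sub>0 'k) set set set"
    assume \<U>: "\<forall>U\<in>\<U>. \<exists>I. binoid_ideal M I \<and> U = combinatorial_open M I"
    define K where "K = insert (infty M)
      (\<Union>{I. binoid_ideal M I \<and> (combinatorial_open M I :: ('a \<Rightarrow>\<^sub>0 'k) set set) \<in> \<U>})"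
    have absorb: "infty M \<otimes> x = infty M" if "x \<in> carrier M" for x
      using that m_comm[of x "infty M"] by simp
    have "binoid_ideal M (insert (infty M) (\<Union>\<J>))" if "\<forall>I\<in>\<J>. binoid_ideal M I" for \<J>
      using that absorb unfolding binoid_ideal_def by blast
    then have K: "binoid_ideal M K"
      by (simp add: K_def)
    have infty: "bmonom M (infty M) 1 \<in> P" if "P \<in> punctured_algebra_spec M"
      for P :: "('a \<Rightarrow>\<^sub>0 'k) set"
    proof -
      have "primeideal P (binoid_algebra M)"
        using that by (simp add: punctured_algebra_spec_def ring_spec_def)
      then have "additive_subgroup P (binoid_algebra M)"
        by (rule ideal.axioms(1)[OF primeideal.axioms(1)])
      from additive_subgroup.zero_closed[OF this] show ?thesis
        by simp
    qed
    have "\<Union>\<U> = combinatorial_open M K"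
    proof (rule Set.set_eqI)
      fix P :: "('a \<Rightarrow>\<^sub>0 'k) set"
      show "P \<in> \<Union>\<U> \<longleftrightarrow> P \<in> combinatorial_open M K"
      proof
        assume "P \<in> \<Union>\<U>"
        then obtain I where I: "binoid_ideal M I" "combinatorial_open M I \<in> \<U>"
            "P \<in> combinatorial_open M I"
          using \<U> by force
        then obtain a where "P \<in> punctured_algebra_spec M" "a \<in> I" "bmonom M a 1 \<notin> P"
          by (auto simp: combinatorial_open_eq)
        moreover have "a \<in> K"
          using I \<open>a \<in> I\<close> by (auto simp: K_def)
        ultimately show "P \<in> combinatorial_open M K"
          unfolding combinatorial_open_eq[OF K] by blast
      next
        assume "P \<in> combinatorial_open M K"
        then obtain a where a: "P \<in> punctured_algebra_spec M" "a \<in> K" "bmonom M a 1 \<notin> P"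
          unfolding combinatorial_open_eq[OF K] by blast
        then have "a \<noteq> infty M"
          using infty by blast
        then obtain I where I: "binoid_ideal M I" "combinatorial_open M I \<in> \<U>" "a \<in> I"
          using a by (auto simp: K_def)
        then have "P \<in> combinatorial_open M I"
          using a by (auto simp: combinatorial_open_eq)
        with I show "P \<in> \<Union>\<U>"
          by blast
      qed
    qed
    with K show "\<exists>K. binoid_ideal M K \<and> \<Union>\<U> = combinatorial_open M K"
      by (intro exI[of _ K] conjI)
  qed
  then show ?thesis
    by (simp add: combinatorial_topology_def)
qed



section \<open>Localization\<close>

text \<open>
  The fraction $a/s$, as an equivalence class of pairs. It only involves the multiplication, so it
  serves for binoids and (on the multiplicative monoid) for rings: in a ring, the condition below is
  the usual $u (a t - b s) = 0$.
\<close>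

definition fraction :: "('a, 'b) monoid_scheme \<Rightarrow> 'a set \<Rightarrow> 'a \<Rightarrow> 'a \<Rightarrow> ('a \<times> 'a) set" where
  "fraction G S a s =
     {(b, t) \<in> carrier G \<times> S. \<exists>u\<in>S. u \<otimes>\<^bsub>G\<^esub> (a \<otimes>\<^bsub>G\<^esub> t) = u \<otimes>\<^bsub>G\<^esub> (b \<otimes>\<^bsub>G\<^esub> s)}"

definition frac_carrier :: "('a, 'b) monoid_scheme \<Rightarrow> 'a set \<Rightarrow> ('a \<times> 'a) set set" where
  "frac_carrier G S = {fraction G S a s | a s. a \<in> carrier G \<and> s \<in> S}"

definition frac_mult ::
  "('a, 'b) monoid_scheme \<Rightarrow> 'a set \<Rightarrow> ('a \<times> 'a) set \<Rightarrow> ('a \<times> 'a) set \<Rightarrow> ('a \<times> 'a) set" where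
  "frac_mult G S X Y = (\<Union>(a, s)\<in>X. \<Union>(b, t)\<in>Y. fraction G S (a \<otimes>\<^bsub>G\<^esub> b) (s \<otimes>\<^bsub>G\<^esub> t))"

definition frac_add ::
  "('a, 'b) ring_scheme \<Rightarrow> 'a set \<Rightarrow> ('a \<times> 'a) set \<Rightarrow> ('a \<times> 'a) set \<Rightarrow> ('a \<times> 'a) set" where
  "frac_add R S X Y = (\<Union>(a, s)\<in>X. \<Union>(b, t)\<in>Y.
     fraction R S ((a \<otimes>\<^bsub>R\<^esub> t) \<oplus>\<^bsub>R\<^esub> (b \<otimes>\<^bsub>R\<^esub> s)) (s \<otimes>\<^bsub>R\<^esub> t))"

definition binoid_localization :: "'a binoid \<Rightarrow> 'a set \<Rightarrow> ('a \<times> 'a) set binoid" where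
  "binoid_localization M S =
    \<lparr>carrier = frac_carrier M S, monoid.mult = frac_mult M S, one = fraction M S \<one>\<^bsub>M\<^esub> \<one>\<^bsub>M\<^esub>,
     infty = fraction M S (infty M) \<one>\<^bsub>M\<^esub>\<rparr>"

definition ring_localization :: "('a, 'b) ring_scheme \<Rightarrow> 'a set \<Rightarrow> ('a \<times> 'a) set ring" where
  "ring_localization R S =
    \<lparr>carrier = frac_carrier R S, monoid.mult = frac_mult R S, one = fraction R S \<one>\<^bsub>R\<^esub> \<one>\<^bsub>R\<^esub>,
     zero = fraction R S \<zero>\<^bsub>R\<^esub> \<one>\<^bsub>R\<^esub>, add = frac_add R S\<rparr>"


section \<open>Structure sheaves\<close>

text \<open>
  Sections over \<open>U\<close>: functions to the stalks (localizations at primes \<open>p\<close>) that locally are given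
  by a single fraction. For a binoid this is the sheaf with $\mathcal O_M(D(f)) = M_f$: the open set
  $D(f)$ is the smallest neighbourhood of the largest prime not containing $f$, whose complement
  consists of the divisors of powers of $f$, so the stalk there is $M_f$.
\<close>

definition fraction_sections ::
  "('a, 'b) monoid_scheme \<Rightarrow> 'a set topology \<Rightarrow> 'a set set \<Rightarrow> ('a set \<Rightarrow> ('a \<times> 'a) set) set" where
  "fraction_sections G X U =
     {s \<in> (\<Pi>\<^sub>E p\<in>U. frac_carrier G (carrier G - p)).
        \<forall>p\<in>U. \<exists>W. openin X W \<and> p \<in> W \<and> W \<subseteq> U \<and>
          (\<exists>a\<in>carrier G. \<exists>f\<in>carrier G. \<forall>q\<in>W. f \<notin> q \<and> s q = fraction G (carrier G - q) a f)}"

definition binoid_sections ::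
  "'a binoid \<Rightarrow> 'a set set \<Rightarrow> ('a set \<Rightarrow> ('a \<times> 'a) set) binoid" where
  "binoid_sections M U =
    \<lparr>carrier = fraction_sections M (binoid_spec_topology M) U,
     monoid.mult = (\<lambda>s t. \<lambda>p\<in>U. s p \<otimes>\<^bsub>binoid_localization M (carrier M - p)\<^esub> t p),
     one = (\<lambda>p\<in>U. \<one>\<^bsub>binoid_localization M (carrier M - p)\<^esub>),
     infty = (\<lambda>p\<in>U. infty (binoid_localization M (carrier M - p)))\<rparr>"

definition ring_sections ::
  "('a, 'b) ring_scheme \<Rightarrow> 'a set set \<Rightarrow> ('a set \<Rightarrow> ('a \<times> 'a) set) ring" where
  "ring_sections R U =
    \<lparr>carrier = fraction_sections R (zariski R) U,
     monoid.mult = (\<lambda>s t. \<lambda>p\<in>U. s p \<otimes>\<^bsub>ring_localization R (carrier R - p)\<^esub> t p),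
     one = (\<lambda>p\<in>U. \<one>\<^bsub>ring_localization R (carrier R - p)\<^esub>),
     zero = (\<lambda>p\<in>U. \<zero>\<^bsub>ring_localization R (carrier R - p)\<^esub>),
     add = (\<lambda>s t. \<lambda>p\<in>U. s p \<oplus>\<^bsub>ring_localization R (carrier R - p)\<^esub> t p)\<rparr>"


section \<open>Sheaves of abelian groups and their morphisms\<close>

text \<open>
  \<open>res F U V\<close> is the restriction from \<open>U\<close> to \<open>V\<close>. A (pre)sheaf is recorded without its base space;
  values on sets that are not open are irrelevant, and restricting it to a coarser topology means
  looking only at the open sets of the latter.
\<close>

record ('x, 's) group_presheaf =
  sections :: "'x set \<Rightarrow> 's monoid"
  res :: "'x set \<Rightarrow> 'x set \<Rightarrow> 's \<Rightarrow> 's"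

definition binoid_units_sheaf ::
  "'a binoid \<Rightarrow> ('a set, 'a set \<Rightarrow> ('a \<times> 'a) set) group_presheaf" where
  "binoid_units_sheaf M =
    \<lparr>sections = (\<lambda>U. units_of (binoid_sections M U)), res = (\<lambda>U V s. restrict s V)\<rparr>"

definition ring_units_sheaf ::
  "('a, 'b) ring_scheme \<Rightarrow> ('a set, 'a set \<Rightarrow> ('a \<times> 'a) set) group_presheaf" where
  "ring_units_sheaf R =
    \<lparr>sections = (\<lambda>U. units_of (ring_sections R U)), res = (\<lambda>U V s. restrict s V)\<rparr>"

text \<open>The constant sheaf $\mathbb K^*$ on the space \<open>X\<close>: locally constant functions to $\mathbb K^*$.\<close>

definition constant_units_sheaf :: "'x topology \<Rightarrow> ('x, 'x \<Rightarrow> 'k::field) group_presheaf" where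
  "constant_units_sheaf X =
    \<lparr>sections = (\<lambda>U.
       \<lparr>carrier = {c \<in> U \<rightarrow>\<^sub>E UNIV - {0}.
          \<forall>p\<in>U. \<exists>W. openin X W \<and> p \<in> W \<and> W \<subseteq> U \<and> (\<exists>k. \<forall>q\<in>W. c q = k)},
        monoid.mult = (\<lambda>c d. \<lambda>p\<in>U. c p * d p),
        one = (\<lambda>p\<in>U. 1)\<rparr>),
     res = (\<lambda>U V c. restrict c V)\<rparr>"

text \<open>Direct image along \<open>f\<close>, where \<open>f\<close> is defined on the set \<open>X\<close>.\<close>

definition pushforward ::
  "'x set \<Rightarrow> ('x \<Rightarrow> 'y) \<Rightarrow> ('x, 's) group_presheaf \<Rightarrow> ('y, 's) group_presheaf" where
  "pushforward X f F =
    \<lparr>sections = (\<lambda>U. sections F {x \<in> X. f x \<in> U}),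
     res = (\<lambda>U V. res F {x \<in> X. f x \<in> U} {x \<in> X. f x \<in> V})\<rparr>"

definition presheaf_sum ::
  "('x, 's) group_presheaf \<Rightarrow> ('x, 't) group_presheaf \<Rightarrow> ('x, 's \<times> 't) group_presheaf" where
  "presheaf_sum F G =
    \<lparr>sections = (\<lambda>U. sections F U \<times>\<times> sections G U),
     res = (\<lambda>U V. map_prod (res F U V) (res G U V))\<rparr>"

definition presheaf_iso ::
  "'x topology \<Rightarrow> ('x, 's) group_presheaf \<Rightarrow> ('x, 't) group_presheaf \<Rightarrow> ('x set \<Rightarrow> 's \<Rightarrow> 't) \<Rightarrow> bool"
  where
  "presheaf_iso X F G \<phi> \<longleftrightarrow>
     (\<forall>U. openin X U \<longrightarrow> \<phi> U \<in> iso (sections F U) (sections G U)) \<and>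
     (\<forall>U V s. openin X U \<longrightarrow> openin X V \<longrightarrow> V \<subseteq> U \<longrightarrow> s \<in> carrier (sections F U) \<longrightarrow>
        \<phi> V (res F U V s) = res G U V (\<phi> U s))"

text \<open>The morphism from a direct sum induced by \<open>\<phi>\<close> and \<open>\<psi>\<close> (target written multiplicatively).\<close>

definition sum_morphism ::
  "('x, 'r) group_presheaf \<Rightarrow> ('x set \<Rightarrow> 's \<Rightarrow> 'r) \<Rightarrow> ('x set \<Rightarrow> 't \<Rightarrow> 'r) \<Rightarrow> 'x set \<Rightarrow> 's \<times> 't \<Rightarrow> 'r"
  where
  "sum_morphism H \<phi> \<psi> U = (\<lambda>(s, t). \<phi> U s \<otimes>\<^bsub>sections H U\<^esub> \<psi> U t)"


section \<open>The two canonical maps into the units of the binoid algebra\<close>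

definition constants_to_units ::
  "'a binoid \<Rightarrow> ('a \<Rightarrow>\<^sub>0 'k::field) set set \<Rightarrow> (('a \<Rightarrow>\<^sub>0 'k) set \<Rightarrow> 'k)
    \<Rightarrow> ('a \<Rightarrow>\<^sub>0 'k) set \<Rightarrow> (('a \<Rightarrow>\<^sub>0 'k) \<times> ('a \<Rightarrow>\<^sub>0 'k)) set" where
  "constants_to_units M U c =
     (\<lambda>P\<in>U. fraction (binoid_algebra M) (carrier (binoid_algebra M) - P)
        (bmonom M \<one>\<^bsub>M\<^esub> (c P)) (bmonom M \<one>\<^bsub>M\<^esub> 1))"

text \<open>The prime of \<open>M\<close> under a prime \<open>P\<close> of the binoid algebra.\<close>

definition monomial_contraction :: "'a binoid \<Rightarrow> ('a \<Rightarrow>\<^sub>0 'k::field) set \<Rightarrow> 'a set" where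
  "monomial_contraction M P = {a \<in> carrier M. bmonom M a 1 \<in> P}"

text \<open>
  On $D(T^f)$ this is the map $M_f^* \to \mathbb K[M]_{T^f}^*$, $a/f^n \mapsto T^a/T^{nf}$. A prime
  \<open>P\<close> and the combinatorial prime spanned by the monomials in \<open>P\<close> lie in the same combinatorial open
  sets, so for \<open>U\<close> open in the combinatorial topology and \<open>P \<in> U\<close> the section \<open>s\<close> over $i^{-1}(U)$ has a
  value at \<open>monomial_contraction M P\<close>; its image in the stalk at \<open>P\<close> is obtained by
  $a/f \mapsto T^a/T^f$.
\<close>

definition binoid_units_to_units ::
  "'a binoid \<Rightarrow> ('a \<Rightarrow>\<^sub>0 'k::field) set set \<Rightarrow> ('a set \<Rightarrow> ('a \<times> 'a) set)
    \<Rightarrow> ('a \<Rightarrow>\<^sub>0 'k) set \<Rightarrow> (('a \<Rightarrow>\<^sub>0 'k) \<times> ('a \<Rightarrow>\<^sub>0 'k)) set" where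
  "binoid_units_to_units M U s =
     (\<lambda>P\<in>U. \<Union>(a, f)\<in>s (monomial_contraction M P).
        fraction (binoid_algebra M) (carrier (binoid_algebra M) - P) (bmonom M a 1) (bmonom M f 1))"

end

theory Submission
  imports Defs "HOL-Algebra.Ring_Divisibility" "HOL-Library.Multiset_Order"
begin

text \<open>
  Every combinatorial open set is a union of sets $D(T^g)$, and everything reduces to the units on
  these. A unit $r$ on $D(T^g)$ and its inverse have the form $e / T^{n g}$ and $e' / T^{m g}$, because
  $\mathbb K[M]$ is reduced; clearing denominators, $e e'$ becomes a monomial $T^w$ with
  $g$ dividing $w$ and $w$ dividing a power of $g$. For a prime $\mathfrak p$ of $M$ not containing
  $g$ the quotient $\mathbb K[M]/\mathbb K[\mathfrak p]$ is a domain with a monomial order, so there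
  $e$ is a single term $c T^a$, and $c$ and $a$ do not depend on $\mathfrak p$. Hence
  $r = c T^{a - n g}$ on all of $D(T^g)$. Since $\mathbb K[\mathfrak p]$ is prime, $c$ and the
  fraction are determined by the germ of $r$ at any single point, so that these local
  data glue.
\<close>

section \<open>Localization and primes\<close>

text \<open>Four properties of simplicial binoids carry the proof; \<open>ordered_binoid\<close>
  collects them: trivial units, an additive and injective \<open>\<rho>\<close>, and enough primes.
  Enough primes make the ideals \<open>combinatorial_ideal M p\<close> intersect in zero, whence
  reducedness. Trivial units make the removed point a maximal ideal that can be recognised by its
  monomials. The points of \<open>U\<close> are arbitrary primes \<open>P\<close>, whereas a section
  of the direct image has values only at primes of \<open>M\<close>. The bridge is
  \<open>p = monomial_contraction M P\<close>: the ideal spanned by \<open>p\<close> is contained in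
  \<open>P\<close>, has the same monomials and so lies in the same combinatorial open sets. This is
  where the topology matters: on the Zariski open set where \<open>1 + T^x\<close> does not vanish,
  this element is a unit but no monomial fraction. Reducedness also makes computations exact: an
  element in every prime of \<open>D(T^g)\<close> is killed by \<open>T^g\<close> itself, so one
  extra factor \<open>T^g\<close> turns congruences along \<open>D(T^g)\<close> into
  identities.\<close>

lemma (in comm_monoid) fraction_eqI:
  assumes S: "submonoid S G" and "a \<in> carrier G" "b \<in> carrier G" "s \<in> S" "t \<in> S"
    and u: "u \<in> S" "u \<otimes> (a \<otimes> t) = u \<otimes> (b \<otimes> s)"
  shows "fraction G S a s = fraction G S b t"
proof -
  interpret S: submonoid S G by fact
  have sub: "fraction G S a s \<subseteq> fraction G S b t"
    if ab: "a \<in> carrier G" "b \<in> carrier G" "s \<in> S" "t \<in> S"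
      and u: "u \<in> S" "u \<otimes> (a \<otimes> t) = u \<otimes> (b \<otimes> s)" for a b s t
  proof
    fix x assume "x \<in> fraction G S a s"
    then obtain c r v where x: "x = (c, r)" "c \<in> carrier G" "r \<in> S" "v \<in> S"
      and v: "v \<otimes> (a \<otimes> r) = v \<otimes> (c \<otimes> s)"
      by (auto simp: fraction_def)
    have car: "s \<in> carrier G" "t \<in> carrier G" "u \<in> carrier G" "r \<in> carrier G" "v \<in> carrier G"
      using ab u(1) x S.subset by auto
    \<comment> \<open>Transitivity through the middle fraction a/s: besides the two witnesses
      \<open>u\<close> and \<open>v\<close>, the multiplier needs the middle denominator
      \<open>s\<close>, since nothing can be cancelled.\<close>
    have "(u \<otimes> v \<otimes> s) \<otimes> (b \<otimes> r) = v \<otimes> r \<otimes> (u \<otimes> (b \<otimes> s))"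
      using ab x car by (simp add: m_ac)
    also have "\<dots> = u \<otimes> t \<otimes> (v \<otimes> (a \<otimes> r))"
      using ab x car by (simp add: u(2)[symmetric] m_ac)
    also have "\<dots> = (u \<otimes> v \<otimes> s) \<otimes> (c \<otimes> t)"
      using ab x car by (simp add: v m_ac)
    finally show "x \<in> fraction G S b t"
      using x ab u(1) unfolding fraction_def by blast
  qed
  show ?thesis
    using sub[of a b s t] sub[of b a t s] assms by auto
qed

lemma (in comm_monoid) mem_fraction_self:
  assumes "submonoid S G" "a \<in> carrier G" "s \<in> S"
  shows "(a, s) \<in> fraction G S a s"
  using assms submonoid.one_closed[OF assms(1)] unfolding fraction_def by blast

lemma (in comm_monoid) fraction_eq_iff:
  assumes S: "submonoid S G" and "a \<in> carrier G" "b \<in> carrier G" "s \<in> S" "t \<in> S"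
  shows "fraction G S a s = fraction G S b t \<longleftrightarrow> (\<exists>u\<in>S. u \<otimes> (a \<otimes> t) = u \<otimes> (b \<otimes> s))"
proof
  assume "fraction G S a s = fraction G S b t"
  then have "(b, t) \<in> fraction G S a s"
    using assms mem_fraction_self by simp
  then show "\<exists>u\<in>S. u \<otimes> (a \<otimes> t) = u \<otimes> (b \<otimes> s)"
    by (auto simp: fraction_def)
qed (use assms fraction_eqI in blast)

text \<open>The union in \<open>frac_mult\<close> runs over all representatives. All of them give
  the same class, with the product of the two witnesses as witness, and the union is not empty
  because a fraction contains its own pair.\<close>

lemma (in comm_monoid) frac_mult_fraction:
  assumes S: "submonoid S G" and ab: "a \<in> carrier G" "b \<in> carrier G" "s \<in> S" "t \<in> S"
  shows "frac_mult G S (fraction G S a s) (fraction G S b t) = fraction G S (a \<otimes> b) (s \<otimes> t)"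
proof -
  interpret S: submonoid S G by fact
  have eq: "fraction G S (a' \<otimes> b') (s' \<otimes> t') = fraction G S (a \<otimes> b) (s \<otimes> t)"
    if x: "(a', s') \<in> fraction G S a s" and y: "(b', t') \<in> fraction G S b t" for a' s' b' t'
  proof -
    obtain u where u: "u \<in> S" "a' \<in> carrier G" "s' \<in> S" "u \<otimes> (a \<otimes> s') = u \<otimes> (a' \<otimes> s)"
      using x by (auto simp: fraction_def)
    obtain v where v: "v \<in> S" "b' \<in> carrier G" "t' \<in> S" "v \<otimes> (b \<otimes> t') = v \<otimes> (b' \<otimes> t)"
      using y by (auto simp: fraction_def)
    have car: "s \<in> carrier G" "t \<in> carrier G" "u \<in> carrier G" "v \<in> carrier G"
        "s' \<in> carrier G" "t' \<in> carrier G"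
      using ab u v S.subset by auto
    have "u \<otimes> v \<otimes> ((a \<otimes> b) \<otimes> (s' \<otimes> t')) = (u \<otimes> (a \<otimes> s')) \<otimes> (v \<otimes> (b \<otimes> t'))"
      using car ab u(2) v(2) by (simp add: m_ac)
    also have "\<dots> = u \<otimes> v \<otimes> ((a' \<otimes> b') \<otimes> (s \<otimes> t))"
      using car ab u(2) v(2) unfolding u(4) v(4) by (simp add: m_ac)
    finally show ?thesis
      using ab u v by (intro fraction_eqI[OF S, symmetric]) auto
  qed
  show ?thesis
    unfolding frac_mult_def
    using eq mem_fraction_self[OF S ab(1,3)] mem_fraction_self[OF S ab(2,4)] by fast
qed

lemma fraction_in_frac_carrier:
  "a \<in> carrier G \<Longrightarrow> s \<in> S \<Longrightarrow> fraction G S a s \<in> frac_carrier G S"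
  by (auto simp: frac_carrier_def)

lemma (in primeideal) submonoid_complement: "submonoid (carrier R - I) R"
  using I_prime I_notcarr one_imp_carrier by unfold_locales auto

lemma (in primeideal) nat_pow_notin:
  "a \<in> carrier R \<Longrightarrow> a \<notin> I \<Longrightarrow> a [^] (n::nat) \<notin> I"
proof (induction n)
  case 0
  then show ?case
    using I_notcarr one_imp_carrier by auto
next
  case (Suc n)
  then show ?case
    using I_prime[of "a [^] n" a] by auto
qed

text \<open>Zorn's lemma: an ideal that is maximal among those containing \<open>I\<close> and
  missing all powers of \<open>f\<close> is prime. The power with exponent 0 makes it proper, the
  one with exponent 1 keeps \<open>f\<close> out.\<close>

lemma (in cring) exists_primeideal_avoiding_powers:
  assumes I: "ideal I R" and f: "f \<in> carrier R" and disj: "\<And>n::nat. f [^] n \<notin> I"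
  obtains P where "primeideal P R" "I \<subseteq> P" "f \<notin> P"
proof -
  define \<A> where "\<A> = {J. ideal J R \<and> I \<subseteq> J \<and> (\<forall>n::nat. f [^] n \<notin> J)}"
  have "\<exists>P\<in>\<A>. \<forall>J\<in>\<A>. P \<subseteq> J \<longrightarrow> J = P"
  proof (rule subset_Zorn_nonempty)
    show "\<A> \<noteq> {}"
      using I disj by (auto simp: \<A>_def)
    fix C assume C: "C \<noteq> {}" "subset.chain \<A> C"
    then have "subset.chain {J. ideal J R} C"
      by (auto simp: pred_on.chain_def \<A>_def)
    from chain_Union_is_ideal[OF this] C show "\<Union>C \<in> \<A>"
      by (auto simp: pred_on.chain_def \<A>_def)
  qed
  then obtain P where P: "ideal P R" "I \<subseteq> P" "\<And>n::nat. f [^] n \<notin> P"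
    and max: "\<And>J. J \<in> \<A> \<Longrightarrow> P \<subseteq> J \<Longrightarrow> J = P"
    by (auto simp: \<A>_def)
  interpret P: ideal P R by fact
  \<comment> \<open>By maximality, adjoining an element outside \<open>P\<close> must bring in a
    power of \<open>f\<close>.\<close>
  have ext: "\<exists>n::nat. \<exists>p\<in>P. \<exists>x\<in>carrier R. f [^] n = p \<oplus> x \<otimes> a"
    if a: "a \<in> carrier R" "a \<notin> P" for a
  proof -
    let ?J = "P <+>\<^bsub>R\<^esub> PIdl a"
    have J: "ideal ?J R"
      by (intro add_ideals P(1) cgenideal_ideal a)
    have mem: "x \<in> ?J \<longleftrightarrow> (\<exists>p\<in>P. \<exists>y\<in>carrier R. x = p \<oplus> y \<otimes> a)" for x
      by (auto simp: set_add_def' cgenideal_def)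
    have "P \<subseteq> ?J"
    proof
      fix p assume "p \<in> P"
      then show "p \<in> ?J"
        using a unfolding mem by (intro bexI[of _ p] bexI[of _ \<zero>]) auto
    qed
    moreover have "a \<in> ?J"
      using a unfolding mem by (intro bexI[of _ \<zero>] bexI[of _ \<one>]) auto
    ultimately have "?J \<notin> \<A>"
      using max a by blast
    then obtain n :: nat where "f [^] n \<in> ?J"
      using J P(2) \<open>P \<subseteq> ?J\<close> by (auto simp: \<A>_def)
    then show ?thesis
      unfolding mem by blast
  qed
  have "primeideal P R"
  proof (rule primeidealI[OF P(1) is_cring])
    show "carrier R \<noteq> P"
      using P(3)[of 0] by auto
    fix a b assume ab: "a \<in> carrier R" "b \<in> carrier R" "a \<otimes> b \<in> P"
    show "a \<in> P \<or> b \<in> P"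
    proof (rule ccontr)
      assume "\<not> (a \<in> P \<or> b \<in> P)"
      then obtain n m :: nat and p q x y where
        n: "p \<in> P" "x \<in> carrier R" "f [^] n = p \<oplus> x \<otimes> a" and
        m: "q \<in> P" "y \<in> carrier R" "f [^] m = q \<oplus> y \<otimes> b"
        using ext ab by metis
      have car: "p \<in> carrier R" "q \<in> carrier R"
        using n m P.a_subset by auto
      \<comment> \<open>Multiplied out, every summand contains \<open>p\<close>, \<open>q\<close> or
        the product of \<open>a\<close> and \<open>b\<close>, all of which lie in
        \<open>P\<close>.\<close>
      have "f [^] (n + m) = (p \<oplus> x \<otimes> a) \<otimes> (q \<oplus> y \<otimes> b)"
        using f n m by (simp flip: nat_pow_mult)
      also have "\<dots> = p \<otimes> (q \<oplus> y \<otimes> b) \<oplus> ((x \<otimes> a) \<otimes> q \<oplus> (x \<otimes> y) \<otimes> (a \<otimes> b))"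
        using car n m ab by (simp add: l_distr r_distr m_ac a_ac)
      also have "\<dots> \<in> P"
        using P.I_r_closed[OF n(1), of "q \<oplus> y \<otimes> b"] P.I_l_closed[OF m(1), of "x \<otimes> a"]
          P.I_l_closed[OF ab(3), of "x \<otimes> y"] car n m ab by (intro P.a_closed) auto
      finally show False
        using P(3) by blast
    qed
  qed
  then show thesis
    using that[of P] P(2) P(3)[of 1] f by simp
qed

section \<open>Sections over basic open sets\<close>

text \<open>\<open>topology_generated_by\<close> only takes a subbasis. As the family is closed
  under binary intersections, induction over the generated topology shows that it is a
  basis.\<close>

lemma openin_topology_generated_by_basis:
  assumes "openin (topology_generated_by {D f | f. f \<in> C}) W" "x \<in> W"
    and inter: "\<And>f g. f \<in> C \<Longrightarrow> g \<in> C \<Longrightarrow> \<exists>h\<in>C. D h = D f \<inter> D g"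
  obtains f where "f \<in> C" "x \<in> D f" "D f \<subseteq> W"
proof -
  have "generate_topology_on {D f | f. f \<in> C} W"
    using assms(1) by (rule openin_topology_generated_by)
  then have "\<exists>f\<in>C. x \<in> D f \<and> D f \<subseteq> W"
    using \<open>x \<in> W\<close>
  proof induction
    case (Int U W)
    then obtain f g where fg: "f \<in> C" "g \<in> C" "x \<in> D f \<inter> D g" "D f \<inter> D g \<subseteq> U \<inter> W"
      by blast
    then show ?case
      using inter[OF fg(1,2)] by metis
  qed blast+
  then show thesis
    using that by blast
qed

abbreviation basic_open :: "('a, 'b) ring_scheme \<Rightarrow> 'a \<Rightarrow> 'a set set" where
  "basic_open R f \<equiv> {P \<in> ring_spec R. f \<notin> P}"

lemma ring_spec_iff: "P \<in> ring_spec R \<longleftrightarrow> primeideal P R"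
  by (simp add: ring_spec_def)

lemma (in cring) basic_open_mult:
  assumes "f \<in> carrier R" "g \<in> carrier R"
  shows "basic_open R (f \<otimes> g) = basic_open R f \<inter> basic_open R g"
proof -
  have "f \<otimes> g \<in> P \<longleftrightarrow> f \<in> P \<or> g \<in> P" if "primeideal P R" for P
  proof -
    interpret primeideal P R by fact
    show ?thesis
      using assms I_prime I_l_closed I_r_closed by blast
  qed
  then show ?thesis
    by (auto simp: ring_spec_iff)
qed

lemma (in cring) zariski_basis:
  assumes "openin (zariski R) W" "P \<in> W"
  obtains h where "h \<in> carrier R" "P \<in> basic_open R h" "basic_open R h \<subseteq> W"
proof (rule openin_topology_generated_by_basis[of "basic_open R" "carrier R" W P])
  show "\<exists>h\<in>carrier R. basic_open R h = basic_open R f \<inter> basic_open R g"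
    if "f \<in> carrier R" "g \<in> carrier R" for f g
    using that basic_open_mult[OF that] by (intro bexI[of _ "f \<otimes> g"]) auto
qed (use assms that in \<open>auto simp: zariski_def\<close>)

lemma (in cring) fraction_section_local:
  assumes "s \<in> fraction_sections R (zariski R) U" "P \<in> U"
  obtains h a g where "h \<in> carrier R" "a \<in> carrier R" "g \<in> carrier R"
    "P \<in> basic_open R h" "basic_open R h \<subseteq> U"
    "\<And>Q. Q \<in> basic_open R h \<Longrightarrow> g \<notin> Q \<and> s Q = fraction R (carrier R - Q) a g"
proof -
  obtain W a g where W: "openin (zariski R) W" "P \<in> W" "W \<subseteq> U"
    and s: "a \<in> carrier R" "g \<in> carrier R" "\<forall>Q\<in>W. g \<notin> Q \<and> s Q = fraction R (carrier R - Q) a g"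
    using assms unfolding fraction_sections_def by blast
  obtain h where "h \<in> carrier R" "P \<in> basic_open R h" "basic_open R h \<subseteq> W"
    using zariski_basis[OF W(1,2)] .
  then show thesis
    using that[of h a g] W s by blast
qed

text \<open>
  The denominators of the section form an ideal. If it contained no power of \<open>f\<close>, a prime containing
  it but not \<open>f\<close> would contradict the local form of the section at that prime. Since \<open>R\<close> is reduced,
  a local denominator \<open>g\<close> on \<open>D(h)\<close> gives the global denominator \<open>h g\<close>; no power of \<open>h\<close>, hence no
  quasi-compactness, is needed.
\<close>

lemma (in cring) section_over_basic_open:
  assumes reduced: "\<And>x. x \<in> carrier R \<Longrightarrow> \<forall>P\<in>ring_spec R. x \<in> P \<Longrightarrow> x = \<zero>"
    and s: "s \<in> fraction_sections R (zariski R) U"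
    and f: "f \<in> carrier R" "basic_open R f \<subseteq> U"
  obtains n :: nat and e where "e \<in> carrier R"
    "\<And>Q. Q \<in> basic_open R f \<Longrightarrow> s Q = fraction R (carrier R - Q) e (f [^] n)"
proof -
  \<comment> \<open>\<open>den d e\<close> expresses that \<open>d\<close> times the section equals
    \<open>e\<close> in every stalk over \<open>D(f)\<close>. It is stated for all representatives
    b/t of the germ, so that it can be used with whichever one is at hand.\<close>
  define den where "den d e \<longleftrightarrow> (\<forall>Q\<in>basic_open R f. \<forall>b\<in>carrier R. \<forall>t\<in>carrier R - Q.
      s Q = fraction R (carrier R - Q) b t \<longrightarrow>
      (\<exists>u\<in>carrier R - Q. u \<otimes> (d \<otimes> b) = u \<otimes> (e \<otimes> t)))" for d e
  define \<aa> where "\<aa> = {d \<in> carrier R. \<exists>e\<in>carrier R. den d e}"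
  have one_notin: "\<one> \<notin> Q" if "Q \<in> ring_spec R" for Q
    using submonoid.one_closed[OF primeideal.submonoid_complement] that by (auto simp: ring_spec_iff)
  have mult_notin: "u \<otimes> v \<in> carrier R - Q"
    if "Q \<in> ring_spec R" "u \<in> carrier R - Q" "v \<in> carrier R - Q" for u v Q
    using submonoid.m_closed[OF primeideal.submonoid_complement, of Q R u v] that
    by (auto simp: ring_spec_iff)
  have "ideal \<aa> R"
  proof (rule idealI)
    have add: "den (d \<oplus> d') (e \<oplus> e')"
      if d: "den d e" "den d' e'" and car: "d \<in> carrier R" "e \<in> carrier R" "d' \<in> carrier R" "e' \<in> carrier R"
      for d e d' e'
      unfolding den_def
    proof (intro ballI impI)
      fix Q b t
      assume Q: "Q \<in> basic_open R f" "b \<in> carrier R" "t \<in> carrier R - Q"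
        "s Q = fraction R (carrier R - Q) b t"
      obtain u where u: "u \<in> carrier R - Q" "u \<otimes> (d \<otimes> b) = u \<otimes> (e \<otimes> t)"
        using d(1) Q unfolding den_def by blast
      obtain v where v: "v \<in> carrier R - Q" "v \<otimes> (d' \<otimes> b) = v \<otimes> (e' \<otimes> t)"
        using d(2) Q unfolding den_def by blast
      have "u \<otimes> v \<otimes> ((d \<oplus> d') \<otimes> b) = v \<otimes> (u \<otimes> (d \<otimes> b)) \<oplus> u \<otimes> (v \<otimes> (d' \<otimes> b))"
        using car Q u(1) v(1) by (simp add: l_distr r_distr m_ac)
      also have "\<dots> = u \<otimes> v \<otimes> ((e \<oplus> e') \<otimes> t)"
        unfolding u(2) v(2) using car Q u(1) v(1) by (simp add: l_distr r_distr m_ac)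
      finally show "\<exists>u\<in>carrier R - Q. u \<otimes> ((d \<oplus> d') \<otimes> b) = u \<otimes> ((e \<oplus> e') \<otimes> t)"
        using mult_notin Q u(1) v(1) by blast
    qed
    have mult: "den (x \<otimes> d) (x \<otimes> e)"
      if d: "den d e" and car: "d \<in> carrier R" "e \<in> carrier R" "x \<in> carrier R" for d e x
      unfolding den_def
    proof (intro ballI impI)
      fix Q b t
      assume Q: "Q \<in> basic_open R f" "b \<in> carrier R" "t \<in> carrier R - Q"
        "s Q = fraction R (carrier R - Q) b t"
      then obtain u where u: "u \<in> carrier R - Q" "u \<otimes> (d \<otimes> b) = u \<otimes> (e \<otimes> t)"
        using d(1) unfolding den_def by blast
      have "u \<otimes> (x \<otimes> d \<otimes> b) = x \<otimes> (u \<otimes> (d \<otimes> b))"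
        using car Q u(1) by (simp add: m_ac)
      also have "\<dots> = u \<otimes> (x \<otimes> e \<otimes> t)"
        unfolding u(2) using car Q u(1) by (simp add: m_ac)
      finally show "\<exists>u\<in>carrier R - Q. u \<otimes> (x \<otimes> d \<otimes> b) = u \<otimes> (x \<otimes> e \<otimes> t)"
        using u(1) by blast
    qed
    have zero: "den \<zero> \<zero>"
      unfolding den_def using one_notin by (auto intro!: bexI[of _ \<one>])
    show l_closed: "x \<otimes> d \<in> \<aa>" if "d \<in> \<aa>" "x \<in> carrier R" for d x
      using that mult unfolding \<aa>_def by blast
    then show "d \<otimes> x \<in> \<aa>" if "d \<in> \<aa>" "x \<in> carrier R" for d x
      using that m_comm[of d x] by (auto simp: \<aa>_def)
    show "subgroup \<aa> (add_monoid R)"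
    proof (rule add.subgroupI)
      show "\<aa> \<subseteq> carrier R" by (auto simp: \<aa>_def)
      show "\<aa> \<noteq> {}" using zero by (auto simp: \<aa>_def)
      show "\<ominus> d \<in> \<aa>" if "d \<in> \<aa>" for d
        using l_closed[OF that, of "\<ominus> \<one>"] that by (auto simp: \<aa>_def l_minus)
      show "d \<oplus> d' \<in> \<aa>" if "d \<in> \<aa>" "d' \<in> \<aa>" for d d'
        using that add unfolding \<aa>_def by blast
    qed
  qed (rule ring_axioms)
  have "\<exists>n::nat. f [^] n \<in> \<aa>"
  proof (rule ccontr)
    assume "\<not> (\<exists>n::nat. f [^] n \<in> \<aa>)"
    then obtain P where P: "primeideal P R" "\<aa> \<subseteq> P" "f \<notin> P"
      using exists_primeideal_avoiding_powers[OF \<open>ideal \<aa> R\<close> f(1)] by blast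
    then have "P \<in> U"
      using f by (auto simp: ring_spec_iff)
    from fraction_section_local[OF s this] obtain h a g
      where h: "h \<in> carrier R" "a \<in> carrier R" "g \<in> carrier R"
        "P \<in> basic_open R h" "basic_open R h \<subseteq> U"
        and sh: "\<And>Q. Q \<in> basic_open R h \<Longrightarrow> g \<notin> Q \<and> s Q = fraction R (carrier R - Q) a g"
      by blast
    have "den (h \<otimes> g) (h \<otimes> a)"
      unfolding den_def
    proof (intro ballI impI)
      fix Q b t
      assume Q: "Q \<in> basic_open R f" "b \<in> carrier R" "t \<in> carrier R - Q"
        and bt: "s Q = fraction R (carrier R - Q) b t"
      then have "Q \<in> U" and Qprime: "primeideal Q R"
        using f by (auto simp: ring_spec_iff)
      from fraction_section_local[OF s \<open>Q \<in> U\<close>] obtain h' a' g'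
        where h': "h' \<in> carrier R" "a' \<in> carrier R" "g' \<in> carrier R" "Q \<in> basic_open R h'" "basic_open R h' \<subseteq> U"
          and sh': "\<And>Q. Q \<in> basic_open R h' \<Longrightarrow> g' \<notin> Q \<and> s Q = fraction R (carrier R - Q) a' g'"
        by blast
      note car = h(1-3) h'(1-3)
      \<comment> \<open>On \<open>D(h)\<close> intersected with \<open>D(h')\<close> both fractions
        represent the section, so their cross difference lies in the prime; at every other prime the
        factor \<open>h\<close> or \<open>h'\<close> does. Reducedness then makes the product
        zero.\<close>
      have "h \<otimes> h' \<otimes> (a \<otimes> g' \<ominus> a' \<otimes> g) \<in> P'" if P': "P' \<in> ring_spec R" for P'
      proof -
        interpret P': primeideal P' R using P' by (simp add: ring_spec_iff)
        show ?thesis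
        proof (cases "P' \<in> basic_open R h \<inter> basic_open R h'")
          case True
          then have "fraction R (carrier R - P') a g = fraction R (carrier R - P') a' g'"
            and "g \<notin> P'" "g' \<notin> P'"
            using sh[of P'] sh'[of P'] by auto
          then obtain u where u: "u \<in> carrier R - P'" "u \<otimes> (a \<otimes> g') = u \<otimes> (a' \<otimes> g)"
            using fraction_eq_iff[OF P'.submonoid_complement, of a a' g g'] car by auto
          then have "u \<otimes> (a \<otimes> g' \<ominus> a' \<otimes> g) = \<zero>"
            using car by (simp add: minus_eq r_distr r_minus r_neg)
          then have "a \<otimes> g' \<ominus> a' \<otimes> g \<in> P'"
            using P'.I_prime[of u "a \<otimes> g' \<ominus> a' \<otimes> g"] u car by auto
          then show ?thesis
            using car by (intro P'.I_l_closed) auto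
        next
          case False
          then have "h \<otimes> h' \<in> P'"
            using P' basic_open_mult[OF car(1,4)] by auto
          then show ?thesis
            using P'.I_r_closed[of "h \<otimes> h'" "a \<otimes> g' \<ominus> a' \<otimes> g"] car by simp
        qed
      qed
      then have "h \<otimes> h' \<otimes> (a \<otimes> g' \<ominus> a' \<otimes> g) = \<zero>"
        using car by (intro reduced) auto
      then have "h \<otimes> h' \<otimes> (a \<otimes> g') \<ominus> h \<otimes> h' \<otimes> (a' \<otimes> g) = \<zero>"
        using car by (simp add: minus_eq r_distr r_minus)
      then have eq: "h \<otimes> h' \<otimes> (a \<otimes> g') = h \<otimes> h' \<otimes> (a' \<otimes> g)"
        using car by (simp add: r_right_minus_eq)
      interpret Q: primeideal Q R by fact
      obtain v where v: "v \<in> carrier R - Q" "v \<otimes> (b \<otimes> g') = v \<otimes> (a' \<otimes> t)"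
        using fraction_eq_iff[OF Q.submonoid_complement, of b a' t g'] car Q bt sh'[OF h'(4)] by auto
      \<comment> \<open>At \<open>Q\<close> the germ b/t is first compared with the local form a'/g'
        (witness \<open>v\<close>), then a'/g' with a/g through the identity \<open>eq\<close>; the
        multiplier collects \<open>v\<close> with the denominators \<open>h'\<close> and
        \<open>g'\<close>, all outside \<open>Q\<close>.\<close>
      have "h' \<otimes> v \<otimes> g' \<otimes> (h \<otimes> g \<otimes> b) = h' \<otimes> h \<otimes> g \<otimes> (v \<otimes> (b \<otimes> g'))"
        using car Q v(1) by (simp add: m_ac)
      also have "\<dots> = v \<otimes> t \<otimes> (h \<otimes> h' \<otimes> (a' \<otimes> g))"
        unfolding v(2) using car Q v(1) by (simp add: m_ac)
      also have "\<dots> = h' \<otimes> v \<otimes> g' \<otimes> (h \<otimes> a \<otimes> t)"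
        unfolding eq[symmetric] using car Q v(1) by (simp add: m_ac)
      finally show "\<exists>u\<in>carrier R - Q. u \<otimes> (h \<otimes> g \<otimes> b) = u \<otimes> (h \<otimes> a \<otimes> t)"
        using mult_notin[of Q] Qprime v(1) h' sh'[OF h'(4)]
        by (intro bexI[of _ "h' \<otimes> v \<otimes> g'"]) (auto simp: ring_spec_iff)
    qed
    then have "h \<otimes> g \<in> \<aa>"
      using h by (auto simp: \<aa>_def)
    then show False
      using P h sh[OF h(4)] primeideal.I_prime[OF P(1), of h g] by blast
  qed
  then obtain n :: nat and e where ne: "e \<in> carrier R" "den (f [^] n) e"
    by (auto simp: \<aa>_def)
  show thesis
  proof (rule that[OF ne(1)])
    fix Q assume Q: "Q \<in> basic_open R f"
    then interpret Q: primeideal Q R by (simp add: ring_spec_iff)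
    have "s Q \<in> frac_carrier R (carrier R - Q)"
      using s Q f(2) by (auto simp: fraction_sections_def PiE_iff)
    then obtain b t where bt: "b \<in> carrier R" "t \<in> carrier R - Q" "s Q = fraction R (carrier R - Q) b t"
      by (auto simp: frac_carrier_def)
    then obtain u where "u \<in> carrier R - Q" "u \<otimes> (f [^] n \<otimes> b) = u \<otimes> (e \<otimes> t)"
      using ne(2) Q unfolding den_def by blast
    then have "fraction R (carrier R - Q) b t = fraction R (carrier R - Q) e (f [^] n)"
      using bt ne(1) f Q Q.nat_pow_notin[of f n]
      by (intro fraction_eqI[OF Q.submonoid_complement, of _ _ _ _ u]) (auto simp: m_comm)
    then show "s Q = fraction R (carrier R - Q) e (f [^] n)"
      using bt by simp
  qed
qed

section \<open>Primes spanned by monomials\<close>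

text \<open>
  The map \<open>\<rho>\<close> is a monomial order: it keeps the extremal terms of a product from cancelling.
\<close>

locale ordered_binoid = binoid M for M :: "'a binoid" (structure) +
  fixes \<rho> :: "'a \<Rightarrow> 'o::{linorder, ordered_cancel_ab_semigroup_add}"
  assumes Units_trivial: "Units M \<subseteq> {\<one>}"
    and \<rho>_mult: "\<lbrakk>a \<in> carrier M; b \<in> carrier M; a \<otimes> b \<noteq> infty M\<rbrakk> \<Longrightarrow> \<rho> (a \<otimes> b) = \<rho> a + \<rho> b"
    and \<rho>_inj: "inj_on \<rho> (carrier M - {infty M})"
    and exists_prime: "\<lbrakk>a \<in> carrier M; a \<noteq> infty M\<rbrakk> \<Longrightarrow> \<exists>p. binoid_prime M p \<and> a \<notin> p"

lemma (in binoid) binoid_primeD: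
  assumes "binoid_prime M p"
  shows "p \<subseteq> carrier M" "infty M \<in> p" "\<one> \<notin> p" "submonoid (carrier M - p) M"
    and "\<lbrakk>a \<in> carrier M; b \<in> carrier M\<rbrakk> \<Longrightarrow> a \<otimes> b \<in> p \<longleftrightarrow> a \<in> p \<or> b \<in> p"
proof -
  show sub: "submonoid (carrier M - p) M" and p: "p \<subseteq> carrier M" "infty M \<in> p"
    using assms by (auto simp: binoid_prime_def binoid_ideal_def)
  show "\<one> \<notin> p"
    using submonoid.one_closed[OF sub] by simp
  have "a \<otimes> b \<in> p" if "a \<in> p" "b \<in> carrier M" for a b
    using assms that by (auto simp: binoid_prime_def binoid_ideal_def)
  then show "a \<otimes> b \<in> p \<longleftrightarrow> a \<in> p \<or> b \<in> p" if "a \<in> carrier M" "b \<in> carrier M"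
    using that m_comm[OF that] submonoid.m_closed[OF sub, of a b] by (metis DiffD2 DiffI)
qed

section \<open>Coefficients and supports of products in the binoid algebra\<close>

lemma lookup_bmonom:
  "Poly_Mapping.lookup (bmonom M a c) x = (if a \<noteq> infty M \<and> a = x then c else 0)"
  by (auto simp: bmonom_def lookup_single when_def)

lemma keys_bmonom:
  "Poly_Mapping.keys (bmonom M a c) = (if a = infty M \<or> c = 0 then {} else {a})"
  by (auto simp: bmonom_def)

lemma keys_subset_carrier:
  "f \<in> carrier (binoid_algebra M) \<Longrightarrow> Poly_Mapping.keys f \<subseteq> carrier M - {infty M}"
  by (simp add: binoid_algebra_def)

lemma lookup_binoid_algebra_mult:
  assumes "c \<noteq> infty M"
  shows "Poly_Mapping.lookup (f \<otimes>\<^bsub>binoid_algebra M\<^esub> g) c =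
    (\<Sum>(a, b)\<in>Poly_Mapping.keys f \<times> Poly_Mapping.keys g.
       if a \<otimes>\<^bsub>M\<^esub> b = c then Poly_Mapping.lookup f a * Poly_Mapping.lookup g b else 0)"
  using assms
  by (auto simp: binoid_algebra_def lookup_sum lookup_bmonom sum.cartesian_product intro!: sum.cong)

lemma (in binoid) keys_binoid_algebra_mult:
  fixes f g :: "'a \<Rightarrow>\<^sub>0 'k::field"
  assumes "f \<in> carrier (binoid_algebra M)" "g \<in> carrier (binoid_algebra M)"
    and c: "c \<in> Poly_Mapping.keys (f \<otimes>\<^bsub>binoid_algebra M\<^esub> g)"
  obtains a b where "a \<in> Poly_Mapping.keys f" "b \<in> Poly_Mapping.keys g" "c = a \<otimes> b"
proof -
  interpret R: cring "binoid_algebra M :: ('a \<Rightarrow>\<^sub>0 'k) ring" by (rule cring_binoid_algebra)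
  have "c \<noteq> infty M"
    using keys_subset_carrier[OF R.m_closed[OF assms(1,2)]] c by auto
  then have "(\<Sum>(a, b)\<in>Poly_Mapping.keys f \<times> Poly_Mapping.keys g.
      if a \<otimes> b = c then Poly_Mapping.lookup f a * Poly_Mapping.lookup g b else 0) \<noteq> 0"
    using c by (simp add: lookup_binoid_algebra_mult in_keys_iff)
  then obtain x where "x \<in> Poly_Mapping.keys f \<times> Poly_Mapping.keys g" "fst x \<otimes> snd x = c"
    by (rule sum.not_neutral_contains_not_neutral) (auto split: if_splits)
  then show thesis
    using that[of "fst x" "snd x"] by auto
qed

lemma (in binoid) combinatorial_ideal_iff:
  assumes "p \<subseteq> carrier M"
  shows "f \<in> combinatorial_ideal M p \<longleftrightarrow> f \<in> carrier (binoid_algebra M) \<and> Poly_Mapping.keys f \<subseteq> p"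
  using assms by (auto simp: combinatorial_ideal_def binoid_algebra_def)

text \<open>Uniqueness is demanded only of terms outside \<open>p\<close>: a pair with a member in
  \<open>p\<close> has its product in \<open>p\<close> and so cannot contribute to the exponent
  \<open>a \<otimes> b\<close>, which lies outside the prime.\<close>

lemma (in binoid) lookup_mult_unique_pair:
  fixes f g :: "'a \<Rightarrow>\<^sub>0 'k::field"
  assumes p: "binoid_prime M p"
    and f: "f \<in> carrier (binoid_algebra M)" and g: "g \<in> carrier (binoid_algebra M)"
    and a: "a \<in> Poly_Mapping.keys f - p" and b: "b \<in> Poly_Mapping.keys g - p"
    and unique: "\<And>a' b'. \<lbrakk>a' \<in> Poly_Mapping.keys f - p; b' \<in> Poly_Mapping.keys g - p;
      a' \<otimes> b' = a \<otimes> b\<rbrakk> \<Longrightarrow> a' = a \<and> b' = b"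
  shows "Poly_Mapping.lookup (f \<otimes>\<^bsub>binoid_algebra M\<^esub> g) (a \<otimes> b)
    = Poly_Mapping.lookup f a * Poly_Mapping.lookup g b"
proof -
  note p' = binoid_primeD[OF p]
  have car: "x \<in> carrier M" if "x \<in> Poly_Mapping.keys f \<union> Poly_Mapping.keys g" for x
    using that keys_subset_carrier[OF f] keys_subset_carrier[OF g] by auto
  have ab: "a \<otimes> b \<notin> p"
    using a b car p'(5) by auto
  have *: "a' \<otimes> b' = a \<otimes> b \<longleftrightarrow> (a', b') = (a, b)"
    if "a' \<in> Poly_Mapping.keys f" "b' \<in> Poly_Mapping.keys g" for a' b'
    using unique[of a' b'] that ab p'(5)[of a' b'] car by auto
  have "Poly_Mapping.lookup (f \<otimes>\<^bsub>binoid_algebra M\<^esub> g) (a \<otimes> b) =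
      (\<Sum>(a', b')\<in>Poly_Mapping.keys f \<times> Poly_Mapping.keys g.
         if a' \<otimes> b' = a \<otimes> b then Poly_Mapping.lookup f a' * Poly_Mapping.lookup g b' else 0)"
    using ab p' by (intro lookup_binoid_algebra_mult) auto
  also have "\<dots> = (\<Sum>x\<in>Poly_Mapping.keys f \<times> Poly_Mapping.keys g.
       if x = (a, b) then Poly_Mapping.lookup f a * Poly_Mapping.lookup g b else 0)"
    by (intro sum.cong refl) (auto simp: * split: if_splits)
  also have "\<dots> = Poly_Mapping.lookup f a * Poly_Mapping.lookup g b"
    using a b by (simp add: sum.delta)
  finally show ?thesis .
qed

context ordered_binoid
begin

text \<open>Addition is strictly monotone, so equal sums with termwise comparable summands have
  equal summands, and \<open>\<rho>\<close> is injective. Staying outside the prime keeps the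
  products different from \<open>infty M\<close>, where \<open>\<rho>\<close> is additive.\<close>

lemma extremal_keys_eq:
  assumes p: "binoid_prime M p"
    and car: "a \<in> carrier M - p" "b \<in> carrier M - p" "a' \<in> carrier M - p" "b' \<in> carrier M - p"
    and eq: "a' \<otimes> b' = a \<otimes> b"
    and le: "\<rho> a' \<le> \<rho> a" "\<rho> b' \<le> \<rho> b"
  shows "a' = a \<and> b' = b"
proof -
  note p' = binoid_primeD[OF p]
  have ab: "a \<otimes> b \<notin> p" "a' \<otimes> b' \<notin> p"
    using car p'(5) by auto
  have "\<rho> a' + \<rho> b' = \<rho> a + \<rho> b"
    using \<rho>_mult[of a b] \<rho>_mult[of a' b'] eq car ab p'(2) by force
  then have "\<rho> a' = \<rho> a" "\<rho> b' = \<rho> b"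
    using add_less_le_mono[of "\<rho> a'" "\<rho> a" "\<rho> b'" "\<rho> b"]
      add_le_less_mono[of "\<rho> a'" "\<rho> a" "\<rho> b'" "\<rho> b"] le by (auto simp: order.order_iff_strict)
  then show ?thesis
    using inj_onD[OF \<rho>_inj] car p'(2) by blast
qed

lemma exists_max_key:
  assumes "finite A" "A \<noteq> {}"
  shows "\<exists>a\<in>A. \<forall>x\<in>A. \<rho> x \<le> \<rho> a"
  using Max_in[of "\<rho> ` A"] Max_ge[of "\<rho> ` A"] assms by fastforce

lemma exists_min_key:
  assumes "finite A" "A \<noteq> {}"
  shows "\<exists>a\<in>A. \<forall>x\<in>A. \<rho> a \<le> \<rho> x"
  using Min_in[of "\<rho> ` A"] Min_le[of "\<rho> ` A"] assms by fastforce

text \<open>The product of the two highest terms outside \<open>p\<close> is reached by no other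
  pair, so its coefficient is a product of nonzero scalars; likewise for the lowest terms. The
  highest terms suffice for primality; the comparison of both ends singles out the monomial
  factors.\<close>

lemma mult_extremal_keys:
  fixes f g :: "'a \<Rightarrow>\<^sub>0 'k::field"
  assumes p: "binoid_prime M p"
    and f: "f \<in> carrier (binoid_algebra M)" "\<not> Poly_Mapping.keys f \<subseteq> p"
    and g: "g \<in> carrier (binoid_algebra M)" "\<not> Poly_Mapping.keys g \<subseteq> p"
  shows "\<exists>a\<in>Poly_Mapping.keys f - p. \<exists>b\<in>Poly_Mapping.keys g - p.
      (\<forall>x\<in>Poly_Mapping.keys f - p. \<rho> x \<le> \<rho> a) \<and> (\<forall>x\<in>Poly_Mapping.keys g - p. \<rho> x \<le> \<rho> b) \<and>
      a \<otimes> b \<in> Poly_Mapping.keys (f \<otimes>\<^bsub>binoid_algebra M\<^esub> g)" (is ?max)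
    and "\<exists>a\<in>Poly_Mapping.keys f - p. \<exists>b\<in>Poly_Mapping.keys g - p.
      (\<forall>x\<in>Poly_Mapping.keys f - p. \<rho> a \<le> \<rho> x) \<and> (\<forall>x\<in>Poly_Mapping.keys g - p. \<rho> b \<le> \<rho> x) \<and>
      a \<otimes> b \<in> Poly_Mapping.keys (f \<otimes>\<^bsub>binoid_algebra M\<^esub> g)" (is ?min)
proof -
  have key: "a \<otimes> b \<in> Poly_Mapping.keys (f \<otimes>\<^bsub>binoid_algebra M\<^esub> g)"
    if a: "a \<in> Poly_Mapping.keys f - p" and b: "b \<in> Poly_Mapping.keys g - p"
      and unique: "\<And>a' b'. \<lbrakk>a' \<in> Poly_Mapping.keys f - p; b' \<in> Poly_Mapping.keys g - p;
        a' \<otimes> b' = a \<otimes> b\<rbrakk> \<Longrightarrow> a' = a \<and> b' = b" for a b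
  proof -
    have "Poly_Mapping.lookup (f \<otimes>\<^bsub>binoid_algebra M\<^esub> g) (a \<otimes> b)
        = Poly_Mapping.lookup f a * Poly_Mapping.lookup g b"
      by (rule lookup_mult_unique_pair[OF p f(1) g(1) a b]) (rule unique)
    moreover have "Poly_Mapping.lookup f a \<noteq> 0" "Poly_Mapping.lookup g b \<noteq> 0"
      using a b by (auto simp: in_keys_iff)
    ultimately show ?thesis
      by (simp add: in_keys_iff)
  qed
  have car: "Poly_Mapping.keys f - p \<subseteq> carrier M - p" "Poly_Mapping.keys g - p \<subseteq> carrier M - p"
    using keys_subset_carrier[OF f(1)] keys_subset_carrier[OF g(1)] by auto
  have ne: "finite (Poly_Mapping.keys f - p)" "Poly_Mapping.keys f - p \<noteq> {}"
    "finite (Poly_Mapping.keys g - p)" "Poly_Mapping.keys g - p \<noteq> {}"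
    using f g by auto
  obtain a b where ab: "a \<in> Poly_Mapping.keys f - p" "b \<in> Poly_Mapping.keys g - p"
      "\<forall>x\<in>Poly_Mapping.keys f - p. \<rho> x \<le> \<rho> a" "\<forall>x\<in>Poly_Mapping.keys g - p. \<rho> x \<le> \<rho> b"
    using exists_max_key[OF ne(1,2)] exists_max_key[OF ne(3,4)]
    by (elim bexE) (rule that)
  have "a \<otimes> b \<in> Poly_Mapping.keys (f \<otimes>\<^bsub>binoid_algebra M\<^esub> g)"
    using ab car by (intro key extremal_keys_eq[OF p]) auto
  with ab show ?max by blast
  obtain a b where ab: "a \<in> Poly_Mapping.keys f - p" "b \<in> Poly_Mapping.keys g - p"
      "\<forall>x\<in>Poly_Mapping.keys f - p. \<rho> a \<le> \<rho> x" "\<forall>x\<in>Poly_Mapping.keys g - p. \<rho> b \<le> \<rho> x"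
    using exists_min_key[OF ne(1,2)] exists_min_key[OF ne(3,4)]
    by (elim bexE) (rule that)
  \<comment> \<open>For minima, \<open>extremal_keys_eq\<close> is applied with the two pairs
    exchanged.\<close>
  have "a' = a \<and> b' = b" if "a' \<in> Poly_Mapping.keys f - p" "b' \<in> Poly_Mapping.keys g - p"
    "a' \<otimes> b' = a \<otimes> b" for a' b'
    using extremal_keys_eq[OF p, of a' b' a b] that ab car by auto
  then have "a \<otimes> b \<in> Poly_Mapping.keys (f \<otimes>\<^bsub>binoid_algebra M\<^esub> g)"
    using ab by (intro key) auto
  with ab show ?min by blast
qed

text \<open>Primality is the argument by leading terms in the quotient: two elements that both have
  terms outside \<open>p\<close> have a product with a term outside \<open>p\<close>.\<close>

lemma primeideal_combinatorial_ideal: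
  assumes p: "binoid_prime M p"
  shows "primeideal (combinatorial_ideal M p) (binoid_algebra M :: ('a \<Rightarrow>\<^sub>0 'k::field) ring)"
proof -
  let ?R = "binoid_algebra M :: ('a \<Rightarrow>\<^sub>0 'k) ring"
  interpret R: cring ?R by (rule cring_binoid_algebra)
  note p' = binoid_primeD[OF p]
  note iff = combinatorial_ideal_iff[OF p'(1)]
  have l_closed: "x \<otimes>\<^bsub>?R\<^esub> f \<in> combinatorial_ideal M p"
    if "f \<in> combinatorial_ideal M p" "x \<in> carrier ?R" for f x
  proof -
    have "c \<in> p" if "c \<in> Poly_Mapping.keys (x \<otimes>\<^bsub>?R\<^esub> f)" for c
    proof -
      obtain a b where "a \<in> Poly_Mapping.keys x" "b \<in> Poly_Mapping.keys f" "c = a \<otimes> b"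
        using keys_binoid_algebra_mult[of x f c] \<open>f \<in> _\<close> \<open>x \<in> _\<close> \<open>c \<in> _\<close> by (auto simp: iff)
      then show ?thesis
        using p'(5)[of a b] keys_subset_carrier[of x M] keys_subset_carrier[of f M]
          \<open>f \<in> _\<close> \<open>x \<in> _\<close> by (auto simp: iff)
    qed
    then show ?thesis
      using that by (auto simp: iff)
  qed
  show ?thesis
  proof (rule primeidealI)
    show "ideal (combinatorial_ideal M p) ?R"
    proof (rule idealI)
      show "subgroup (combinatorial_ideal M p) (add_monoid ?R)"
      proof (rule R.add.subgroupI)
        have "0 \<in> (combinatorial_ideal M p :: ('a \<Rightarrow>\<^sub>0 'k) set)"
          by (simp add: combinatorial_ideal_def)
        then show "combinatorial_ideal M p \<noteq> ({} :: ('a \<Rightarrow>\<^sub>0 'k) set)" by blast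
        show "\<ominus>\<^bsub>?R\<^esub> f \<in> combinatorial_ideal M p" if f: "f \<in> combinatorial_ideal M p" for f
        proof -
          have "\<ominus>\<^bsub>?R\<^esub> f = (\<ominus>\<^bsub>?R\<^esub> \<one>\<^bsub>?R\<^esub>) \<otimes>\<^bsub>?R\<^esub> f"
            using f R.l_minus[of "\<one>\<^bsub>?R\<^esub>" f] R.l_one[of f] R.one_closed unfolding iff by simp
          then show ?thesis
            using l_closed[OF f R.a_inv_closed[OF R.one_closed]] by simp
        qed
        show "f \<oplus>\<^bsub>?R\<^esub> g \<in> combinatorial_ideal M p"
          if "f \<in> combinatorial_ideal M p" "g \<in> combinatorial_ideal M p" for f g
          using that keys_add[of f g] carrier_binoid_algebra_add[of f M g] by (auto simp: iff)
      qed (auto simp: iff)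
      fix f x :: "'a \<Rightarrow>\<^sub>0 'k"
      assume fx: "f \<in> combinatorial_ideal M p" "x \<in> carrier ?R"
      then show "x \<otimes>\<^bsub>?R\<^esub> f \<in> combinatorial_ideal M p" by (rule l_closed)
      with fx show "f \<otimes>\<^bsub>?R\<^esub> x \<in> combinatorial_ideal M p"
        using R.m_comm[of f x] by (simp add: iff)
    qed (rule R.ring_axioms)
    have "\<one> \<in> Poly_Mapping.keys (\<one>\<^bsub>?R\<^esub>)"
      using p'(2,3) by (auto simp: keys_bmonom)
    then have "\<one>\<^bsub>?R\<^esub> \<notin> combinatorial_ideal M p"
      using p'(3) unfolding iff by blast
    then show "carrier ?R \<noteq> combinatorial_ideal M p"
      using R.one_closed by metis
    fix f g :: "'a \<Rightarrow>\<^sub>0 'k"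
    assume fg: "f \<in> carrier ?R" "g \<in> carrier ?R" "f \<otimes>\<^bsub>?R\<^esub> g \<in> combinatorial_ideal M p"
    show "f \<in> combinatorial_ideal M p \<or> g \<in> combinatorial_ideal M p"
    proof (rule ccontr)
      assume "\<not> ?thesis"
      then have "\<not> Poly_Mapping.keys f \<subseteq> p" "\<not> Poly_Mapping.keys g \<subseteq> p"
        using fg by (auto simp: iff)
      then obtain a b where ab: "a \<in> Poly_Mapping.keys f - p" "b \<in> Poly_Mapping.keys g - p"
          "a \<otimes> b \<in> Poly_Mapping.keys (f \<otimes>\<^bsub>?R\<^esub> g)"
        using mult_extremal_keys(1)[OF p fg(1) _ fg(2)] by blast
      then have "a \<otimes> b \<in> p"
        using fg(3) by (auto simp: iff)
      then show False
        using ab p'(5)[of a b] keys_subset_carrier[OF fg(1)] keys_subset_carrier[OF fg(2)] by auto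
    qed
  qed (rule R.is_cring)
qed

text \<open>The primes spanned by monomials already suffice: an exponent occurring in
  \<open>f\<close> is avoided by some prime \<open>p\<close> of \<open>M\<close>, and then
  \<open>f\<close> is not in the span of \<open>p\<close>.\<close>

lemma binoid_algebra_reduced:
  fixes f :: "'a \<Rightarrow>\<^sub>0 'k::field"
  assumes f: "f \<in> carrier (binoid_algebra M)" and P: "\<forall>P\<in>ring_spec (binoid_algebra M). f \<in> P"
  shows "f = 0"
proof (rule ccontr)
  assume "f \<noteq> 0"
  then obtain a where a: "a \<in> Poly_Mapping.keys f"
    using keys_eq_empty by blast
  with f obtain p where p: "binoid_prime M p" "a \<notin> p"
    using exists_prime[of a] keys_subset_carrier[OF f] by auto
  then have "f \<in> combinatorial_ideal M p"
    using primeideal_combinatorial_ideal P by (auto simp: ring_spec_def)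
  then show False
    using a p by (auto simp: combinatorial_ideal_def)
qed

text \<open>Outside \<open>p\<close> the highest terms of the two factors multiply to a term of the
  product, and so do the lowest ones. The product has the single term \<open>w\<close>, so highest
  and lowest coincide.\<close>

lemma factor_of_monomial:
  fixes f g :: "'a \<Rightarrow>\<^sub>0 'k::field"
  assumes p: "binoid_prime M p"
    and f: "f \<in> carrier (binoid_algebra M)" and g: "g \<in> carrier (binoid_algebra M)"
    and w: "w \<in> carrier M - p"
    and fg: "f \<otimes>\<^bsub>binoid_algebra M\<^esub> g = bmonom M w 1"
  obtains a b where "Poly_Mapping.keys f - p = {a}" "a \<in> carrier M" "b \<in> carrier M" "a \<otimes> b = w"
proof -
  let ?R = "binoid_algebra M :: ('a \<Rightarrow>\<^sub>0 'k) ring"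
  interpret P: primeideal "combinatorial_ideal M p" ?R
    by (rule primeideal_combinatorial_ideal[OF p])
  note p' = binoid_primeD[OF p]
  note iff = combinatorial_ideal_iff[OF p'(1)]
  have w': "Poly_Mapping.keys (bmonom M w 1 :: 'a \<Rightarrow>\<^sub>0 'k) = {w}"
    using w p'(2) by (auto simp: keys_bmonom)
  then have notin: "f \<otimes>\<^bsub>?R\<^esub> g \<notin> combinatorial_ideal M p"
    unfolding fg using w by (auto simp: combinatorial_ideal_def)
  have "\<not> Poly_Mapping.keys f \<subseteq> p" "\<not> Poly_Mapping.keys g \<subseteq> p"
    using notin P.I_l_closed[of g f] P.I_r_closed[of f g] f g by (auto simp: iff)
  note extr = mult_extremal_keys[OF p f this(1) g this(2)]
  obtain a b where ab: "a \<in> Poly_Mapping.keys f - p" "b \<in> Poly_Mapping.keys g - p"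
    "\<forall>x\<in>Poly_Mapping.keys f - p. \<rho> x \<le> \<rho> a" "\<forall>x\<in>Poly_Mapping.keys g - p. \<rho> x \<le> \<rho> b" "a \<otimes> b = w"
    using extr(1) unfolding fg w' by (elim bexE conjE) (rule that, assumption+, simp)
  obtain a' b' where ab': "a' \<in> Poly_Mapping.keys f - p" "b' \<in> Poly_Mapping.keys g - p"
    "\<forall>x\<in>Poly_Mapping.keys f - p. \<rho> a' \<le> \<rho> x" "a' \<otimes> b' = w"
    using extr(2) unfolding fg w' by (elim bexE conjE) (rule that, assumption+, simp)
  have car: "Poly_Mapping.keys f - p \<subseteq> carrier M - p" "Poly_Mapping.keys g - p \<subseteq> carrier M - p"
    using keys_subset_carrier[OF f] keys_subset_carrier[OF g] by auto
  \<comment> \<open>Both pairs have product \<open>w\<close>, and the first dominates the second in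
    each component.\<close>
  have "a' = a \<and> b' = b"
    using ab ab' car by (intro extremal_keys_eq[OF p]) auto
  then have eq: "\<rho> x = \<rho> a" if "x \<in> Poly_Mapping.keys f - p" for x
    using ab(3) ab'(3) that by (auto intro: order.antisym)
  have "x = a" if "x \<in> Poly_Mapping.keys f - p" for x
    using inj_onD[OF \<rho>_inj eq[OF that]] that ab(1) car p'(2) by blast
  then have "Poly_Mapping.keys f - p = {a}"
    using ab(1) by blast
  then show thesis
    using that[of a b] ab car by blast
qed

end

section \<open>Units on monomial basic open sets\<close>

context binoid
begin

lemma monomial_contraction_iff:
  "a \<in> carrier M \<Longrightarrow> a \<in> monomial_contraction M P \<longleftrightarrow> bmonom M a 1 \<in> P"
  by (simp add: monomial_contraction_def)

lemma binoid_prime_contraction: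
  fixes P :: "('a \<Rightarrow>\<^sub>0 'k::field) set"
  assumes "primeideal P (binoid_algebra M)"
  shows "binoid_prime M (monomial_contraction M P)"
proof -
  interpret P: primeideal P "binoid_algebra M" by fact
  have mult: "bmonom M (a \<otimes> b) 1 \<in> P \<longleftrightarrow> bmonom M a 1 \<in> P \<or> bmonom M b 1 \<in> P"
    if "a \<in> carrier M" "b \<in> carrier M" for a b
    using that P.I_prime[of "bmonom M a 1" "bmonom M b 1"] P.I_l_closed[of "bmonom M b 1" "bmonom M a 1"]
      P.I_r_closed[of "bmonom M a 1" "bmonom M b 1"]
    by (auto simp: bmonom_closed bmonom_mult)
  have zero: "0 \<in> P"
    using additive_subgroup.zero_closed[OF P.is_additive_subgroup] by simp
  have "\<one>\<^bsub>binoid_algebra M\<^esub> \<notin> P"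
    using P.I_notcarr P.one_imp_carrier by metis
  then show ?thesis
    using mult zero unfolding binoid_prime_def binoid_ideal_def submonoid_def
    by (auto simp: monomial_contraction_def)
qed

text \<open>Contraction is a left inverse of the map from primes of \<open>M\<close> to primes
  spanned by monomials, so every \<open>p\<close> over \<open>U\<close> is the contraction of a
  point of \<open>U\<close>.\<close>

lemma monomial_contraction_combinatorial_ideal:
  assumes "binoid_prime M p"
  shows "monomial_contraction M (combinatorial_ideal M p :: ('a \<Rightarrow>\<^sub>0 'k::field) set) = p"
  using binoid_primeD[OF assms]
  by (auto simp: monomial_contraction_def combinatorial_ideal_def keys_bmonom split: if_splits)

text \<open>The passage between \<open>P\<close> and the ideal of its monomials, where membership
  can be read off from the exponents: what lies in the smaller ideal lies in \<open>P\<close>, and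
  what lies outside \<open>P\<close> lies outside the smaller ideal.\<close>

lemma combinatorial_ideal_contraction_subset:
  fixes P :: "('a \<Rightarrow>\<^sub>0 'k::field) set"
  assumes "primeideal P (binoid_algebra M)"
  shows "combinatorial_ideal M (monomial_contraction M P) \<subseteq> P"
  by (subst combinatorial_ideal_subset_iff)
    (use assms primeideal.axioms(1) in \<open>auto simp: monomial_contraction_def\<close>)

lemma bmonom_mem_prime_iff:
  fixes P :: "('a \<Rightarrow>\<^sub>0 'k::field) set"
  assumes "primeideal P (binoid_algebra M)" "a \<in> carrier M" "c \<noteq> 0"
  shows "bmonom M a c \<in> P \<longleftrightarrow> a \<in> monomial_contraction M P"
proof -
  interpret P: primeideal P "binoid_algebra M" by fact
  have scale: "bmonom M a (d * c) \<in> P" if "bmonom M a c \<in> P" for c d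
    using P.I_l_closed[OF that, of "bmonom M \<one> d"] assms(2) by (simp add: bmonom_closed bmonom_mult)
  show ?thesis
    using scale[of c "inverse c"] scale[of 1 c] assms by (auto simp: monomial_contraction_iff)
qed

lemma bmonom_pow:
  assumes "g \<in> carrier M"
  shows "bmonom M g 1 [^]\<^bsub>binoid_algebra M\<^esub> (n::nat) = (bmonom M (g [^] n) 1 :: 'a \<Rightarrow>\<^sub>0 'k::field)"
  by (induction n) (use assms in \<open>simp_all add: nat_pow_def bmonom_mult flip: nat_pow_def\<close>)

lemma a_inv_binoid_algebra:
  fixes f :: "'a \<Rightarrow>\<^sub>0 'k::field"
  assumes "f \<in> carrier (binoid_algebra M)"
  shows "\<ominus>\<^bsub>binoid_algebra M\<^esub> f = - f"
proof -
  interpret R: cring "binoid_algebra M :: ('a \<Rightarrow>\<^sub>0 'k) ring" by (rule cring_binoid_algebra)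
  have "- f \<in> carrier (binoid_algebra M)"
    using assms by (simp add: binoid_algebra_def)
  then show ?thesis
    using assms by (intro R.minus_equality) auto
qed

lemma a_minus_binoid_algebra:
  fixes f g :: "'a \<Rightarrow>\<^sub>0 'k::field"
  assumes "g \<in> carrier (binoid_algebra M)"
  shows "f \<ominus>\<^bsub>binoid_algebra M\<^esub> g = f - g"
  using assms by (simp add: a_minus_def a_inv_binoid_algebra)

end

section \<open>Fractions of monomials in the stalks\<close>

abbreviation monomial_fraction ::
  "'a binoid \<Rightarrow> ('a \<Rightarrow>\<^sub>0 'k::field) set \<Rightarrow> 'a \<Rightarrow> 'k \<Rightarrow> 'a \<Rightarrow> (('a \<Rightarrow>\<^sub>0 'k) \<times> ('a \<Rightarrow>\<^sub>0 'k)) set" where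
  "monomial_fraction M P a c f \<equiv>
     fraction (binoid_algebra M) (carrier (binoid_algebra M) - P) (bmonom M a c) (bmonom M f 1)"

lemma (in binoid) frac_mult_monomial_fraction:
  fixes P :: "('a \<Rightarrow>\<^sub>0 'k::field) set"
  assumes P: "primeideal P (binoid_algebra M)"
    and "a \<in> carrier M" "b \<in> carrier M"
    and "f \<in> carrier M - monomial_contraction M P" "g \<in> carrier M - monomial_contraction M P"
  shows "frac_mult (binoid_algebra M) (carrier (binoid_algebra M) - P)
      (monomial_fraction M P a c f) (monomial_fraction M P b d g)
    = monomial_fraction M P (a \<otimes> b) (c * d) (f \<otimes> g)"
proof -
  interpret P: primeideal P "binoid_algebra M" by fact
  show ?thesis
    using assms by (subst P.frac_mult_fraction[OF P.submonoid_complement])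
      (auto simp: bmonom_closed bmonom_mult monomial_contraction_iff)
qed

text \<open>Well-definedness of the map from a/f to \<open>T^a/T^f\<close> on stalks: a witness
  \<open>u\<close> outside the contraction gives the witness \<open>T^u\<close> outside
  \<open>P\<close>. Hence the union in \<open>binoid_units_to_units\<close> is a single
  class.\<close>

lemma (in binoid) UN_monomial_fraction:
  fixes P :: "('a \<Rightarrow>\<^sub>0 'k::field) set"
  assumes P: "primeideal P (binoid_algebra M)"
    and a: "a \<in> carrier M" and f: "f \<in> carrier M - monomial_contraction M P"
  shows "(\<Union>(b, g)\<in>fraction M (carrier M - monomial_contraction M P) a f. monomial_fraction M P b 1 g)
    = monomial_fraction M P a 1 f"
proof -
  interpret P: primeideal P "binoid_algebra M" by fact
  let ?S = "carrier M - monomial_contraction M P"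
  have S: "submonoid ?S M"
    using binoid_primeD(4)[OF binoid_prime_contraction[OF P]] .
  have "monomial_fraction M P b 1 g = monomial_fraction M P a 1 f"
    if "(b, g) \<in> fraction M ?S a f" for b g
  proof -
    obtain u where u: "u \<in> ?S" "b \<in> carrier M" "g \<in> ?S" "u \<otimes> (a \<otimes> g) = u \<otimes> (b \<otimes> f)"
      using \<open>(b, g) \<in> _\<close> by (auto simp: fraction_def)
    then show ?thesis
      using a f
      by (intro P.fraction_eqI[OF P.submonoid_complement, symmetric, where u = "bmonom M u 1"])
        (auto simp: bmonom_closed bmonom_mult monomial_contraction_iff)
  qed
  then show ?thesis
    using mem_fraction_self[OF S a f] by fast
qed

context ordered_binoid
begin

text \<open>A witness \<open>u\<close> outside \<open>P\<close> is also outside the smaller prime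
  spanned by the contraction. Dividing by it there puts the difference of the cross products into
  that prime; since \<open>a \<otimes> f'\<close> is outside the contraction, its coefficient must
  cancel, which is possible only if the two monomials agree.\<close>

lemma monomial_fraction_eqD:
  fixes P :: "('a \<Rightarrow>\<^sub>0 'k::field) set"
  assumes P: "primeideal P (binoid_algebra M)"
    and c: "c \<noteq> 0"
    and a: "a \<in> carrier M - monomial_contraction M P" "a' \<in> carrier M - monomial_contraction M P"
    and f: "f \<in> carrier M - monomial_contraction M P" "f' \<in> carrier M - monomial_contraction M P"
    and eq: "monomial_fraction M P a c f = monomial_fraction M P a' c' f'"
  shows "c = c'" "a \<otimes> f' = a' \<otimes> f"
proof -
  let ?R = "binoid_algebra M :: ('a \<Rightarrow>\<^sub>0 'k) ring"
  let ?p = "monomial_contraction M P"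
  interpret P: primeideal P ?R by fact
  have p: "binoid_prime M ?p"
    by (rule binoid_prime_contraction[OF P])
  note p' = binoid_primeD[OF p]
  interpret K: primeideal "combinatorial_ideal M ?p" ?R
    by (rule primeideal_combinatorial_ideal[OF p])
  have "bmonom M f 1 \<in> carrier ?R - P" "bmonom M f' 1 \<in> carrier ?R - P"
    using f by (auto simp: bmonom_closed monomial_contraction_iff)
  then obtain u where u: "u \<in> carrier ?R - P"
    and "u \<otimes>\<^bsub>?R\<^esub> (bmonom M a c \<otimes>\<^bsub>?R\<^esub> bmonom M f' 1) = u \<otimes>\<^bsub>?R\<^esub> (bmonom M a' c' \<otimes>\<^bsub>?R\<^esub> bmonom M f 1)"
    using eq P.fraction_eq_iff[OF P.submonoid_complement, of "bmonom M a c" "bmonom M a' c'"] a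
    by (auto simp: bmonom_closed)
  then have "u \<otimes>\<^bsub>?R\<^esub> bmonom M (a \<otimes> f') c = u \<otimes>\<^bsub>?R\<^esub> bmonom M (a' \<otimes> f) c'"
    using a f by (simp add: bmonom_mult)
  moreover have car: "bmonom M (a \<otimes> f') c \<in> carrier ?R" "bmonom M (a' \<otimes> f) c' \<in> carrier ?R"
    using a f by (auto simp: bmonom_closed)
  ultimately have "u \<otimes>\<^bsub>?R\<^esub> (bmonom M (a \<otimes> f') c \<ominus>\<^bsub>?R\<^esub> bmonom M (a' \<otimes> f) c') = \<zero>\<^bsub>?R\<^esub>"
    using u P.r_neg[of "u \<otimes>\<^bsub>?R\<^esub> bmonom M (a' \<otimes> f) c'"]
    by (simp add: P.minus_eq P.r_distr P.r_minus del: add_binoid_algebra zero_binoid_algebra)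
  then have "u \<otimes>\<^bsub>?R\<^esub> (bmonom M (a \<otimes> f') c \<ominus>\<^bsub>?R\<^esub> bmonom M (a' \<otimes> f) c') \<in> combinatorial_ideal M ?p"
    using K.zero_closed by metis
  then have "bmonom M (a \<otimes> f') c \<ominus>\<^bsub>?R\<^esub> bmonom M (a' \<otimes> f) c' \<in> combinatorial_ideal M ?p"
    using K.I_prime[of u "bmonom M (a \<otimes> f') c \<ominus>\<^bsub>?R\<^esub> bmonom M (a' \<otimes> f) c'"] u car
      combinatorial_ideal_contraction_subset[OF P] by blast
  then have "Poly_Mapping.keys (bmonom M (a \<otimes> f') c - bmonom M (a' \<otimes> f) c') \<subseteq> ?p"
    using car by (auto simp: a_minus_binoid_algebra combinatorial_ideal_def)
  moreover have notin: "a \<otimes> f' \<notin> ?p"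
    using a f p'(5) by auto
  moreover have infty: "a \<otimes> f' \<noteq> infty M"
    using notin p'(2) by metis
  ultimately have "Poly_Mapping.lookup (bmonom M (a \<otimes> f') c - bmonom M (a' \<otimes> f) c') (a \<otimes> f') = 0"
    by (auto simp: in_keys_iff)
  then have "c = (if a' \<otimes> f = a \<otimes> f' then c' else 0)"
    using infty by (auto simp: lookup_minus lookup_bmonom)
  then show "c = c'" "a \<otimes> f' = a' \<otimes> f"
    using c by (auto split: if_splits)
qed

text \<open>
  On \<open>D(T\<^sup>g)\<close> a unit is \<open>e / T\<^bsup>n g\<^esup>\<close> with \<open>e e' = T\<^bsup>w\<^esup>\<close> for a multiple \<open>w\<close> of \<open>g\<close>. Modulo each
  $\mathbb K[\mathfrak p]$ with $g \notin \mathfrak p$ the factor \<open>e\<close> is a single monomial; its exponent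
  divides \<open>w\<close>, so it survives modulo every other such prime and hence does not depend on $\mathfrak p$.
\<close>

lemma unit_section_monomial:
  fixes U :: "('a \<Rightarrow>\<^sub>0 'k::field) set set"
  assumes r: "r \<in> Units (ring_sections (binoid_algebra M) U)"
    and g: "g \<in> carrier M" "basic_open (binoid_algebra M) (bmonom M g 1) \<subseteq> U"
  obtains c a f where "c \<noteq> 0" "a \<in> carrier M" "f \<in> carrier M"
    "\<And>Q. Q \<in> basic_open (binoid_algebra M) (bmonom M g 1) \<Longrightarrow>
      a \<notin> monomial_contraction M Q \<and> f \<notin> monomial_contraction M Q \<and>
      r Q = monomial_fraction M Q a c f"
proof (cases "basic_open (binoid_algebra M) (bmonom M g 1 :: 'a \<Rightarrow>\<^sub>0 'k) = {}")
  \<comment> \<open>This happens for instance for \<open>g = infty M\<close>; the claim about points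
    is then vacuous. Otherwise a point is available from which \<open>a\<close> and \<open>c\<close>
    can be read off.\<close>
  case True
  then show thesis
    using that[of 1 \<one> \<one>] by auto
next
  case False
  let ?R = "binoid_algebra M :: ('a \<Rightarrow>\<^sub>0 'k) ring"
  define G where "G = (bmonom M g 1 :: 'a \<Rightarrow>\<^sub>0 'k)"
  interpret R: cring ?R by (rule cring_binoid_algebra)
  have reduced: "\<And>x. x \<in> carrier ?R \<Longrightarrow> \<forall>P\<in>ring_spec ?R. x \<in> P \<Longrightarrow> x = \<zero>\<^bsub>?R\<^esub>"
    using binoid_algebra_reduced by simp
  have G: "G \<in> carrier ?R" "basic_open ?R G \<subseteq> U"
    using g by (auto simp: G_def bmonom_closed)
  have Gpow: "G [^]\<^bsub>?R\<^esub> n = bmonom M (g [^] n) 1" for n :: nat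
    using bmonom_pow[OF g(1)] by (simp add: G_def)
  \<comment> \<open>The difference lies in all primes of \<open>D(G)\<close> and \<open>G\<close> in
    all the others, so their product is in every prime and vanishes by reducedness.\<close>
  have vanish: "G \<otimes>\<^bsub>?R\<^esub> x = G \<otimes>\<^bsub>?R\<^esub> y"
    if "x \<in> carrier ?R" "y \<in> carrier ?R" "\<And>Q. Q \<in> basic_open ?R G \<Longrightarrow> x \<ominus>\<^bsub>?R\<^esub> y \<in> Q" for x y
  proof -
    have "G \<otimes>\<^bsub>?R\<^esub> (x \<ominus>\<^bsub>?R\<^esub> y) \<in> Q" if "Q \<in> ring_spec ?R" for Q
    proof -
      interpret Q: primeideal Q ?R using that by (simp add: ring_spec_iff)
      show ?thesis
        using that \<open>\<And>Q. Q \<in> basic_open ?R G \<Longrightarrow> x \<ominus>\<^bsub>?R\<^esub> y \<in> Q\<close>[of Q] G(1)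
          Q.I_l_closed[of "x \<ominus>\<^bsub>?R\<^esub> y" G] Q.I_r_closed[of G "x \<ominus>\<^bsub>?R\<^esub> y"]
          R.minus_closed[OF \<open>x \<in> carrier ?R\<close> \<open>y \<in> carrier ?R\<close>] by blast
    qed
    then have "G \<otimes>\<^bsub>?R\<^esub> (x \<ominus>\<^bsub>?R\<^esub> y) = \<zero>\<^bsub>?R\<^esub>"
      using that G(1) by (intro reduced) auto
    then have "(G \<otimes>\<^bsub>?R\<^esub> x) \<ominus>\<^bsub>?R\<^esub> (G \<otimes>\<^bsub>?R\<^esub> y) = \<zero>\<^bsub>?R\<^esub>"
      using that(1,2) G(1)
      by (simp add: R.minus_eq R.r_distr R.r_minus del: add_binoid_algebra zero_binoid_algebra)
    then show ?thesis
      using that(1,2) G(1) R.r_right_minus_eq by simp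
  qed
  obtain r' where r': "r' \<in> carrier (ring_sections ?R U)"
      "r \<otimes>\<^bsub>ring_sections ?R U\<^esub> r' = \<one>\<^bsub>ring_sections ?R U\<^esub>"
    and r_car: "r \<in> carrier (ring_sections ?R U)"
    using r unfolding Units_def by blast
  have inv: "frac_mult ?R (carrier ?R - Q) (r Q) (r' Q) = fraction ?R (carrier ?R - Q) \<one>\<^bsub>?R\<^esub> \<one>\<^bsub>?R\<^esub>"
    if "Q \<in> U" for Q
    using fun_cong[OF r'(2), of Q] that by (simp add: ring_sections_def ring_localization_def)
  have s: "r \<in> fraction_sections ?R (zariski ?R) U" "r' \<in> fraction_sections ?R (zariski ?R) U"
    using r_car r'(1) by (simp_all add: ring_sections_def)
  obtain n e where e: "e \<in> carrier ?R"
    "\<And>Q. Q \<in> basic_open ?R G \<Longrightarrow> r Q = fraction ?R (carrier ?R - Q) e (G [^]\<^bsub>?R\<^esub> (n::nat))"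
    by (rule R.section_over_basic_open[OF reduced s(1) G]) blast+
  obtain m e' where e': "e' \<in> carrier ?R"
    "\<And>Q. Q \<in> basic_open ?R G \<Longrightarrow> r' Q = fraction ?R (carrier ?R - Q) e' (G [^]\<^bsub>?R\<^esub> (m::nat))"
    by (rule R.section_over_basic_open[OF reduced s(2) G]) blast+
  \<comment> \<open>The equation r r' = 1 in the stalk at \<open>Q\<close> holds up to a multiplier
    outside \<open>Q\<close>, which primality removes.\<close>
  have prod: "e \<otimes>\<^bsub>?R\<^esub> e' \<ominus>\<^bsub>?R\<^esub> G [^]\<^bsub>?R\<^esub> (n + m) \<in> Q" if Q: "Q \<in> basic_open ?R G" for Q
  proof -
    interpret Q: primeideal Q ?R using Q by (simp add: ring_spec_iff)
    have pow: "G [^]\<^bsub>?R\<^esub> k \<in> carrier ?R - Q" for k :: nat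
      using Q.nat_pow_notin[of G k] G Q by auto
    have "fraction ?R (carrier ?R - Q) (e \<otimes>\<^bsub>?R\<^esub> e') (G [^]\<^bsub>?R\<^esub> n \<otimes>\<^bsub>?R\<^esub> G [^]\<^bsub>?R\<^esub> m)
        = fraction ?R (carrier ?R - Q) \<one>\<^bsub>?R\<^esub> \<one>\<^bsub>?R\<^esub>"
      using inv[of Q] Q G(2) e e' pow
        R.frac_mult_fraction[OF Q.submonoid_complement e(1) e'(1) pow[of n] pow[of m]] by auto
    then have "fraction ?R (carrier ?R - Q) (e \<otimes>\<^bsub>?R\<^esub> e') (G [^]\<^bsub>?R\<^esub> (n + m))
        = fraction ?R (carrier ?R - Q) \<one>\<^bsub>?R\<^esub> \<one>\<^bsub>?R\<^esub>"
      using G(1) R.nat_pow_mult by simp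
    moreover have "\<one>\<^bsub>?R\<^esub> \<in> carrier ?R - Q"
      using pow[of 0] by simp
    ultimately obtain u where u: "u \<in> carrier ?R - Q"
      "u \<otimes>\<^bsub>?R\<^esub> (e \<otimes>\<^bsub>?R\<^esub> e' \<otimes>\<^bsub>?R\<^esub> \<one>\<^bsub>?R\<^esub>) = u \<otimes>\<^bsub>?R\<^esub> (\<one>\<^bsub>?R\<^esub> \<otimes>\<^bsub>?R\<^esub> G [^]\<^bsub>?R\<^esub> (n + m))"
      using R.fraction_eq_iff[OF Q.submonoid_complement, of "e \<otimes>\<^bsub>?R\<^esub> e'" "\<one>\<^bsub>?R\<^esub>" "G [^]\<^bsub>?R\<^esub> (n + m)" "\<one>\<^bsub>?R\<^esub>"]
        pow e(1) e'(1) R.one_closed by blast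
    have "u \<otimes>\<^bsub>?R\<^esub> (e \<otimes>\<^bsub>?R\<^esub> e' \<ominus>\<^bsub>?R\<^esub> G [^]\<^bsub>?R\<^esub> (n + m)) = \<zero>\<^bsub>?R\<^esub>"
      using u e(1) e'(1) G(1) R.r_neg[of "u \<otimes>\<^bsub>?R\<^esub> G [^]\<^bsub>?R\<^esub> (n + m)"]
      by (simp add: R.minus_eq R.r_distr R.r_minus
          del: add_binoid_algebra zero_binoid_algebra one_binoid_algebra)
    then have "u \<otimes>\<^bsub>?R\<^esub> (e \<otimes>\<^bsub>?R\<^esub> e' \<ominus>\<^bsub>?R\<^esub> G [^]\<^bsub>?R\<^esub> (n + m)) \<in> Q"
      using Q.zero_closed by metis
    moreover have "e \<otimes>\<^bsub>?R\<^esub> e' \<ominus>\<^bsub>?R\<^esub> G [^]\<^bsub>?R\<^esub> (n + m) \<in> carrier ?R"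
      using e(1) e'(1) G(1) by simp
    ultimately show ?thesis
      using Q.I_prime[of u "e \<otimes>\<^bsub>?R\<^esub> e' \<ominus>\<^bsub>?R\<^esub> G [^]\<^bsub>?R\<^esub> (n + m)"] u(1) by blast
  qed
  \<comment> \<open>By \<open>vanish\<close>, one more factor \<open>G\<close> turns the congruence
    \<open>prod\<close> into the exact factorisation \<open>E e' = T^w\<close>. The factor is put
    into \<open>E\<close> and is compensated by one more \<open>G\<close> in the denominator at the
    end.\<close>
  define E where "E = G \<otimes>\<^bsub>?R\<^esub> e"
  define w where "w = g \<otimes> g [^] (n + m)"
  have E: "E \<in> carrier ?R"
    using e(1) G(1) by (simp add: E_def)
  have "G \<otimes>\<^bsub>?R\<^esub> (e \<otimes>\<^bsub>?R\<^esub> e') = G \<otimes>\<^bsub>?R\<^esub> G [^]\<^bsub>?R\<^esub> (n + m)"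
    using prod e(1) e'(1) G(1) by (intro vanish) auto
  also have "\<dots> = bmonom M w 1"
    unfolding Gpow using g(1) by (simp add: G_def w_def bmonom_mult)
  finally have Ee': "E \<otimes>\<^bsub>?R\<^esub> e' = bmonom M w 1"
    using e(1) e'(1) G(1) by (simp add: E_def R.m_assoc)
  have contr: "binoid_prime M (monomial_contraction M Q)" "g \<notin> monomial_contraction M Q"
      "w \<in> carrier M - monomial_contraction M Q"
    if "Q \<in> basic_open ?R G" for Q
  proof -
    have Q: "primeideal Q ?R"
      using that by (simp add: ring_spec_iff)
    show prime: "binoid_prime M (monomial_contraction M Q)"
      by (rule binoid_prime_contraction[OF Q])
    show "g \<notin> monomial_contraction M Q"
      using that g(1) by (simp add: monomial_contraction_iff G_def)
    moreover have "g [^] k \<notin> monomial_contraction M Q" for k :: nat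
      using binoid_primeD(3,5)[OF prime] calculation g(1) by (induction k) auto
    ultimately show "w \<in> carrier M - monomial_contraction M Q"
      using binoid_primeD(5)[OF prime] g(1) by (auto simp: w_def)
  qed
  \<comment> \<open>An arbitrary point of \<open>D(G)\<close>, used to define the exponent
    \<open>a\<close>.\<close>
  obtain Q0 where Q0: "Q0 \<in> basic_open ?R G"
    using False by (auto simp: G_def)
  obtain a b where ab: "Poly_Mapping.keys E - monomial_contraction M Q0 = {a}"
      "a \<in> carrier M" "b \<in> carrier M" "a \<otimes> b = w"
    using factor_of_monomial[OF contr(1)[OF Q0] E e'(1) contr(3)[OF Q0] Ee'] by blast
  have keys: "Poly_Mapping.keys E - monomial_contraction M Q = {a}" if Q: "Q \<in> basic_open ?R G" for Q
  proof -
    have "a \<notin> monomial_contraction M Q"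
      using binoid_primeD(5)[OF contr(1)[OF Q] ab(2,3)] contr(3)[OF Q] ab(4) by auto
    then have "a \<in> Poly_Mapping.keys E - monomial_contraction M Q"
      using ab(1) by blast
    moreover obtain a' where "Poly_Mapping.keys E - monomial_contraction M Q = {a'}"
      using factor_of_monomial[OF contr(1)[OF Q] E e'(1) contr(3)[OF Q] Ee'] by blast
    ultimately show ?thesis
      by auto
  qed
  define c where "c = Poly_Mapping.lookup E a"
  have a_infty: "a \<noteq> infty M"
    using ab(1) binoid_primeD(2)[OF contr(1)[OF Q0]] by blast
  have T: "bmonom M a c \<in> carrier ?R"
    by (rule bmonom_closed[OF ab(2)])
  \<comment> \<open>Subtracting the term at \<open>a\<close> leaves only exponents in the
    contraction of \<open>Q\<close>, so the difference lies in the ideal they span, which is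
    contained in \<open>Q\<close>.\<close>
  have diff: "E \<ominus>\<^bsub>?R\<^esub> bmonom M a c \<in> Q" if Q: "Q \<in> basic_open ?R G" for Q
  proof -
    have "x \<in> monomial_contraction M Q" if "x \<in> Poly_Mapping.keys (E - bmonom M a c)" for x
    proof (rule ccontr)
      assume "x \<notin> monomial_contraction M Q"
      moreover have "x \<noteq> a"
        using that a_infty by (auto simp: in_keys_iff lookup_minus lookup_bmonom c_def)
      moreover from this have "x \<in> Poly_Mapping.keys E"
        using that by (auto simp: in_keys_iff lookup_minus lookup_bmonom)
      ultimately show False
        using keys[OF Q] by blast
    qed
    moreover have "E - bmonom M a c \<in> carrier ?R"
      using R.minus_closed[OF E T] by (simp add: a_minus_binoid_algebra[OF T])
    ultimately have "E - bmonom M a c \<in> combinatorial_ideal M (monomial_contraction M Q)"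
      using combinatorial_ideal_iff[OF binoid_primeD(1)[OF contr(1)[OF Q]]] by blast
    then show ?thesis
      using combinatorial_ideal_contraction_subset[of Q] Q
      by (auto simp: a_minus_binoid_algebra[OF T] ring_spec_iff)
  qed
  have GE: "G \<otimes>\<^bsub>?R\<^esub> E = G \<otimes>\<^bsub>?R\<^esub> bmonom M a c"
    using diff by (intro vanish E T)
  show thesis
  \<comment> \<open>The exponent is \<open>Suc n\<close> because
    \<open>e / G^n = E / G^(n+1)\<close>. Replacing \<open>E\<close> by the monomial is legitimate
    after multiplication by \<open>G\<close>, by \<open>GE\<close>, so \<open>G\<close> itself is
    the witness for equality of the fractions.\<close>
  proof (rule that[of c a "g [^] Suc n"])
    show "c \<noteq> 0"
      using ab(1) by (auto simp: c_def in_keys_iff)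
    fix Q assume "Q \<in> basic_open ?R (bmonom M g 1)"
    then have Q: "Q \<in> basic_open ?R G" by (simp add: G_def)
    then interpret Q: primeideal Q ?R by (simp add: ring_spec_iff)
    have pow: "G [^]\<^bsub>?R\<^esub> k \<in> carrier ?R - Q" for k :: nat
      using Q.nat_pow_notin[of G k] G Q by auto
    have "r Q = fraction ?R (carrier ?R - Q) e (G [^]\<^bsub>?R\<^esub> n)"
      by (rule e(2)[OF Q])
    also have "\<dots> = fraction ?R (carrier ?R - Q) (bmonom M a c) (G [^]\<^bsub>?R\<^esub> Suc n)"
    proof (rule R.fraction_eqI[OF Q.submonoid_complement e(1) T pow pow])
      show "G \<in> carrier ?R - Q" using G(1) Q by blast
      have "G \<otimes>\<^bsub>?R\<^esub> (e \<otimes>\<^bsub>?R\<^esub> G [^]\<^bsub>?R\<^esub> Suc n) = (G \<otimes>\<^bsub>?R\<^esub> E) \<otimes>\<^bsub>?R\<^esub> G [^]\<^bsub>?R\<^esub> n"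
        using e(1) G(1) by (simp add: E_def R.m_ac)
      also have "\<dots> = G \<otimes>\<^bsub>?R\<^esub> (bmonom M a c \<otimes>\<^bsub>?R\<^esub> G [^]\<^bsub>?R\<^esub> n)"
        unfolding GE using T G(1) by (simp add: R.m_assoc)
      finally show "G \<otimes>\<^bsub>?R\<^esub> (e \<otimes>\<^bsub>?R\<^esub> G [^]\<^bsub>?R\<^esub> Suc n) = G \<otimes>\<^bsub>?R\<^esub> (bmonom M a c \<otimes>\<^bsub>?R\<^esub> G [^]\<^bsub>?R\<^esub> n)" .
    qed
    finally have "r Q = monomial_fraction M Q a c (g [^] Suc n)"
      unfolding Gpow .
    moreover have "a \<notin> monomial_contraction M Q"
      using keys[OF Q] by blast
    moreover have "g [^] Suc n \<notin> monomial_contraction M Q"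
      using pow[of "Suc n"] g(1) unfolding Gpow by (simp add: monomial_contraction_iff del: nat_pow_Suc)
    ultimately show "a \<notin> monomial_contraction M Q \<and> g [^] Suc n \<notin> monomial_contraction M Q \<and>
        r Q = monomial_fraction M Q a c (g [^] Suc n)"
      by blast
  qed (use ab g in auto)
qed

end

section \<open>Units as locally given fractions\<close>

lemma (in binoid) binoid_spec_basis:
  assumes "openin (binoid_spec_topology M) W" "p \<in> W"
  obtains g where "g \<in> carrier M" "p \<in> binoid_spec M" "g \<notin> p" "{q \<in> binoid_spec M. g \<notin> q} \<subseteq> W"
proof (rule openin_topology_generated_by_basis[of "\<lambda>f. {q \<in> binoid_spec M. f \<notin> q}" "carrier M" W p])
  show "\<exists>h\<in>carrier M. {q \<in> binoid_spec M. h \<notin> q} = {q \<in> binoid_spec M. f \<notin> q} \<inter> {q \<in> binoid_spec M. g \<notin> q}"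
    if "f \<in> carrier M" "g \<in> carrier M" for f g
    using that by (intro bexI[of _ "f \<otimes> g"]) (auto simp: binoid_spec_def binoid_primeD(5))
qed (use assms that in \<open>auto simp: binoid_spec_topology_def\<close>)

lemma (in comm_monoid) fraction_inverse_cong:
  assumes S: "submonoid S G" and "a \<in> S" "a' \<in> S" "f \<in> S" "f' \<in> S"
    and "fraction G S a f = fraction G S a' f'"
  shows "fraction G S f a = fraction G S f' a'"
proof -
  have car: "a \<in> carrier G" "a' \<in> carrier G" "f \<in> carrier G" "f' \<in> carrier G"
    using assms submonoid.subset[OF S] by auto
  then obtain u where "u \<in> S" "u \<otimes> (a \<otimes> f') = u \<otimes> (a' \<otimes> f)"
    using fraction_eq_iff[OF S, of a a' f f'] assms by blast
  then show ?thesis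
    using car assms by (intro fraction_eqI[OF S, of _ _ _ _ u]) (auto simp: m_comm)
qed

lemma (in comm_monoid) frac_mult_inverse:
  assumes S: "submonoid S G" and "a \<in> S" "f \<in> S"
  shows "frac_mult G S (fraction G S a f) (fraction G S f a) = fraction G S \<one> \<one>"
proof -
  interpret S: submonoid S G by fact
  have car: "a \<in> carrier G" "f \<in> carrier G"
    using assms S.subset by auto
  have "fraction G S (a \<otimes> f) (f \<otimes> a) = fraction G S \<one> \<one>"
    using car assms by (intro fraction_eqI[OF S, of _ _ _ _ \<one>]) (auto simp: m_comm)
  then show ?thesis
    using car assms by (simp add: frac_mult_fraction)
qed

lemma mult_binoid_sections:
  "p \<in> U \<Longrightarrow> (s \<otimes>\<^bsub>binoid_sections M U\<^esub> t) p = frac_mult M (carrier M - p) (s p) (t p)"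
  by (simp add: binoid_sections_def binoid_localization_def)

lemma one_binoid_sections:
  "p \<in> U \<Longrightarrow> \<one>\<^bsub>binoid_sections M U\<^esub> p = fraction M (carrier M - p) \<one>\<^bsub>M\<^esub> \<one>\<^bsub>M\<^esub>"
  by (simp add: binoid_sections_def binoid_localization_def)

lemma mult_ring_sections:
  "P \<in> U \<Longrightarrow> (s \<otimes>\<^bsub>ring_sections R U\<^esub> t) P = frac_mult R (carrier R - P) (s P) (t P)"
  by (simp add: ring_sections_def ring_localization_def)

lemma one_ring_sections:
  "P \<in> U \<Longrightarrow> \<one>\<^bsub>ring_sections R U\<^esub> P = fraction R (carrier R - P) \<one>\<^bsub>R\<^esub> \<one>\<^bsub>R\<^esub>"
  by (simp add: ring_sections_def ring_localization_def)

lemma sections_extensional: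
  "(s \<otimes>\<^bsub>binoid_sections M U\<^esub> t) \<in> extensional U" "\<one>\<^bsub>binoid_sections M U\<^esub> \<in> extensional U"
  "(r \<otimes>\<^bsub>ring_sections R W\<^esub> v) \<in> extensional W" "\<one>\<^bsub>ring_sections R W\<^esub> \<in> extensional W"
  by (simp_all add: binoid_sections_def ring_sections_def)

lemma fraction_sectionsI:
  assumes "s \<in> extensional U"
    and "\<And>p. p \<in> U \<Longrightarrow> \<exists>W. openin X W \<and> p \<in> W \<and> W \<subseteq> U \<and> (\<exists>a\<in>carrier G. \<exists>f\<in>carrier G.
      \<forall>q\<in>W. f \<notin> q \<and> s q = fraction G (carrier G - q) a f)"
  shows "s \<in> fraction_sections G X U"
proof -
  have "s p \<in> frac_carrier G (carrier G - p)" if "p \<in> U" for p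
    using assms(2)[OF that] by (auto intro!: fraction_in_frac_carrier)
  then show ?thesis
    using assms unfolding fraction_sections_def by (auto simp: PiE_iff)
qed

text \<open>Sections only keep denominators outside the primes. For a unit the numerators stay
  outside as well, and conversely fractions with both outside can be inverted by swapping; no
  neighbourhood has to be shrunk.\<close>

lemma (in binoid) binoid_units_iff:
  assumes A: "A \<subseteq> binoid_spec M"
  shows "s \<in> Units (binoid_sections M A) \<longleftrightarrow> s \<in> extensional A \<and>
    (\<forall>p\<in>A. \<exists>W a f. openin (binoid_spec_topology M) W \<and> p \<in> W \<and> W \<subseteq> A \<and> a \<in> carrier M \<and> f \<in> carrier M \<and>
      (\<forall>q\<in>W. a \<notin> q \<and> f \<notin> q \<and> s q = fraction M (carrier M - q) a f))" (is "?L \<longleftrightarrow> ?R")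
proof
  assume L: ?L
  then obtain t where s: "s \<in> carrier (binoid_sections M A)" and t: "t \<in> carrier (binoid_sections M A)"
    and st: "s \<otimes>\<^bsub>binoid_sections M A\<^esub> t = \<one>\<^bsub>binoid_sections M A\<^esub>"
    unfolding Units_def by blast
  \<comment> \<open>If the product of a/f and b/g is one, then \<open>a \<otimes> b\<close> agrees
    with \<open>f \<otimes> g\<close> up to a multiplier outside \<open>q\<close>, so it is outside
    the prime, and so is its factor \<open>a\<close>.\<close>
  have unit: "a \<notin> q" if q: "q \<in> A" and a: "a \<in> carrier M" "f \<in> carrier M" "f \<notin> q"
    "s q = fraction M (carrier M - q) a f" for q a f
  proof -
    let ?S = "carrier M - q"
    have "binoid_prime M q"
      using q A by (auto simp: binoid_spec_def)
    note q' = binoid_primeD[OF this]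
    obtain b g where b: "b \<in> carrier M" "g \<in> ?S" "t q = fraction M ?S b g"
      using t q by (auto simp: binoid_sections_def fraction_sections_def PiE_iff frac_carrier_def)
    have "fraction M ?S (a \<otimes> b) (f \<otimes> g) = fraction M ?S \<one> \<one>"
      using fun_cong[OF st, of q] q a b frac_mult_fraction[OF q'(4), of a b f g]
      by (simp add: mult_binoid_sections one_binoid_sections)
    then obtain u where "u \<in> ?S" "u \<otimes> (a \<otimes> b \<otimes> \<one>) = u \<otimes> (\<one> \<otimes> (f \<otimes> g))"
      using fraction_eq_iff[OF q'(4), of "a \<otimes> b" \<one> "f \<otimes> g" \<one>] a b q' by auto
    then have u: "u \<in> carrier M" "u \<notin> q" "u \<otimes> (a \<otimes> b) = u \<otimes> (f \<otimes> g)"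
      using a b by auto
    have "u \<otimes> (f \<otimes> g) \<notin> q"
      using a b u(1,2) q'(5) by auto
    then have "u \<otimes> (a \<otimes> b) \<notin> q"
      using u(3) by simp
    then show "a \<notin> q"
      using q'(5)[of u "a \<otimes> b"] q'(5)[of a b] a b u(1) by auto
  qed
  show ?R
  proof (intro conjI ballI)
    show "s \<in> extensional A"
      using s by (auto simp: binoid_sections_def fraction_sections_def PiE_iff)
    fix p assume "p \<in> A"
    then obtain W a f where W: "openin (binoid_spec_topology M) W" "p \<in> W" "W \<subseteq> A"
      "a \<in> carrier M" "f \<in> carrier M" "\<forall>q\<in>W. f \<notin> q \<and> s q = fraction M (carrier M - q) a f"
      using s unfolding binoid_sections_def fraction_sections_def by auto
    have "\<forall>q\<in>W. a \<notin> q \<and> f \<notin> q \<and> s q = fraction M (carrier M - q) a f"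
    proof
      fix q assume "q \<in> W"
      then show "a \<notin> q \<and> f \<notin> q \<and> s q = fraction M (carrier M - q) a f"
        using unit[of q a f] W by auto
    qed
    with W show "\<exists>W a f. openin (binoid_spec_topology M) W \<and> p \<in> W \<and> W \<subseteq> A \<and> a \<in> carrier M \<and>
        f \<in> carrier M \<and> (\<forall>q\<in>W. a \<notin> q \<and> f \<notin> q \<and> s q = fraction M (carrier M - q) a f)"
      by blast
  qed
next
  assume R: ?R
  note R_local = bspec[OF conjunct2[OF R]]
  have "\<forall>q\<in>A. \<exists>a f. a \<in> carrier M - q \<and> f \<in> carrier M - q \<and> s q = fraction M (carrier M - q) a f"
  proof
    fix q assume "q \<in> A"
    from R_local[OF this] obtain W a f where W: "q \<in> W" "a \<in> carrier M" "f \<in> carrier M"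
      "\<forall>q\<in>W. a \<notin> q \<and> f \<notin> q \<and> s q = fraction M (carrier M - q) a f"
      by (elim exE conjE) (rule that; assumption)
    from bspec[OF W(4,1)] W(2,3)
    show "\<exists>a f. a \<in> carrier M - q \<and> f \<in> carrier M - q \<and> s q = fraction M (carrier M - q) a f"
      by blast
  qed
  then obtain a f where af: "\<And>q. q \<in> A \<Longrightarrow> a q \<in> carrier M - q" "\<And>q. q \<in> A \<Longrightarrow> f q \<in> carrier M - q"
    "\<And>q. q \<in> A \<Longrightarrow> s q = fraction M (carrier M - q) (a q) (f q)"
    by metis
  \<comment> \<open>The inverse is defined from representatives chosen point by point. By
    \<open>fraction_inverse_cong\<close> its values do not depend on the choice, so swapping a local
    form of \<open>s\<close> gives a local form of \<open>t\<close>.\<close>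
  define t where "t = (\<lambda>q\<in>A. fraction M (carrier M - q) (f q) (a q))"
  have sub: "submonoid (carrier M - q) M" if "q \<in> A" for q
    using that A binoid_primeD(4) by (auto simp: binoid_spec_def)
  have "s \<in> carrier (binoid_sections M A)"
    unfolding binoid_sections_def
  proof (simp, rule fraction_sectionsI)
    fix p assume "p \<in> A"
    then obtain W b g where W: "openin (binoid_spec_topology M) W" "p \<in> W" "W \<subseteq> A"
      "b \<in> carrier M" "g \<in> carrier M" "\<forall>q\<in>W. b \<notin> q \<and> g \<notin> q \<and> s q = fraction M (carrier M - q) b g"
      using R_local[OF \<open>p \<in> A\<close>] by (elim exE conjE) (rule that; assumption)
    show "\<exists>W. openin (binoid_spec_topology M) W \<and> p \<in> W \<and> W \<subseteq> A \<and> (\<exists>a\<in>carrier M. \<exists>f\<in>carrier M.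
        \<forall>q\<in>W. f \<notin> q \<and> s q = fraction M (carrier M - q) a f)"
      by (intro exI[of _ W] conjI bexI[of _ b] bexI[of _ g] ballI W(1-5)) (drule bspec[OF W(6)], simp)+
  qed (rule conjunct1[OF R])
  moreover have "t \<in> carrier (binoid_sections M A)"
    unfolding binoid_sections_def
  proof (simp, rule fraction_sectionsI)
    fix p assume "p \<in> A"
    then obtain W b g where W: "openin (binoid_spec_topology M) W" "p \<in> W" "W \<subseteq> A"
      "b \<in> carrier M" "g \<in> carrier M" "\<forall>q\<in>W. b \<notin> q \<and> g \<notin> q \<and> s q = fraction M (carrier M - q) b g"
      using R_local[OF \<open>p \<in> A\<close>] by (elim exE conjE) (rule that; assumption)
    have t: "b \<notin> q \<and> t q = fraction M (carrier M - q) g b" if "q \<in> W" for q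
    proof -
      have q: "q \<in> A" "b \<notin> q" "g \<notin> q" "s q = fraction M (carrier M - q) b g"
        using W that by blast+
      have "fraction M (carrier M - q) (f q) (a q) = fraction M (carrier M - q) g b"
        by (rule fraction_inverse_cong[OF sub[OF q(1)] af(1)[OF q(1)] _ af(2)[OF q(1)]])
          (use W(4,5) q af(3)[OF q(1)] in simp_all)
      with q show ?thesis
        by (simp add: t_def)
    qed
    show "\<exists>W. openin (binoid_spec_topology M) W \<and> p \<in> W \<and> W \<subseteq> A \<and> (\<exists>a\<in>carrier M. \<exists>f\<in>carrier M.
        \<forall>q\<in>W. f \<notin> q \<and> t q = fraction M (carrier M - q) a f)"
      by (intro exI[of _ W] conjI bexI[of _ g] bexI[of _ b] ballI W(1-5)) (drule t, simp)+
  qed (simp add: t_def)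
  moreover have "s \<otimes>\<^bsub>binoid_sections M A\<^esub> t = \<one>\<^bsub>binoid_sections M A\<^esub>"
    "t \<otimes>\<^bsub>binoid_sections M A\<^esub> s = \<one>\<^bsub>binoid_sections M A\<^esub>"
    by (rule extensionalityI[OF sections_extensional(1,2)],
        simp add: mult_binoid_sections one_binoid_sections t_def af(3) frac_mult_inverse[OF sub af(1,2)]
          frac_mult_inverse[OF sub af(2,1)])+
  ultimately show ?L
    unfolding Units_def by blast
qed

context ordered_binoid
begin

text \<open>The ring counterpart of the converse in \<open>binoid_units_iff\<close>. With
  \<open>c\<close> nonzero and \<open>a\<close> outside the contraction, \<open>c T^a\<close> is
  outside \<open>Q\<close> and can serve as denominator of the inverse
  \<open>T^f / (c T^a)\<close>.\<close>

lemma monomial_sections_in_Units: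
  fixes U :: "('a \<Rightarrow>\<^sub>0 'k::field) set set"
  assumes U: "U \<subseteq> ring_spec (binoid_algebra M)" and ext: "r \<in> extensional U"
    and local: "\<And>P. P \<in> U \<Longrightarrow> \<exists>W c a f. openin (zariski (binoid_algebra M :: ('a \<Rightarrow>\<^sub>0 'k) ring)) W \<and>
      P \<in> W \<and> W \<subseteq> U \<and> c \<noteq> 0 \<and> a \<in> carrier M \<and> f \<in> carrier M \<and>
      (\<forall>Q\<in>W. a \<notin> monomial_contraction M Q \<and> f \<notin> monomial_contraction M Q \<and>
        r Q = monomial_fraction M Q a c f)"
  shows "r \<in> Units (ring_sections (binoid_algebra M) U)"
proof -
  let ?R = "binoid_algebra M :: ('a \<Rightarrow>\<^sub>0 'k) ring"
  interpret R: cring ?R by (rule cring_binoid_algebra)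
  have prime: "primeideal Q ?R" if "Q \<in> U" for Q
    using that U by (auto simp: ring_spec_iff)
  have sub: "submonoid (carrier ?R - Q) ?R" if "Q \<in> U" for Q
    using primeideal.submonoid_complement[OF prime[OF that]] .
  have frac: "bmonom M a c \<in> carrier ?R - Q"
    if "Q \<in> U" "a \<in> carrier M - monomial_contraction M Q" "c \<noteq> 0" for Q a c
    using that bmonom_mem_prime_iff[OF prime[OF that(1)]] by (simp add: bmonom_closed)
  have "\<forall>Q\<in>U. \<exists>c a f. c \<noteq> 0 \<and> a \<in> carrier M - monomial_contraction M Q \<and>
      f \<in> carrier M - monomial_contraction M Q \<and> r Q = monomial_fraction M Q a c f"
  proof
    fix Q assume "Q \<in> U"
    from local[OF this] obtain W c a f where W: "Q \<in> W" "c \<noteq> 0" "a \<in> carrier M" "f \<in> carrier M"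
      "\<forall>Q\<in>W. a \<notin> monomial_contraction M Q \<and> f \<notin> monomial_contraction M Q \<and> r Q = monomial_fraction M Q a c f"
      by (elim exE conjE) (rule that; assumption)
    from bspec[OF W(5,1)] W(2-4)
    show "\<exists>c a f. c \<noteq> 0 \<and> a \<in> carrier M - monomial_contraction M Q \<and>
      f \<in> carrier M - monomial_contraction M Q \<and> r Q = monomial_fraction M Q a c f"
      by blast
  qed
  then obtain c a f where caf: "\<And>Q. Q \<in> U \<Longrightarrow> c Q \<noteq> 0" "\<And>Q. Q \<in> U \<Longrightarrow> a Q \<in> carrier M - monomial_contraction M Q"
    "\<And>Q. Q \<in> U \<Longrightarrow> f Q \<in> carrier M - monomial_contraction M Q"
    "\<And>Q. Q \<in> U \<Longrightarrow> r Q = monomial_fraction M Q (a Q) (c Q) (f Q)"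
    by metis
  have mem: "bmonom M (a Q) (c Q) \<in> carrier ?R - Q" "bmonom M (f Q) 1 \<in> carrier ?R - Q" if "Q \<in> U" for Q
    using frac caf(1-3) that by auto
  define v where "v = (\<lambda>Q\<in>U. fraction ?R (carrier ?R - Q) (bmonom M (f Q) 1) (bmonom M (a Q) (c Q)))"
  have "r \<in> carrier (ring_sections ?R U)"
    unfolding ring_sections_def
  proof (simp, rule fraction_sectionsI[OF ext])
    fix P assume "P \<in> U"
    then obtain W d b g where W: "openin (zariski ?R) W" "P \<in> W" "W \<subseteq> U" "d \<noteq> 0" "b \<in> carrier M" "g \<in> carrier M"
      "\<forall>Q\<in>W. b \<notin> monomial_contraction M Q \<and> g \<notin> monomial_contraction M Q \<and> r Q = monomial_fraction M Q b d g"
      using local[OF \<open>P \<in> U\<close>] by (elim exE conjE) (rule that; assumption)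
    show "\<exists>W. openin (zariski ?R) W \<and> P \<in> W \<and> W \<subseteq> U \<and> (\<exists>a\<in>carrier ?R. \<exists>f\<in>carrier ?R.
        \<forall>q\<in>W. f \<notin> q \<and> r q = fraction ?R (carrier ?R - q) a f)"
      by (intro exI[of _ W] conjI bexI[of _ "bmonom M b d"] bexI[of _ "bmonom M g 1"] ballI bmonom_closed W(1-6))
        (drule bspec[OF W(7)], simp add: monomial_contraction_iff W(6))+
  qed
  moreover have "v \<in> carrier (ring_sections ?R U)"
    unfolding ring_sections_def
  proof (simp, rule fraction_sectionsI)
    fix P assume "P \<in> U"
    then obtain W d b g where W: "openin (zariski ?R) W" "P \<in> W" "W \<subseteq> U" "d \<noteq> 0" "b \<in> carrier M" "g \<in> carrier M"
      "\<forall>Q\<in>W. b \<notin> monomial_contraction M Q \<and> g \<notin> monomial_contraction M Q \<and> r Q = monomial_fraction M Q b d g"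
      using local[OF \<open>P \<in> U\<close>] by (elim exE conjE) (rule that; assumption)
    have v: "bmonom M b d \<notin> Q \<and> v Q = fraction ?R (carrier ?R - Q) (bmonom M g 1) (bmonom M b d)"
      if "Q \<in> W" for Q
    proof -
      have Q: "Q \<in> U" "b \<in> carrier M - monomial_contraction M Q" "g \<in> carrier M - monomial_contraction M Q"
          "r Q = monomial_fraction M Q b d g"
        using W that by blast+
      have "fraction ?R (carrier ?R - Q) (bmonom M (f Q) 1) (bmonom M (a Q) (c Q))
          = fraction ?R (carrier ?R - Q) (bmonom M g 1) (bmonom M b d)"
        by (rule R.fraction_inverse_cong[OF sub[OF Q(1)]])
          (use W(4-6) Q caf[OF Q(1)] in \<open>simp_all add: frac del: Diff_iff\<close>)
      with Q frac[OF Q(1,2) W(4)] show ?thesis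
        by (simp add: v_def)
    qed
    show "\<exists>W. openin (zariski ?R) W \<and> P \<in> W \<and> W \<subseteq> U \<and> (\<exists>a\<in>carrier ?R. \<exists>f\<in>carrier ?R.
        \<forall>q\<in>W. f \<notin> q \<and> v q = fraction ?R (carrier ?R - q) a f)"
      by (intro exI[of _ W] conjI bexI[of _ "bmonom M g 1"] bexI[of _ "bmonom M b d"] ballI bmonom_closed W(1-6))
        (drule v, simp)+
  qed (simp add: v_def)
  moreover have "r \<otimes>\<^bsub>ring_sections ?R U\<^esub> v = \<one>\<^bsub>ring_sections ?R U\<^esub>"
    "v \<otimes>\<^bsub>ring_sections ?R U\<^esub> r = \<one>\<^bsub>ring_sections ?R U\<^esub>"
    by (rule extensionalityI[OF sections_extensional(3,4)],
        simp add: mult_ring_sections one_ring_sections v_def caf(4) R.frac_mult_inverse[OF sub mem]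
          R.frac_mult_inverse[OF sub mem(2,1)] del: one_binoid_algebra)+
  ultimately show ?thesis
    unfolding Units_def by blast
qed

text \<open>As \<open>\<one>\<close> is the only possible unit, every element is a constant plus a
  combination of nonunits. A prime containing all nonunit monomials therefore cannot contain
  anything more. Thus the removed point is recognised by its monomials.\<close>

lemma prime_eq_combinatorial_nonunits_iff:
  fixes P :: "('a \<Rightarrow>\<^sub>0 'k::field) set"
  assumes P: "primeideal P (binoid_algebra M)"
  shows "P = combinatorial_ideal M (nonunits M) \<longleftrightarrow> monomial_contraction M P = nonunits M"
proof
  let ?R = "binoid_algebra M :: ('a \<Rightarrow>\<^sub>0 'k) ring"
  interpret P: primeideal P ?R by fact
  note p' = binoid_primeD[OF binoid_prime_contraction[OF P]]
  have units: "a \<in> nonunits M" if "a \<in> carrier M" "a \<noteq> \<one>" for a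
    using that Units_trivial by (auto simp: nonunits_def)
  {
    assume eq: "P = combinatorial_ideal M (nonunits M)"
    have "bmonom M a 1 \<in> (combinatorial_ideal M (nonunits M) :: ('a \<Rightarrow>\<^sub>0 'k) set)" if "a \<in> nonunits M" for a
      using that by (auto simp: combinatorial_ideal_def keys_bmonom)
    then have "nonunits M \<subseteq> monomial_contraction M P"
      using eq by (auto simp: monomial_contraction_iff nonunits_def)
    moreover have "monomial_contraction M P \<subseteq> nonunits M"
      using p'(1,3) units by blast
    ultimately show "monomial_contraction M P = nonunits M"
      by blast
  next
    assume eq: "monomial_contraction M P = nonunits M"
    then have sub: "combinatorial_ideal M (nonunits M) \<subseteq> P"
      using combinatorial_ideal_contraction_subset[OF P] by simp
    moreover have "P \<subseteq> combinatorial_ideal M (nonunits M)"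
    proof
      fix f assume f: "f \<in> P"
      then have f_car: "f \<in> carrier ?R"
        using P.a_subset by blast
      \<comment> \<open>The constant term. \<open>f - T\<close> lies in the span of the nonunits and
        hence in \<open>P\<close>, so \<open>T\<close> does too; a nonzero constant would be a unit
        in \<open>P\<close>.\<close>
      define c where "c = Poly_Mapping.lookup f \<one>"
      define T where "T = (bmonom M \<one> c :: 'a \<Rightarrow>\<^sub>0 'k)"
      have T: "T \<in> carrier ?R"
        by (simp add: T_def bmonom_closed)
      have one: "\<one> \<noteq> infty M"
        using p'(2,3) by metis
      have keys: "a \<in> nonunits M" if "a \<in> Poly_Mapping.keys (f - T)" for a
      proof -
        have "a \<noteq> \<one>"
          using that one by (auto simp: in_keys_iff lookup_minus lookup_bmonom T_def c_def)
        moreover have "a \<in> carrier M"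
          using keys_subset_carrier[of "f - T" M] that P.minus_closed[OF f_car T]
          by (auto simp: a_minus_binoid_algebra[OF T])
        ultimately show ?thesis
          by (intro units)
      qed
      have "f - T \<in> carrier ?R"
        using P.minus_closed[OF f_car T] by (simp add: a_minus_binoid_algebra[OF T])
      then have fT: "f - T \<in> combinatorial_ideal M (nonunits M)"
        using keys keys_subset_carrier[of "f - T" M] by (auto simp: combinatorial_ideal_def)
      then have "f \<ominus>\<^bsub>?R\<^esub> T \<in> P"
        using sub by (auto simp: a_minus_binoid_algebra[OF T])
      then have "f \<ominus>\<^bsub>?R\<^esub> (f \<ominus>\<^bsub>?R\<^esub> T) \<in> P"
        unfolding P.minus_eq[of f "f \<ominus>\<^bsub>?R\<^esub> T"]
        by (intro additive_subgroup.a_closed[OF P.is_additive_subgroup f]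
            additive_subgroup.a_inv_closed[OF P.is_additive_subgroup])
      then have "T \<in> P"
        using P.minus_closed[OF f_car T] by (simp add: a_minus_binoid_algebra[OF T] a_minus_binoid_algebra)
      have "c = 0"
      proof (rule ccontr)
        assume "c \<noteq> 0"
        then show False
          using bmonom_mem_prime_iff[OF P one_closed] \<open>T \<in> P\<close> p'(3) by (simp add: T_def)
      qed
      with fT show "f \<in> combinatorial_ideal M (nonunits M)"
        by (simp add: T_def)
    qed
    ultimately show "P = combinatorial_ideal M (nonunits M)"
      by blast
  }
qed

end

section \<open>The splitting of the sheaf of units\<close>

lemma (in binoid) combinatorial_open_in_ring_spec:
  fixes U :: "('a \<Rightarrow>\<^sub>0 'k::field) set set"
  assumes "openin (combinatorial_topology M) U" "P \<in> U"
  shows "primeideal P (binoid_algebra M)"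
  using assms unfolding openin_combinatorial_topology
  by (auto simp: combinatorial_open_def punctured_algebra_spec_def ring_spec_def)

abbreviation combinatorial_preimage :: "'a binoid \<Rightarrow> ('a \<Rightarrow>\<^sub>0 'k::field) set set \<Rightarrow> 'a set set" where
  "combinatorial_preimage M U \<equiv> {p \<in> punctured_binoid_spec M. combinatorial_ideal M p \<in> U}"

context ordered_binoid
begin

text \<open>Combinatorial open sets only test which monomials a prime contains, and the removed
  point is detected by the same data. \<open>P\<close> and the ideal spanned by its monomials cannot
  be told apart in this way.\<close>

lemma contraction_mem_combinatorial_open_iff:
  fixes U :: "('a \<Rightarrow>\<^sub>0 'k::field) set set"
  assumes U: "openin (combinatorial_topology M) U" and P: "primeideal P (binoid_algebra M)"
  shows "combinatorial_ideal M (monomial_contraction M P) \<in> U \<longleftrightarrow> P \<in> U"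
proof -
  obtain I where I: "binoid_ideal M I" "U = combinatorial_open M I"
    using U unfolding openin_combinatorial_topology by blast
  let ?p = "monomial_contraction M P"
  let ?K = "combinatorial_ideal M ?p :: ('a \<Rightarrow>\<^sub>0 'k) set"
  have p: "binoid_prime M ?p"
    by (rule binoid_prime_contraction[OF P])
  have K: "primeideal ?K (binoid_algebra M)"
    by (rule primeideal_combinatorial_ideal[OF p])
  have contr: "monomial_contraction M ?K = ?p"
    by (rule monomial_contraction_combinatorial_ideal[OF p])
  have "bmonom M a 1 \<in> ?K \<longleftrightarrow> bmonom M a 1 \<in> P" if "a \<in> I" for a
  proof -
    have "a \<in> carrier M"
      using that I(1) by (auto simp: binoid_ideal_def)
    then show ?thesis
      using contr monomial_contraction_iff[of a ?K] monomial_contraction_iff[of a P] by simp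
  qed
  moreover have "?K \<in> punctured_algebra_spec M \<longleftrightarrow> P \<in> punctured_algebra_spec M"
    unfolding punctured_algebra_spec_def
    using prime_eq_combinatorial_nonunits_iff[OF P] prime_eq_combinatorial_nonunits_iff[OF K] contr P K
    by (simp add: ring_spec_iff)
  ultimately show ?thesis
    unfolding I(2) combinatorial_open_eq[OF I(1)] by blast
qed

text \<open>The puncture on the binoid side is automatic, because the image of the removed prime
  never lies in \<open>U\<close>.\<close>

lemma combinatorial_preimage_eq:
  fixes U :: "('a \<Rightarrow>\<^sub>0 'k::field) set set"
  assumes U: "openin (combinatorial_topology M) U"
  shows "combinatorial_preimage M U = {p. binoid_prime M p \<and> combinatorial_ideal M p \<in> U}"
proof -
  have "combinatorial_ideal M (nonunits M) \<notin> U"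
    using U unfolding openin_combinatorial_topology
    by (auto simp: combinatorial_open_def punctured_algebra_spec_def)
  then show ?thesis
    by (auto simp: punctured_binoid_spec_def binoid_spec_def)
qed

lemma contraction_mem_preimage:
  fixes U :: "('a \<Rightarrow>\<^sub>0 'k::field) set set"
  assumes U: "openin (combinatorial_topology M) U" and P: "P \<in> U"
  shows "monomial_contraction M P \<in> combinatorial_preimage M U"
  using contraction_mem_combinatorial_open_iff[OF U] combinatorial_open_in_ring_spec[OF U P] P
  by (auto simp: combinatorial_preimage_eq[OF U] binoid_prime_contraction)

text \<open>A monomial \<open>a\<close> of the defining ideal only gives \<open>D(T^a)\<close> minus
  the removed point. Multiplying it by a nonunit outside the contraction of \<open>P\<close> yields
  a full basic open set that avoids this point.\<close>

lemma combinatorial_open_basis: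
  fixes U :: "('a \<Rightarrow>\<^sub>0 'k::field) set set"
  assumes U: "openin (combinatorial_topology M) U" and P: "P \<in> U"
  obtains g where "g \<in> carrier M" "P \<in> basic_open (binoid_algebra M) (bmonom M g 1)"
    "basic_open (binoid_algebra M) (bmonom M g (1::'k)) \<subseteq> U"
proof -
  obtain I where I: "binoid_ideal M I" "U = combinatorial_open M I"
    using U unfolding openin_combinatorial_topology by blast
  have P': "P \<in> ring_spec (binoid_algebra M)" "P \<noteq> combinatorial_ideal M (nonunits M)"
    using P I(2) by (auto simp: combinatorial_open_def punctured_algebra_spec_def)
  have prime: "primeideal P (binoid_algebra M)"
    using P' by (simp add: ring_spec_iff)
  note p = binoid_primeD[OF binoid_prime_contraction[OF prime]]
  obtain a where a: "a \<in> I" "bmonom M a 1 \<notin> P"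
    using P unfolding I(2) combinatorial_open_eq[OF I(1)] by blast
  have a_car: "a \<in> carrier M"
    using a I(1) by (auto simp: binoid_ideal_def)
  have "monomial_contraction M P \<noteq> nonunits M"
    using P'(2) prime_eq_combinatorial_nonunits_iff[OF prime] by simp
  moreover have "monomial_contraction M P \<subseteq> nonunits M"
    using p(1,3) Units_trivial by (auto simp: nonunits_def)
  \<comment> \<open>\<open>P\<close> is not the removed point, so its monomials do not exhaust the
    nonunits. \<open>T^h\<close> lies in the removed prime but not in \<open>P\<close>.\<close>
  ultimately obtain h where h: "h \<in> nonunits M" "h \<notin> monomial_contraction M P"
    by blast
  have h_car: "h \<in> carrier M"
    using h by (auto simp: nonunits_def)
  show thesis
  proof (rule that[of "a \<otimes> h"])
    show "a \<otimes> h \<in> carrier M" using a_car h_car by simp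
    have "a \<otimes> h \<notin> monomial_contraction M P"
      using p(5)[OF a_car h_car] a h a_car by (simp add: monomial_contraction_iff)
    then show "P \<in> basic_open (binoid_algebra M) (bmonom M (a \<otimes> h) 1)"
      using P' a_car h_car by (simp add: monomial_contraction_iff)
    show "basic_open (binoid_algebra M) (bmonom M (a \<otimes> h) (1::'k)) \<subseteq> U"
    proof
      fix Q assume Q: "Q \<in> basic_open (binoid_algebra M) (bmonom M (a \<otimes> h) (1::'k))"
      then have Qp: "primeideal Q (binoid_algebra M)"
        by (simp add: ring_spec_iff)
      have "a \<otimes> h \<notin> monomial_contraction M Q"
        using Q a_car h_car by (simp add: monomial_contraction_iff)
      then have ah: "a \<notin> monomial_contraction M Q" "h \<notin> monomial_contraction M Q"
        using binoid_primeD(5)[OF binoid_prime_contraction[OF Qp] a_car h_car] by auto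
      then have "Q \<noteq> combinatorial_ideal M (nonunits M)"
        using prime_eq_combinatorial_nonunits_iff[OF Qp] h by blast
      then show "Q \<in> U"
        using Q a ah a_car unfolding I(2) combinatorial_open_eq[OF I(1)]
        by (auto simp: punctured_algebra_spec_def monomial_contraction_iff)
    qed
  qed
qed

end

section \<open>The morphism on sections\<close>

lemma openin_zariski_basic_open:
  "f \<in> carrier R \<Longrightarrow> openin (zariski R) (basic_open R f)"
  unfolding zariski_def by (rule topology_generated_by_Basis) blast

lemma openin_binoid_spec_basic:
  "g \<in> carrier M \<Longrightarrow> openin (binoid_spec_topology M) {q \<in> binoid_spec M. g \<notin> q}"
  unfolding binoid_spec_topology_def by (rule topology_generated_by_Basis) blast

abbreviation (input) units_morphism ::
  "'a binoid \<Rightarrow> ('a \<Rightarrow>\<^sub>0 'k::field) set set \<Rightarrow> (('a \<Rightarrow>\<^sub>0 'k) set \<Rightarrow> 'k) \<times> ('a set \<Rightarrow> ('a \<times> 'a) set) \<Rightarrow>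
    ('a \<Rightarrow>\<^sub>0 'k) set \<Rightarrow> (('a \<Rightarrow>\<^sub>0 'k) \<times> ('a \<Rightarrow>\<^sub>0 'k)) set" where
  "units_morphism M \<equiv>
    sum_morphism (ring_units_sheaf (binoid_algebra M)) (constants_to_units M) (binoid_units_to_units M)"

text \<open>At \<open>P\<close> the morphism depends only on \<open>c P\<close> and on the germ of
  \<open>s\<close> at the contraction. All its properties below are checked point by point through
  this formula.\<close>

lemma (in binoid) units_morphism_value:
  fixes U :: "('a \<Rightarrow>\<^sub>0 'k::field) set set"
  assumes P: "primeideal P (binoid_algebra M)" "P \<in> U"
    and a: "a \<in> carrier M" and f: "f \<in> carrier M - monomial_contraction M P"
    and s: "s (monomial_contraction M P) = fraction M (carrier M - monomial_contraction M P) a f"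
  shows "units_morphism M U (c, s) P = monomial_fraction M P a (c P) f"
proof -
  have one: "\<one> \<in> carrier M - monomial_contraction M P"
    using binoid_primeD(3)[OF binoid_prime_contraction[OF P(1)]] by simp
  have "constants_to_units M U c P = monomial_fraction M P \<one> (c P) \<one>"
    using P by (simp add: constants_to_units_def)
  moreover have "binoid_units_to_units M U s P = monomial_fraction M P a 1 f"
    using P UN_monomial_fraction[OF P(1) a f] by (simp add: binoid_units_to_units_def s)
  ultimately show ?thesis
    using P a f one frac_mult_monomial_fraction[OF P(1) one_closed a one f, of "c P" 1]
    by (simp add: sum_morphism_def ring_units_sheaf_def units_of_def mult_ring_sections)
qed

lemma units_morphism_extensional: "units_morphism M U x \<in> extensional U"
  by (simp add: sum_morphism_def ring_units_sheaf_def units_of_def sections_extensional split: prod.splits)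

lemma (in binoid) binoid_unit_value:
  assumes "A \<subseteq> binoid_spec M" "s \<in> Units (binoid_sections M A)" "p \<in> A"
  obtains a f where "a \<in> carrier M - p" "f \<in> carrier M - p" "s p = fraction M (carrier M - p) a f"
proof -
  have R: "\<forall>p\<in>A. \<exists>W a f. openin (binoid_spec_topology M) W \<and> p \<in> W \<and> W \<subseteq> A \<and> a \<in> carrier M \<and> f \<in> carrier M \<and>
      (\<forall>q\<in>W. a \<notin> q \<and> f \<notin> q \<and> s q = fraction M (carrier M - q) a f)"
    using assms binoid_units_iff by blast
  obtain W a f where W: "p \<in> W" "a \<in> carrier M" "f \<in> carrier M"
    "\<forall>q\<in>W. a \<notin> q \<and> f \<notin> q \<and> s q = fraction M (carrier M - q) a f"
    using bspec[OF R assms(3)] by (elim exE conjE) (rule that; assumption)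
  show thesis
    using that[of a f] bspec[OF W(4,1)] W(2,3) by simp
qed

lemma sections_constant_units_sheaf:
  "carrier (sections (constant_units_sheaf X) U) = {c \<in> U \<rightarrow>\<^sub>E UNIV - {0}.
     \<forall>p\<in>U. \<exists>W. openin X W \<and> p \<in> W \<and> W \<subseteq> U \<and> (\<exists>k. \<forall>q\<in>W. c q = k)}"
  "c \<otimes>\<^bsub>sections (constant_units_sheaf X) U\<^esub> d = (\<lambda>p\<in>U. c p * d p)"
  by (simp_all add: constant_units_sheaf_def)

lemma sections_binoid_units_sheaf:
  "sections (binoid_units_sheaf M) U = units_of (binoid_sections M U)"
  by (simp add: binoid_units_sheaf_def)

lemma sections_ring_units_sheaf:
  "sections (ring_units_sheaf R) U = units_of (ring_sections R U)"
  by (simp add: ring_units_sheaf_def)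

context ordered_binoid
begin

context
  fixes U :: "('a \<Rightarrow>\<^sub>0 'k::field) set set"
  assumes U: "openin (combinatorial_topology M) U"
begin

private abbreviation (input) "A \<equiv> combinatorial_preimage M U"

lemma preimage_subset_spec: "A \<subseteq> binoid_spec M"
  by (auto simp: punctured_binoid_spec_def)

lemma preimage_contraction:
  assumes "p \<in> A"
  shows "binoid_prime M p" "combinatorial_ideal M p \<in> U"
    "monomial_contraction M (combinatorial_ideal M p :: ('a \<Rightarrow>\<^sub>0 'k) set) = p"
  using assms monomial_contraction_combinatorial_ideal by (auto simp: combinatorial_preimage_eq[OF U])

lemma unit_value_at_contraction:
  assumes s: "s \<in> Units (binoid_sections M A)" and P: "P \<in> U"
  obtains a f where "a \<in> carrier M - monomial_contraction M P" "f \<in> carrier M - monomial_contraction M P"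
    "s (monomial_contraction M P) = fraction M (carrier M - monomial_contraction M P) a f"
    "\<And>c. units_morphism M U (c, s) P = monomial_fraction M P a (c P) f"
proof -
  obtain a f where af: "a \<in> carrier M - monomial_contraction M P" "f \<in> carrier M - monomial_contraction M P"
    "s (monomial_contraction M P) = fraction M (carrier M - monomial_contraction M P) a f"
    by (rule binoid_unit_value[OF preimage_subset_spec s contraction_mem_preimage[OF U P]])
  show thesis
    using af by (intro that[OF af] units_morphism_value[OF combinatorial_open_in_ring_spec[OF U P] P]) auto
qed

lemma units_morphism_in_Units:
  assumes c: "c \<in> carrier (sections (constant_units_sheaf (zariski (binoid_algebra M))) U)"
    and s: "s \<in> Units (binoid_sections M A)"
  shows "units_morphism M U (c, s) \<in> Units (ring_sections (binoid_algebra M) U)"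
proof (rule monomial_sections_in_Units)
  let ?R = "binoid_algebra M :: ('a \<Rightarrow>\<^sub>0 'k) ring"
  interpret R: cring ?R by (rule cring_binoid_algebra)
  show "U \<subseteq> ring_spec ?R"
    using combinatorial_open_in_ring_spec[OF U] by (auto simp: ring_spec_iff)
  show "units_morphism M U (c, s) \<in> extensional U"
    by (rule units_morphism_extensional)
  fix P assume P: "P \<in> U"
  obtain W k where W: "openin (zariski ?R) W" "P \<in> W" "W \<subseteq> U" "\<forall>Q\<in>W. c Q = k"
    using c P unfolding sections_constant_units_sheaf(1) by blast
  have "c P \<noteq> 0"
    using c P unfolding sections_constant_units_sheaf(1) by (auto simp: PiE_iff)
  then have "k \<noteq> 0"
    using W by auto
  let ?p = "monomial_contraction M P"
  have "\<forall>p\<in>A. \<exists>W a f. openin (binoid_spec_topology M) W \<and> p \<in> W \<and> W \<subseteq> A \<and> a \<in> carrier M \<and> f \<in> carrier M \<and>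
      (\<forall>q\<in>W. a \<notin> q \<and> f \<notin> q \<and> s q = fraction M (carrier M - q) a f)"
    using s binoid_units_iff[OF preimage_subset_spec] by blast
  from bspec[OF this contraction_mem_preimage[OF U P]]
  obtain Y a f where Y: "openin (binoid_spec_topology M) Y" "?p \<in> Y" "Y \<subseteq> A" "a \<in> carrier M" "f \<in> carrier M"
      "\<forall>q\<in>Y. a \<notin> q \<and> f \<notin> q \<and> s q = fraction M (carrier M - q) a f"
    by (elim exE conjE) (rule that; assumption)
  obtain g where g: "g \<in> carrier M" "g \<notin> ?p" "{q \<in> binoid_spec M. g \<notin> q} \<subseteq> Y"
    by (rule binoid_spec_basis[OF Y(1,2)])
  \<comment> \<open>\<open>W\<close> makes \<open>c\<close> constant. \<open>D(T^g)\<close> makes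
    the binoid part uniform, since contraction maps it into the neighbourhood \<open>Y\<close> on
    which \<open>s\<close> is the single fraction a/f.\<close>
  define D where "D = W \<inter> basic_open ?R (bmonom M g 1)"
  have "openin (zariski ?R) D"
    unfolding D_def by (intro openin_Int W(1) openin_zariski_basic_open bmonom_closed g(1))
  moreover have "P \<in> D"
    using W(2) P combinatorial_open_in_ring_spec[OF U P] g(1,2)
    by (simp add: D_def ring_spec_iff monomial_contraction_iff)
  moreover have "a \<notin> monomial_contraction M Q \<and> f \<notin> monomial_contraction M Q \<and>
      units_morphism M U (c, s) Q = monomial_fraction M Q a k f" if Q: "Q \<in> D" for Q
  proof -
    have QU: "Q \<in> U" and cQ: "c Q = k" and Qp: "primeideal Q ?R" and gQ: "g \<notin> monomial_contraction M Q"
      using Q W(3,4) g(1) by (auto simp: D_def ring_spec_iff monomial_contraction_iff)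
    then have "monomial_contraction M Q \<in> Y"
      using g(3) binoid_prime_contraction[OF Qp] by (auto simp: binoid_spec_def)
    from bspec[OF Y(6) this] show ?thesis
      using units_morphism_value[OF Qp QU Y(4), of f s c] Y(5) cQ by simp
  qed
  ultimately show "\<exists>W c' a f. openin (zariski ?R) W \<and> P \<in> W \<and> W \<subseteq> U \<and> c' \<noteq> 0 \<and> a \<in> carrier M \<and> f \<in> carrier M \<and>
      (\<forall>Q\<in>W. a \<notin> monomial_contraction M Q \<and> f \<notin> monomial_contraction M Q \<and>
        units_morphism M U (c, s) Q = monomial_fraction M Q a c' f)"
    using W(3) by (intro exI[of _ D] exI[of _ k] exI[of _ a] exI[of _ f] conjI ballI \<open>k \<noteq> 0\<close> Y(4,5))
      (auto simp: D_def)
qed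

lemma units_morphism_mult:
  assumes s: "s \<in> Units (binoid_sections M A)" and t: "t \<in> Units (binoid_sections M A)"
  shows "units_morphism M U (\<lambda>P\<in>U. c P * d P, s \<otimes>\<^bsub>binoid_sections M A\<^esub> t)
    = units_morphism M U (c, s) \<otimes>\<^bsub>ring_sections (binoid_algebra M) U\<^esub> units_morphism M U (d, t)"
proof (rule extensionalityI[OF units_morphism_extensional sections_extensional(3)])
  fix P assume P: "P \<in> U"
  let ?p = "monomial_contraction M P"
  have prime: "primeideal P (binoid_algebra M)"
    by (rule combinatorial_open_in_ring_spec[OF U P])
  note p' = binoid_primeD[OF binoid_prime_contraction[OF prime]]
  obtain a f where af: "a \<in> carrier M - ?p" "f \<in> carrier M - ?p"
    "s ?p = fraction M (carrier M - ?p) a f"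
    "\<And>c. units_morphism M U (c, s) P = monomial_fraction M P a (c P) f"
    by (rule unit_value_at_contraction[OF s P]) blast
  obtain b g where bg: "b \<in> carrier M - ?p" "g \<in> carrier M - ?p"
    "t ?p = fraction M (carrier M - ?p) b g"
    "\<And>c. units_morphism M U (c, t) P = monomial_fraction M P b (c P) g"
    by (rule unit_value_at_contraction[OF t P]) blast
  have "(s \<otimes>\<^bsub>binoid_sections M A\<^esub> t) ?p = fraction M (carrier M - ?p) (a \<otimes> b) (f \<otimes> g)"
    using mult_binoid_sections[OF contraction_mem_preimage[OF U P]] af bg
    by (simp add: frac_mult_fraction[OF p'(4)])
  then show "units_morphism M U (\<lambda>P\<in>U. c P * d P, s \<otimes>\<^bsub>binoid_sections M A\<^esub> t) P =
      (units_morphism M U (c, s) \<otimes>\<^bsub>ring_sections (binoid_algebra M) U\<^esub> units_morphism M U (d, t)) P"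
    using units_morphism_value[OF prime P, of "a \<otimes> b" "f \<otimes> g"] af bg P p'(5)
    by (simp add: mult_ring_sections frac_mult_monomial_fraction[OF prime])
qed

text \<open>\<open>monomial_fraction_eqD\<close> recovers both components from the germ at each
  point.\<close>

lemma units_morphism_inj:
  assumes c: "c \<in> carrier (sections (constant_units_sheaf X) U)" and d: "d \<in> carrier (sections (constant_units_sheaf X) U)"
    and s: "s \<in> Units (binoid_sections M A)" and t: "t \<in> Units (binoid_sections M A)"
    and eq: "units_morphism M U (c, s) = units_morphism M U (d, t)"
  shows "c = d" "s = t"
proof -
  have val: "c P = d P \<and> s (monomial_contraction M P) = t (monomial_contraction M P)" if P: "P \<in> U" for P
  proof -
    let ?p = "monomial_contraction M P"
    have prime: "primeideal P (binoid_algebra M)"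
      by (rule combinatorial_open_in_ring_spec[OF U P])
    note p' = binoid_primeD[OF binoid_prime_contraction[OF prime]]
    obtain a f where af: "a \<in> carrier M - ?p" "f \<in> carrier M - ?p"
      "s ?p = fraction M (carrier M - ?p) a f"
      "\<And>c. units_morphism M U (c, s) P = monomial_fraction M P a (c P) f"
      by (rule unit_value_at_contraction[OF s P]) blast
    obtain b g where bg: "b \<in> carrier M - ?p" "g \<in> carrier M - ?p"
      "t ?p = fraction M (carrier M - ?p) b g"
      "\<And>c. units_morphism M U (c, t) P = monomial_fraction M P b (c P) g"
      by (rule unit_value_at_contraction[OF t P]) blast
    have "c P \<noteq> 0"
      using c P unfolding sections_constant_units_sheaf(1) by (auto simp: PiE_iff)
    moreover have "monomial_fraction M P a (c P) f = monomial_fraction M P b (d P) g"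
      using eq af(4) bg(4) by metis
    ultimately have "c P = d P" "a \<otimes> g = b \<otimes> f"
      using monomial_fraction_eqD[OF prime _ af(1) bg(1) af(2) bg(2)] by auto
    moreover have "fraction M (carrier M - ?p) a f = fraction M (carrier M - ?p) b g"
      using af(1,2) bg(1,2) p'(3) calculation(2)
      by (intro fraction_eqI[OF p'(4), of _ _ _ _ \<one>]) auto
    ultimately show ?thesis
      using af(3) bg(3) by simp
  qed
  show "c = d"
    using c d val unfolding sections_constant_units_sheaf(1) by (auto intro: PiE_ext)
  show "s = t"
  proof (rule extensionalityI)
    show "s \<in> extensional A" "t \<in> extensional A"
      using s t binoid_units_iff[OF preimage_subset_spec] by blast+
    \<comment> \<open>\<open>p\<close> is the contraction of the point of \<open>U\<close> that it
      spans, so the comparison at points of \<open>U\<close> reaches all of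
      \<open>A\<close>.\<close>
    fix p assume "p \<in> A"
    then show "s p = t p"
      using val[of "combinatorial_ideal M p"] preimage_contraction[of p] by simp
  qed
qed

text \<open>Constants and fractions are chosen at each point separately. No compatible choice is
  needed: \<open>monomial_fraction_eqD\<close> forces every choice to agree with the uniform
  description on a basic neighbourhood, so the chosen data are local sections.\<close>

lemma units_morphism_surj:
  assumes r: "r \<in> Units (ring_sections (binoid_algebra M) U)"
  obtains c s where "c \<in> carrier (sections (constant_units_sheaf (zariski (binoid_algebra M))) U)"
    "s \<in> Units (binoid_sections M A)" "units_morphism M U (c, s) = r"
proof -
  let ?R = "binoid_algebra M :: ('a \<Rightarrow>\<^sub>0 'k) ring"
  have ex: "\<exists>g c a f. g \<in> carrier M \<and> P \<in> basic_open ?R (bmonom M g 1) \<and> basic_open ?R (bmonom M g 1) \<subseteq> U \<and>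
      c \<noteq> 0 \<and> a \<in> carrier M \<and> f \<in> carrier M \<and> (\<forall>Q\<in>basic_open ?R (bmonom M g 1).
      a \<notin> monomial_contraction M Q \<and> f \<notin> monomial_contraction M Q \<and> r Q = monomial_fraction M Q a c f)"
    if P: "P \<in> U" for P
  proof -
    obtain g where g: "g \<in> carrier M" "P \<in> basic_open ?R (bmonom M g 1)" "basic_open ?R (bmonom M g 1) \<subseteq> U"
      by (rule combinatorial_open_basis[OF U P])
    obtain c a f where caf: "c \<noteq> 0" "a \<in> carrier M" "f \<in> carrier M"
      "\<And>Q. Q \<in> basic_open ?R (bmonom M g 1) \<Longrightarrow> a \<notin> monomial_contraction M Q \<and>
        f \<notin> monomial_contraction M Q \<and> r Q = monomial_fraction M Q a c f"
      by (rule unit_section_monomial[OF r g(1,3)]) blast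
    have "\<forall>Q\<in>basic_open ?R (bmonom M g 1). a \<notin> monomial_contraction M Q \<and>
        f \<notin> monomial_contraction M Q \<and> r Q = monomial_fraction M Q a c f"
      using caf(4) by blast
    then show ?thesis
      by (intro exI[of _ g] exI[of _ c] exI[of _ a] exI[of _ f] conjI g caf(1-3))
  qed
  have "\<forall>P\<in>U. \<exists>c a f. c \<noteq> 0 \<and> a \<in> carrier M - monomial_contraction M P \<and>
      f \<in> carrier M - monomial_contraction M P \<and> r P = monomial_fraction M P a c f"
  proof
    fix P assume "P \<in> U"
    from ex[OF this] obtain g c a f where *: "P \<in> basic_open ?R (bmonom M g 1)"
      "c \<noteq> 0" "a \<in> carrier M" "f \<in> carrier M" "\<forall>Q\<in>basic_open ?R (bmonom M g 1).
        a \<notin> monomial_contraction M Q \<and> f \<notin> monomial_contraction M Q \<and> r Q = monomial_fraction M Q a c f"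
      by (elim exE conjE) (rule that; assumption)
    from bspec[OF *(5,1)] *(2-4) show "\<exists>c a f. c \<noteq> 0 \<and> a \<in> carrier M - monomial_contraction M P \<and>
        f \<in> carrier M - monomial_contraction M P \<and> r P = monomial_fraction M P a c f"
      by blast
  qed
  then obtain c a f where caf: "\<And>P. P \<in> U \<Longrightarrow> c P \<noteq> 0"
    "\<And>P. P \<in> U \<Longrightarrow> a P \<in> carrier M - monomial_contraction M P"
    "\<And>P. P \<in> U \<Longrightarrow> f P \<in> carrier M - monomial_contraction M P"
    "\<And>P. P \<in> U \<Longrightarrow> r P = monomial_fraction M P (a P) (c P) (f P)"
    by metis
  \<comment> \<open>On \<open>D(T^g)\<close> the chosen constants equal one constant
    \<open>d\<close>, and the chosen binoid fractions all equal b/h, although the chosen numerators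
    and denominators may vary.\<close>
  have local: "\<exists>g d b h. g \<in> carrier M \<and> P \<in> basic_open ?R (bmonom M g 1) \<and> basic_open ?R (bmonom M g 1) \<subseteq> U \<and>
      b \<in> carrier M \<and> h \<in> carrier M \<and> (\<forall>Q\<in>basic_open ?R (bmonom M g 1).
      b \<notin> monomial_contraction M Q \<and> h \<notin> monomial_contraction M Q \<and> r Q = monomial_fraction M Q b d h \<and> c Q = d \<and>
      fraction M (carrier M - monomial_contraction M Q) (a Q) (f Q) = fraction M (carrier M - monomial_contraction M Q) b h)"
    if P: "P \<in> U" for P
  proof -
    from ex[OF P] obtain g d b h where g: "g \<in> carrier M" "P \<in> basic_open ?R (bmonom M g 1)"
      "basic_open ?R (bmonom M g 1) \<subseteq> U" and d: "d \<noteq> 0" "b \<in> carrier M" "h \<in> carrier M"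
      "\<forall>Q\<in>basic_open ?R (bmonom M g 1). b \<notin> monomial_contraction M Q \<and> h \<notin> monomial_contraction M Q \<and>
        r Q = monomial_fraction M Q b d h"
      by (elim exE conjE) (rule that; assumption)
    have "b \<notin> monomial_contraction M Q \<and> h \<notin> monomial_contraction M Q \<and> r Q = monomial_fraction M Q b d h \<and> c Q = d \<and>
      fraction M (carrier M - monomial_contraction M Q) (a Q) (f Q) = fraction M (carrier M - monomial_contraction M Q) b h"
      if Q: "Q \<in> basic_open ?R (bmonom M g 1)" for Q
    proof -
      have QU: "Q \<in> U" using Q g(3) by blast
      have prime: "primeideal Q ?R"
        by (rule combinatorial_open_in_ring_spec[OF U QU])
      note q' = binoid_primeD[OF binoid_prime_contraction[OF prime]]
      note dQ = bspec[OF d(4) Q]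
      have b: "b \<in> carrier M - monomial_contraction M Q" "h \<in> carrier M - monomial_contraction M Q"
        and "monomial_fraction M Q (a Q) (c Q) (f Q) = monomial_fraction M Q b d h"
        using d(2,3) dQ caf(4)[OF QU] by simp_all
      from monomial_fraction_eqD[OF prime caf(1)[OF QU] caf(2)[OF QU] b(1) caf(3)[OF QU] b(2) this(3)]
      have "c Q = d" "a Q \<otimes> h = b \<otimes> f Q" .
      moreover have "fraction M (carrier M - monomial_contraction M Q) (a Q) (f Q) =
          fraction M (carrier M - monomial_contraction M Q) b h"
        using b caf(2,3)[OF QU] q'(3) calculation(2)
        by (intro fraction_eqI[OF q'(4), of _ _ _ _ \<one>]) auto
      ultimately show ?thesis
        using dQ by simp
    qed
    with g d(2,3) show ?thesis
      by (intro exI[of _ g] exI[of _ d] exI[of _ b] exI[of _ h] conjI ballI) simp_all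
  qed
  define c' where "c' = restrict c U"
  define K where "K p = (combinatorial_ideal M p :: ('a \<Rightarrow>\<^sub>0 'k) set)" for p
  \<comment> \<open>Many points of \<open>U\<close> can contract to the same \<open>p\<close>; the
    representative chosen at the combinatorial one, \<open>K p\<close>, is used.\<close>
  define s where "s = (\<lambda>p\<in>A. fraction M (carrier M - p) (a (K p)) (f (K p)))"
  have K_mem: "K q \<in> basic_open ?R (bmonom M g 1) \<and> monomial_contraction M (K q) = q"
    if "binoid_prime M q" "g \<in> carrier M" "g \<notin> q" for q g
  proof -
    have "primeideal (K q) ?R" "monomial_contraction M (K q) = q"
      unfolding K_def using that(1)
      by (rule primeideal_combinatorial_ideal, rule monomial_contraction_combinatorial_ideal)
    then show ?thesis
      using that monomial_contraction_iff[OF that(2), of "K q"] by (simp add: ring_spec_iff)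
  qed
  have "c' \<in> carrier (sections (constant_units_sheaf (zariski ?R)) U)"
    unfolding sections_constant_units_sheaf(1)
  proof (intro CollectI conjI ballI)
    show "c' \<in> U \<rightarrow>\<^sub>E UNIV - {0}"
      using caf(1) by (auto simp: c'_def PiE_iff)
    fix P assume "P \<in> U"
    from local[OF this] obtain g d b h where g: "g \<in> carrier M" "P \<in> basic_open ?R (bmonom M g 1)"
      "basic_open ?R (bmonom M g 1) \<subseteq> U" and d: "\<forall>Q\<in>basic_open ?R (bmonom M g 1).
        b \<notin> monomial_contraction M Q \<and> h \<notin> monomial_contraction M Q \<and> r Q = monomial_fraction M Q b d h \<and> c Q = d \<and>
        fraction M (carrier M - monomial_contraction M Q) (a Q) (f Q) = fraction M (carrier M - monomial_contraction M Q) b h"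
      by (elim exE conjE) (rule that; assumption)
    have "c' Q = d" if "Q \<in> basic_open ?R (bmonom M g 1)" for Q
      using bspec[OF d that] subsetD[OF g(3) that] by (simp add: c'_def)
    then show "\<exists>W. openin (zariski ?R) W \<and> P \<in> W \<and> W \<subseteq> U \<and> (\<exists>k. \<forall>q\<in>W. c' q = k)"
      using g openin_zariski_basic_open[OF bmonom_closed[OF g(1)]]
      by (intro exI[of _ "basic_open ?R (bmonom M g 1)"] conjI exI[of _ d] ballI)
  qed
  moreover have "s \<in> Units (binoid_sections M A)"
    unfolding binoid_units_iff[OF preimage_subset_spec]
  proof (intro conjI ballI)
    show "s \<in> extensional A" by (simp add: s_def)
    fix p assume p: "p \<in> A"
    have KU: "K p \<in> U" and contr: "monomial_contraction M (K p) = p" and prime: "binoid_prime M p"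
      using preimage_contraction[OF p] by (simp_all add: K_def)
    from local[OF KU] obtain g d b h where g: "g \<in> carrier M" "K p \<in> basic_open ?R (bmonom M g 1)"
      "basic_open ?R (bmonom M g 1) \<subseteq> U" and b: "b \<in> carrier M" "h \<in> carrier M" and d: "\<forall>Q\<in>basic_open ?R (bmonom M g 1).
        b \<notin> monomial_contraction M Q \<and> h \<notin> monomial_contraction M Q \<and> r Q = monomial_fraction M Q b d h \<and> c Q = d \<and>
        fraction M (carrier M - monomial_contraction M Q) (a Q) (f Q) = fraction M (carrier M - monomial_contraction M Q) b h"
      by (elim exE conjE) (rule that; assumption)
    let ?W = "{q \<in> binoid_spec M. g \<notin> q}"
    have Wq: "q \<in> A \<and> b \<notin> q \<and> h \<notin> q \<and> s q = fraction M (carrier M - q) b h" if "q \<in> ?W" for q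
    proof -
      have q: "binoid_prime M q" "g \<notin> q"
        using that by (auto simp: binoid_spec_def)
      have Kq: "K q \<in> basic_open ?R (bmonom M g 1)" "monomial_contraction M (K q) = q"
        using K_mem[OF q(1) g(1) q(2)] by blast+
      have "q \<in> A"
        using subsetD[OF g(3) Kq(1)] q by (simp add: combinatorial_preimage_eq[OF U] K_def)
      then show ?thesis
        using bspec[OF d Kq(1)] Kq(2) by (simp add: s_def)
    qed
    have "g \<notin> p"
      using g(1,2) contr monomial_contraction_iff[OF g(1), of "K p"] by simp
    then have "p \<in> ?W"
      using prime by (simp add: binoid_spec_def)
    moreover have "?W \<subseteq> A"
      using Wq by blast
    moreover have "\<forall>q\<in>?W. b \<notin> q \<and> h \<notin> q \<and> s q = fraction M (carrier M - q) b h"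
      using Wq by blast
    ultimately show "\<exists>W a f. openin (binoid_spec_topology M) W \<and> p \<in> W \<and> W \<subseteq> A \<and> a \<in> carrier M \<and> f \<in> carrier M \<and>
        (\<forall>q\<in>W. a \<notin> q \<and> f \<notin> q \<and> s q = fraction M (carrier M - q) a f)"
      using openin_binoid_spec_basic[OF g(1)] b
      by (intro exI[of _ ?W] exI[of _ b] exI[of _ h] conjI)
  qed
  moreover have "units_morphism M U (c', s) = r"
  proof (rule extensionalityI[OF units_morphism_extensional])
    show "r \<in> extensional U"
      using r by (auto simp: Units_def ring_sections_def fraction_sections_def PiE_iff)
    fix P assume P: "P \<in> U"
    let ?p = "monomial_contraction M P"
    have prime: "primeideal P ?R"
      by (rule combinatorial_open_in_ring_spec[OF U P])
    note bp = binoid_prime_contraction[OF prime]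
    from local[OF P] obtain g d b h where g: "g \<in> carrier M" "P \<in> basic_open ?R (bmonom M g 1)"
      "basic_open ?R (bmonom M g 1) \<subseteq> U" and b: "b \<in> carrier M" "h \<in> carrier M" and d: "\<forall>Q\<in>basic_open ?R (bmonom M g 1).
        b \<notin> monomial_contraction M Q \<and> h \<notin> monomial_contraction M Q \<and> r Q = monomial_fraction M Q b d h \<and> c Q = d \<and>
        fraction M (carrier M - monomial_contraction M Q) (a Q) (f Q) = fraction M (carrier M - monomial_contraction M Q) b h"
      by (elim exE conjE) (rule that; assumption)
    have "g \<notin> ?p"
      using g(1,2) by (simp add: monomial_contraction_iff)
    \<comment> \<open>The value of \<open>s\<close> was chosen at \<open>K ?p\<close>, not at
      \<open>P\<close>. Both points lie in \<open>D(T^g)\<close>, so both are governed by the same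
      fraction b/h.\<close>
    then have K: "K ?p \<in> basic_open ?R (bmonom M g 1)" "monomial_contraction M (K ?p) = ?p"
      using K_mem[OF bp g(1)] by blast+
    have "s ?p = fraction M (carrier M - ?p) b h"
      using bspec[OF d K(1)] K(2) contraction_mem_preimage[OF U P] by (simp add: s_def)
    then show "units_morphism M U (c', s) P = r P"
      using units_morphism_value[OF prime P b(1), of h s c'] bspec[OF d g(2)] b(2) P by (simp add: c'_def)
  qed
  ultimately show thesis
    by (rule that)
qed

end

theorem presheaf_iso_units:
  "presheaf_iso (combinatorial_topology M)
    (presheaf_sum (constant_units_sheaf (zariski (binoid_algebra M :: ('a \<Rightarrow>\<^sub>0 'k::field) ring)))
      (pushforward (punctured_binoid_spec M) (combinatorial_ideal M) (binoid_units_sheaf M)))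
    (ring_units_sheaf (binoid_algebra M)) (units_morphism M)"
    (is "presheaf_iso ?X (presheaf_sum ?C ?B) ?O _")
  unfolding presheaf_iso_def
proof (intro conjI allI impI)
  fix U :: "('a \<Rightarrow>\<^sub>0 'k) set set"
  assume U: "openin ?X U"
  have car: "carrier (sections (presheaf_sum ?C ?B) U)
      = carrier (sections ?C U) \<times> Units (binoid_sections M (combinatorial_preimage M U))"
    "carrier (sections ?O U) = Units (ring_sections (binoid_algebra M) U)"
    by (simp_all add: presheaf_sum_def pushforward_def sections_binoid_units_sheaf
        sections_ring_units_sheaf units_of_carrier)
  show "units_morphism M U \<in> iso (sections (presheaf_sum ?C ?B) U) (sections ?O U)"
    unfolding iso_def hom_def bij_betw_def
  proof (intro CollectI conjI ballI funcsetI)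
    fix x assume "x \<in> carrier (sections (presheaf_sum ?C ?B) U)"
    then show "units_morphism M U x \<in> carrier (sections ?O U)"
      using units_morphism_in_Units[OF U] unfolding car by auto
  next
    fix x y assume "x \<in> carrier (sections (presheaf_sum ?C ?B) U)" "y \<in> carrier (sections (presheaf_sum ?C ?B) U)"
    then show "units_morphism M U (x \<otimes>\<^bsub>sections (presheaf_sum ?C ?B) U\<^esub> y)
        = units_morphism M U x \<otimes>\<^bsub>sections ?O U\<^esub> units_morphism M U y"
      using units_morphism_mult[OF U] unfolding car
      by (auto simp: presheaf_sum_def pushforward_def sections_binoid_units_sheaf
        sections_ring_units_sheaf units_of_mult sections_constant_units_sheaf(2) mult_DirProd)
  next
    show "inj_on (units_morphism M U) (carrier (sections (presheaf_sum ?C ?B) U))"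
      unfolding car using units_morphism_inj[OF U] by (auto simp: inj_on_def)
    show "units_morphism M U ` carrier (sections (presheaf_sum ?C ?B) U) = carrier (sections ?O U)"
    proof
      show "units_morphism M U ` carrier (sections (presheaf_sum ?C ?B) U) \<subseteq> carrier (sections ?O U)"
        using units_morphism_in_Units[OF U] unfolding car by auto
      show "carrier (sections ?O U) \<subseteq> units_morphism M U ` carrier (sections (presheaf_sum ?C ?B) U)"
      proof
        fix r assume "r \<in> carrier (sections ?O U)"
        then obtain c s where "c \<in> carrier (sections ?C U)" "s \<in> Units (binoid_sections M (combinatorial_preimage M U))"
          "units_morphism M U (c, s) = r"
          unfolding car by (rule units_morphism_surj[OF U])
        then show "r \<in> units_morphism M U ` carrier (sections (presheaf_sum ?C ?B) U)"
          unfolding car by (intro image_eqI[of _ _ "(c, s)"]) auto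
      qed
    qed
  qed
next
  fix U V :: "('a \<Rightarrow>\<^sub>0 'k) set set" and x
  assume U: "openin ?X U" and V: "openin ?X V" "V \<subseteq> U"
    and x: "x \<in> carrier (sections (presheaf_sum ?C ?B) U)"
  obtain c s where cs: "x = (c, s)" "s \<in> Units (binoid_sections M (combinatorial_preimage M U))"
    using x by (auto simp: presheaf_sum_def pushforward_def sections_binoid_units_sheaf units_of_carrier)
  have res: "res (presheaf_sum ?C ?B) U V x = (restrict c V, restrict s (combinatorial_preimage M V))"
    by (simp add: cs presheaf_sum_def pushforward_def constant_units_sheaf_def binoid_units_sheaf_def)
  show "units_morphism M V (res (presheaf_sum ?C ?B) U V x) = res ?O U V (units_morphism M U x)"
  proof (rule extensionalityI[OF units_morphism_extensional])
    have res': "res ?O U V r = restrict r V" for r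
      by (simp add: ring_units_sheaf_def)
    then show "res ?O U V (units_morphism M U x) \<in> extensional V"
      by simp
    fix P assume P: "P \<in> V"
    let ?p = "monomial_contraction M P"
    have PU: "P \<in> U" using P V(2) by blast
    obtain a f where af: "a \<in> carrier M - ?p" "f \<in> carrier M - ?p" "s ?p = fraction M (carrier M - ?p) a f"
      "\<And>c. units_morphism M U (c, s) P = monomial_fraction M P a (c P) f"
      by (rule unit_value_at_contraction[OF U cs(2) PU]) blast
    have "restrict s (combinatorial_preimage M V) ?p = fraction M (carrier M - ?p) a f"
      using contraction_mem_preimage[OF V(1) P] af(3) by simp
    then have "units_morphism M V (restrict c V, restrict s (combinatorial_preimage M V)) P
        = monomial_fraction M P a (c P) f"
      using units_morphism_value[OF combinatorial_open_in_ring_spec[OF V(1) P] P, of a f _ "restrict c V"] af(1,2) P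
      by simp
    then show "units_morphism M V (res (presheaf_sum ?C ?B) U V x) P = res ?O U V (units_morphism M U x) P"
      unfolding res res' using P af(4) by (simp add: cs(1))
  qed
qed

end

section \<open>Simplicial binoids\<close>

lemma free_binoid_simps:
  "x \<in> carrier (free_binoid V) \<longleftrightarrow> (case x of None \<Rightarrow> True | Some m \<Rightarrow> set_mset m \<subseteq> V)"
  "Some m \<otimes>\<^bsub>free_binoid V\<^esub> Some k = Some (m + k)"
  "None \<otimes>\<^bsub>free_binoid V\<^esub> x = None" "x \<otimes>\<^bsub>free_binoid V\<^esub> None = None"
  "\<one>\<^bsub>free_binoid V\<^esub> = Some {#}" "infty (free_binoid V) = None"
  by (auto simp: free_binoid_def split: option.splits)

lemma inj_on_image_mset:
  assumes "inj_on f A"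
  shows "inj_on (image_mset f) {m. set_mset m \<subseteq> A}"
proof (rule inj_on_inverseI)
  fix m assume "m \<in> {m. set_mset m \<subseteq> A}"
  then have "image_mset (inv_into A f \<circ> f) m = image_mset id m"
    using inv_into_f_f[OF assms] by (intro image_mset_cong) auto
  then show "image_mset (inv_into A f) (image_mset f m) = m"
    by (simp add: multiset.map_comp)
qed

context
  fixes V :: "'v set" and \<Delta> :: "'v set set"
  assumes complex: "abstract_simplicial_complex V \<Delta>"
begin

private abbreviation (input) "r \<equiv>
  generated_congruence (free_binoid V) {(Some (mset_set F), None) | F. F \<subseteq> V \<and> F \<notin> \<Delta>}"

private abbreviation (input) "M \<equiv> simplicial_binoid V \<Delta>"

lemma face_subset: "F \<in> \<Delta> \<Longrightarrow> G \<subseteq> F \<Longrightarrow> G \<in> \<Delta>"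
  and face_carrier: "F \<in> \<Delta> \<Longrightarrow> F \<subseteq> V" and finite_vertices: "finite V"
  using complex by (auto simp: abstract_simplicial_complex_def)

text \<open>The congruence merely collapses all multisets with non-face support into the absorbing
  class. Such a multiset is a multiple of the square-free monomial of its support, which is a
  defining relation; conversely, supports only grow under multiplication and faces are closed under
  subsets, so nothing else is identified.\<close>

lemma simplicial_congruence_iff:
  "(x, y) \<in> r \<longleftrightarrow> x \<in> carrier (free_binoid V) \<and> y \<in> carrier (free_binoid V) \<and>
    (x = y \<or> (\<forall>m. x = Some m \<longrightarrow> set_mset m \<notin> \<Delta>) \<and> (\<forall>m. y = Some m \<longrightarrow> set_mset m \<notin> \<Delta>))"
proof -
  interpret F: binoid "free_binoid V" by (rule binoid_free_binoid)
  let ?nf = "\<lambda>x. \<forall>m. x = Some m \<longrightarrow> set_mset m \<notin> \<Delta>"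
  have None: "(x, None) \<in> r" if x: "x \<in> carrier (free_binoid V)" "?nf x" for x
  proof (cases x)
    case None
    then show ?thesis
      using x by (auto intro: generated_congruence.refl)
  next
    case (Some m)
    let ?F = "set_mset m"
    have m: "?F \<subseteq> V" "?F \<notin> \<Delta>"
      using x Some by (auto simp: free_binoid_simps)
    have "(Some (mset_set ?F), None) \<in> r"
      using m by (intro generated_congruence.base) (auto simp: free_binoid_simps)
    then have "(Some (mset_set ?F) \<otimes>\<^bsub>free_binoid V\<^esub> Some (m - mset_set ?F),
        None \<otimes>\<^bsub>free_binoid V\<^esub> Some (m - mset_set ?F)) \<in> r"
      using m by (intro generated_congruence.cong) (auto simp: free_binoid_simps dest: in_diffD)
    moreover have "mset_set ?F + (m - mset_set ?F) = m"
      by (intro subset_mset.add_diff_inverse mset_set_set_mset_msubset)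
    ultimately show ?thesis
      using Some by (simp add: free_binoid_simps)
  qed
  have "x = y \<or> ?nf x \<and> ?nf y" if "(x, y) \<in> r"
    using that
  proof induction
    \<comment> \<open>Finiteness of \<open>V\<close> enters here: \<open>mset_set F\<close> has
      support \<open>F\<close> only for finite \<open>F\<close>.\<close>
    case (base x y)
    then show ?case
      using finite_subset[OF _ finite_vertices] by auto
  next
    case (cong x y z)
    have "?nf (x \<otimes>\<^bsub>free_binoid V\<^esub> z)" if "?nf x" for x
      using that face_subset by (cases x; cases z) (auto simp: free_binoid_simps)
    then show ?case
      using cong by blast
  qed auto
  moreover have "(x, y) \<in> r" if "x \<in> carrier (free_binoid V)" "y \<in> carrier (free_binoid V)" "?nf x" "?nf y"
    by (rule generated_congruence.trans[OF None[OF that(1,3)] generated_congruence.sym[OF None[OF that(2,4)]]])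
  moreover have "(x, x) \<in> r" if "x \<in> carrier (free_binoid V)"
    by (rule generated_congruence.refl[OF that])
  moreover note F.generated_congruence_subset[of x y]
  ultimately show ?thesis
    by blast
qed

lemma simplicial_class:
  assumes "set_mset m \<subseteq> V"
  shows "r `` {Some m} = (if set_mset m \<in> \<Delta> then {Some m} else infty M)"
proof -
  define q where "q = r"
  have infty: "infty M = q `` {None}"
    by (simp add: simplicial_binoid_def quotient_binoid_def free_binoid_simps q_def)
  have mem: "(Some m, y) \<in> q \<longleftrightarrow> (if set_mset m \<in> \<Delta> then y = Some m else (None, y) \<in> q)" for y
    unfolding q_def simplicial_congruence_iff using assms by (cases y) (auto simp: free_binoid_simps(1))
  have "q `` {Some m} = (if set_mset m \<in> \<Delta> then {Some m} else q `` {None})"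
    by (rule Set.set_eqI) (simp add: mem)
  then show ?thesis
    unfolding infty by (simp only: q_def)
qed

lemma simplicial_infty: "None \<in> infty M"
  by (auto simp: simplicial_binoid_def quotient_binoid_def free_binoid_simps simplicial_congruence_iff)

lemma simplicial_carrier: "carrier M = insert (infty M) {{Some m} | m. set_mset m \<in> \<Delta>}"
proof -
  have "carrier M = (\<lambda>x. r `` {x}) ` carrier (free_binoid V)"
    by (auto simp: simplicial_binoid_def quotient_binoid_def quotient_def)
  also have "carrier (free_binoid V) = insert None (Some ` {m. set_mset m \<subseteq> V})"
    by (simp add: free_binoid_def)
  also have "(\<lambda>x. r `` {x}) ` \<dots> = insert (infty M) ((\<lambda>m. r `` {Some m}) ` {m. set_mset m \<subseteq> V})"
    by (auto simp: simplicial_binoid_def quotient_binoid_def free_binoid_simps)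
  also have "\<dots> = insert (infty M) {{Some m} | m. set_mset m \<in> \<Delta>}"
    using face_carrier by (auto simp: simplicial_class)
  finally show ?thesis .
qed

lemma simplicial_mult:
  assumes "set_mset m \<in> \<Delta>" "set_mset k \<in> \<Delta>"
  shows "{Some m} \<otimes>\<^bsub>M\<^esub> {Some k} = (if set_mset (m + k) \<in> \<Delta> then {Some (m + k)} else infty M)"
proof -
  interpret F: binoid "free_binoid V" by (rule binoid_free_binoid)
  have V: "set_mset m \<subseteq> V" "set_mset k \<subseteq> V"
    using assms face_carrier by auto
  then have "r `` {Some m} \<otimes>\<^bsub>M\<^esub> r `` {Some k} = r `` {Some (m + k)}"
    unfolding simplicial_binoid_def
    by (subst F.quotient_binoid_mult_class) (auto simp: free_binoid_simps)
  then show ?thesis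
    using V assms by (simp add: simplicial_class)
qed

text \<open>The assumption excludes the degenerate case of no faces at all, which the definition of
  a complex allows for an empty vertex set; the binoid is then zero.\<close>

lemma simplicial_one: "{} \<in> \<Delta> \<Longrightarrow> \<one>\<^bsub>M\<^esub> = {Some {#}}"
proof -
  assume "{} \<in> \<Delta>"
  moreover have "\<one>\<^bsub>M\<^esub> = r `` {Some {#}}"
    by (simp add: simplicial_binoid_def quotient_binoid_def free_binoid_simps)
  ultimately show ?thesis
    by (simp add: simplicial_class)
qed

text \<open>Numbering the vertices turns monomials into multisets of natural numbers, and the
  multiset order on these is total and compatible with addition. The product of two monomials is
  either their multiset sum or \<open>infty M\<close>, which gives additivity and trivial
  units.\<close>

lemma ordered_binoid_simplicial_binoid:
  obtains \<rho> :: "'v multiset option set \<Rightarrow> nat multiset" where "ordered_binoid M \<rho>"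
proof -
  interpret binoid M by (rule binoid_simplicial_binoid)
  obtain \<iota> :: "'v \<Rightarrow> nat" where \<iota>: "inj_on \<iota> V"
    using finite_imp_inj_to_nat_seg[OF finite_vertices] by blast
  \<comment> \<open>Away from \<open>infty M\<close> every class is a singleton
    \<open>{Some m}\<close>, from which \<open>m\<close> is extracted. The value at
    \<open>infty M\<close> is arbitrary; the axioms do not constrain it.\<close>
  define \<rho> where "\<rho> X = image_mset \<iota> (the (the_elem X))" for X :: "'v multiset option set"
  have \<rho>: "\<rho> {Some m} = image_mset \<iota> m" for m
    by (simp add: \<rho>_def)
  have ne: "{Some m} \<noteq> infty M" for m
    using simplicial_infty by auto
  have infty: "infty M \<otimes>\<^bsub>M\<^esub> x = infty M" if "x \<in> carrier M" for x
    using m_comm[of x "infty M"] that by simp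
  have face: "\<exists>m. x = {Some m} \<and> set_mset m \<in> \<Delta>" if "x \<in> carrier M" "x \<noteq> infty M" for x
    using that unfolding simplicial_carrier by blast
  have "ordered_binoid M \<rho>"
  proof unfold_locales
    show "Units M \<subseteq> {\<one>\<^bsub>M\<^esub>}"
    proof (cases "{} \<in> \<Delta>")
      \<comment> \<open>Without faces the binoid has one element, which is both
        \<open>\<one>\<close> and \<open>infty M\<close>.\<close>
      case False
      then have "\<Delta> = {}"
        using face_subset by blast
      then have "carrier M = {infty M}"
        using simplicial_carrier by simp
      then show ?thesis
        using one_closed by (auto simp: Units_def)
    next
      case True
      show ?thesis
      proof
        fix x assume "x \<in> Units M"
        then obtain y where xy: "x \<in> carrier M" "y \<in> carrier M" "x \<otimes>\<^bsub>M\<^esub> y = {Some {#}}"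
          using True by (auto simp: Units_def simplicial_one)
        then have "x \<noteq> infty M" "y \<noteq> infty M"
          using infty[of y] infty_absorb[of x] ne[of "{#}"] by metis+
        then obtain m k where "x = {Some m}" "y = {Some k}" "set_mset m \<in> \<Delta>" "set_mset k \<in> \<Delta>"
          using face xy(1,2) by blast
        then have "m = {#}"
          using xy ne[of "{#}"] by (auto simp: simplicial_mult split: if_splits)
        then show "x \<in> {\<one>\<^bsub>M\<^esub>}"
          using True \<open>x = _\<close> by (simp add: simplicial_one)
      qed
    qed
    show "\<rho> (a \<otimes>\<^bsub>M\<^esub> b) = \<rho> a + \<rho> b"
      if "a \<in> carrier M" "b \<in> carrier M" "a \<otimes>\<^bsub>M\<^esub> b \<noteq> infty M" for a b
    proof -
      note ab = that
      have "a \<noteq> infty M" "b \<noteq> infty M"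
        using ab infty infty_absorb by auto
      then obtain m k where "a = {Some m}" "b = {Some k}" "set_mset m \<in> \<Delta>" "set_mset k \<in> \<Delta>"
        using face ab(1,2) by blast
      then show ?thesis
        using ab by (auto simp: simplicial_mult \<rho> split: if_splits)
    qed
    show "inj_on \<rho> (carrier M - {infty M})"
    proof (rule inj_onI)
      fix x y assume *: "x \<in> carrier M - {infty M}" "y \<in> carrier M - {infty M}" "\<rho> x = \<rho> y"
      then obtain m k where "x = {Some m}" "y = {Some k}" "set_mset m \<in> \<Delta>" "set_mset k \<in> \<Delta>"
        using face by blast
      then show "x = y"
        using * inj_onD[OF inj_on_image_mset[OF \<iota>], of m k] face_carrier by (simp add: \<rho>)
    qed
    fix a assume "a \<in> carrier M" "a \<noteq> infty M"
    then obtain m where m: "a = {Some m}" "set_mset m \<in> \<Delta>"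
      using face by blast
    \<comment> \<open>The monomials supported on the face \<open>set_mset m\<close>. The complement
      is the prime generated by the vertices outside this face, together with
      \<open>infty M\<close>; it avoids \<open>a\<close>.\<close>
    define S where "S = {{Some k} | k. set_mset k \<subseteq> set_mset m}"
    have S: "S \<subseteq> carrier M" "infty M \<notin> S"
      using face_subset[OF m(2)] ne by (auto simp: S_def simplicial_carrier)
    have "submonoid S M"
    proof
      show "x \<otimes>\<^bsub>M\<^esub> y \<in> S" if xy: "x \<in> S" "y \<in> S" for x y
      proof -
        obtain k l where "x = {Some k}" "y = {Some l}" "set_mset k \<subseteq> set_mset m" "set_mset l \<subseteq> set_mset m"
          using xy by (auto simp: S_def)
        then show ?thesis
          using face_subset[OF m(2)] by (auto simp: simplicial_mult S_def)
      qed
      show "\<one>\<^bsub>M\<^esub> \<in> S"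
        using face_subset[OF m(2), of "{}"] by (simp add: simplicial_one S_def)
    qed (rule S)
    moreover have "x \<otimes>\<^bsub>M\<^esub> y \<notin> S" if xy: "x \<in> carrier M - S" "y \<in> carrier M" for x y
    proof
      assume xyS: "x \<otimes>\<^bsub>M\<^esub> y \<in> S"
      then have "x \<noteq> infty M" "y \<noteq> infty M"
        using infty[of y] infty_absorb[of x] S xy by auto
      then obtain k l where kl: "x = {Some k}" "y = {Some l}" "set_mset k \<in> \<Delta>" "set_mset l \<in> \<Delta>"
        using face xy by blast
      then have "x \<otimes>\<^bsub>M\<^esub> y = {Some (k + l)}"
        using xyS S(2) by (auto simp: simplicial_mult split: if_splits)
      then have "x \<in> S"
        using xyS kl(1) by (auto simp: S_def)
      then show False
        using xy by simp
    qed
    ultimately have "binoid_prime M (carrier M - S)"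
      using S by (auto simp: binoid_prime_def binoid_ideal_def double_diff)
    moreover have "a \<notin> carrier M - S"
      using m by (auto simp: S_def)
    ultimately show "\<exists>p. binoid_prime M p \<and> a \<notin> p"
      by blast
  qed
  then show thesis
    by (rule that)
qed

end

theorem theorem4p28:
  fixes V :: "'v set" and \<Delta> :: "'v set set"
    and M :: "'v multiset option set binoid"
    and K_M :: "('v multiset option set \<Rightarrow>\<^sub>0 'k::field) ring"
  assumes "abstract_simplicial_complex V \<Delta>"
  defines "M \<equiv> simplicial_binoid V \<Delta>"
    and "K_M \<equiv> binoid_algebra M"
  shows "presheaf_iso (combinatorial_topology M)
    (presheaf_sum (constant_units_sheaf (zariski K_M))
      (pushforward (punctured_binoid_spec M) (combinatorial_ideal M) (binoid_units_sheaf M)))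
    (ring_units_sheaf K_M)
    (sum_morphism (ring_units_sheaf K_M) (constants_to_units M) (binoid_units_to_units M))"
proof -
  obtain \<rho> :: "'v multiset option set \<Rightarrow> nat multiset" where "ordered_binoid M \<rho>"
    unfolding M_def by (rule ordered_binoid_simplicial_binoid[OF assms(1)])
  then show ?thesis
    unfolding K_M_def by (rule ordered_binoid.presheaf_iso_units)
qed

end
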